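(* Let $n\ge 1$, let $G$ be a connected compact Lie group and $H,K\subseteq G$ subgroups. Let $\mathbf{K}=H\times G^{\times(n-1)}\times K$ act on $G^{\times n}$ by $$\bm{k}\cdot\bm{g}'=(hg_1'g_2^{-1},\,g_2g_2'g_3^{-1},\ldots,g_ng_n'k^{-1}),\qquad \bm{k}=(h,g_2,\ldots,g_n,k)\in\mathbf{K},\ \bm{g}'=(g'_1,\ldots,g_n')\in G^{\times n}.$$ Let $S_i$ ($1<i\le n$) be finite dimensional $G$-representations, $L$ a finite dimensional $H$-representation, $N$ a finite dimensional $K$-representation, $\underline{S}=S_2\otimes\cdots\otimes S_n$ and $\mathbf{S}=L\otimes\underline{S}\otimes N$. Let $\pi_i:G\to\mathrm{GL}(M^{\pi_i})$ ($1\le i\le n$) be irreducible finite dimensional representations, and let $\bm\pi$ be the associated tensor product representation of $G^{\times n}$. Then there is a linear isomorphism $$\mathrm{Hom}_H(M^{\pi_1},L)\otimes\bigotimes_{i=2}^n\mathrm{Hom}_G\bigl(M^{\pi_i},M^{\pi_{i-1}}\otimes S_i\bigr)\otimes\mathrm{Hom}_K(N^*,M^{\pi_n})\overset{\sim}{\longrightarrow}\bigl(\mathcal{R}^{\bm\pi}(G^{\times n})\otimes\mathbf{S}\bigr)^{\mathbf{K}}$$ mapping $\Theta\otimes\bigl(\bigotimes_{i=2}^n\Phi_i\bigr)\otimes\Xi$ to the function $f^{\bm\pi}_{\Theta,\bm\Phi,\Xi}\in\bigl(\mathcal{R}^{\bm\pi}(G^{\times n})\otimes\mathbf{S}\bigr)^{\mathbf{K}}$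 defined by $$f^{\bm\pi}_{\Theta,\bm\Phi,\Xi}(\bm g):=Q_{L\otimes\underline{S},N}\Bigl((\Theta\pi_1(g_1)\otimes\mathrm{id}_{\underline{S}})(\Phi_2\pi_2(g_2)\otimes\mathrm{id}_{S_3\otimes\cdots\otimes S_n})\cdots(\Phi_{n-1}\pi_{n-1}(g_{n-1})\otimes\mathrm{id}_{S_n})\,\Phi_n\pi_n(g_n)\,\Xi\Bigr).$$
   Context: Representations are complex; $G$-representations are continuous. $M^{\pi_1}$ (resp. $M^{\pi_n}$) is viewed as an $H$- (resp. $K$-) representation by restriction, and $M^{\pi_{i-1}}\otimes S_i$ carries the diagonal $G$-action. For $n=1$, $\underline{S}=\mathbb{C}$ and the argument of $Q_{L\otimes\underline S,N}$ is $\Theta\pi_1(g_1)\Xi$. (This is the setting of the linearly ordered linear graph with $n$ edges $e_i$ from $v_i$ to $v_{i+1}$, with local gauge groups $H$ at $v_1$, $G$ at $v_2,\ldots,v_n$, and $K$ at $v_{n+1}$.) $Q_{L\otimes\underline{S},N}:\mathrm{Hom}(N^*,L\otimes\underline{S})\overset{\sim}{\to}\mathbf{S}=L\otimes\underline{S}\otimes N$ is the linear isomorphism $Q_{L\otimes\underline{S},N}(T)=\sum_jT(n_j^* )\otimes n_j$, with $\{n_j\}$ a basis of $N$ and $\{n_j^*\}$ the dual basis of $N^*$. $\bm\pi(\bm g)=\pi_1(g_1)\otimes\cdots\otimes\pi_n(g_n)$ on $M^{\pi_1}\otimes\cdots\otimes M^{\pi_n}$; $\mathcal{R}^{\bm\pi}(G^{\times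 n})$ is the span of its matrix coefficients $\bm g\mapsto\bm\phi(\bm\pi(\bm g)\bm m)$. $\mathbf{K}$ acts on $\mathbf{S}$ by the tensor product representation $\bm\sigma$ (each factor of $\mathbf{K}$ acting on the corresponding tensor factor of $L\otimes S_2\otimes\cdots\otimes S_n\otimes N$), and on $\mathbf{S}$-valued functions by $(\bm k\cdot f)(\bm g)=\bm\sigma(\bm k)f(\bm k^{-1}\cdot\bm g)$; the superscript $\mathbf{K}$ denotes invariants. *)

theory Defs
  imports "HOL-Analysis.Analysis" "HOL-Algebra.Group" "HOL-Library.Function_Algebras"
begin

section \<open>Lie groups\<close>

primrec Ck_on :: "nat \<Rightarrow> 'a::real_normed_vector set \<Rightarrow> ('a \<Rightarrow> 'b::real_normed_vector) \<Rightarrow> bool" where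
  "Ck_on 0 U f \<longleftrightarrow> continuous_on U f"
| "Ck_on (Suc k) U f \<longleftrightarrow> (\<forall>x\<in>U. f differentiable (at x)) \<and>
     (\<forall>v. Ck_on k U (\<lambda>x. frechet_derivative f (at x) v))"

definition smooth_on :: "'a::real_normed_vector set \<Rightarrow> ('a \<Rightarrow> 'b::real_normed_vector) \<Rightarrow> bool" where
  "smooth_on U f \<longleftrightarrow> open U \<and> (\<forall>k. Ck_on k U f)"

text \<open>
  The model space \<open>'e\<close> is a finite-dimensional normed space rather than a Euclidean space, because
  the class \<open>euclidean_space\<close> excludes dimension 0 and hence the trivial Lie group.
\<close>

locale lie_group = group G for G :: "'g monoid" (structure) +
  fixes T :: "'g topology" and \<A> :: "('g set \<times> ('g \<Rightarrow> 'e::real_normed_vector)) set"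
  assumes finite_dimensional_model: "\<exists>B::'e set. finite B \<and> span B = UNIV"
    and topspace: "topspace T = carrier G"
    and Hausdorff: "Hausdorff_space T"
    and second_countable: "second_countable T"
    and charts: "\<And>U \<phi>. (U, \<phi>) \<in> \<A> \<Longrightarrow>
          openin T U \<and> open (\<phi> ` U) \<and> homeomorphic_map (subtopology T U) (top_of_set (\<phi> ` U)) \<phi>"
    and charts_cover: "(\<Union>(U, \<phi>)\<in>\<A>. U) = carrier G"
    and transition_smooth: "\<And>U \<phi> V \<psi>. (U, \<phi>) \<in> \<A> \<Longrightarrow> (V, \<psi>) \<in> \<A> \<Longrightarrow>
          smooth_on (\<phi> ` (U \<inter> V)) (\<psi> \<circ> inv_into U \<phi>)"
    and mult_continuous: "continuous_map (prod_topology T T) T (\<lambda>(x, y). x \<otimes> y)"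
    and inv_continuous: "continuous_map T T (\<lambda>x. inv x)"
    and mult_smooth: "\<And>U \<phi> V \<psi> W \<zeta>. (U, \<phi>) \<in> \<A> \<Longrightarrow> (V, \<psi>) \<in> \<A> \<Longrightarrow> (W, \<zeta>) \<in> \<A> \<Longrightarrow>
          smooth_on {(\<phi> x, \<psi> y) | x y. x \<in> U \<and> y \<in> V \<and> x \<otimes> y \<in> W}
            (\<lambda>(a, b). \<zeta> (inv_into U \<phi> a \<otimes> inv_into V \<psi> b))"
    and inv_smooth: "\<And>U \<phi> W \<zeta>. (U, \<phi>) \<in> \<A> \<Longrightarrow> (W, \<zeta>) \<in> \<A> \<Longrightarrow>
          smooth_on {\<phi> x | x. x \<in> U \<and> inv x \<in> W} (\<lambda>a. \<zeta> (inv (inv_into U \<phi> a)))"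


section \<open>Complex vector spaces\<close>

class complex_vector = ab_group_add +
  fixes scaleC :: "complex \<Rightarrow> 'a \<Rightarrow> 'a" (infixr \<open>*\<^sub>C\<close> 75)
  assumes scaleC_add_right: "c *\<^sub>C (x + y) = c *\<^sub>C x + c *\<^sub>C y"
    and scaleC_add_left: "(c + d) *\<^sub>C x = c *\<^sub>C x + d *\<^sub>C x"
    and scaleC_scaleC: "c *\<^sub>C d *\<^sub>C x = (c * d) *\<^sub>C x"
    and scaleC_one: "1 *\<^sub>C x = x"

global_interpretation complex_vector: vector_space "scaleC :: complex \<Rightarrow> 'a \<Rightarrow> 'a::complex_vector"
  by standard (rule scaleC_add_right scaleC_add_left scaleC_scaleC scaleC_one)+

instantiation complex :: complex_vector
begin
definition scaleC_complex_def: "c *\<^sub>C x = c * x" for c x :: complex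
instance by standard (simp_all add: scaleC_complex_def algebra_simps)
end

instantiation "fun" :: (type, complex_vector) complex_vector
begin
definition scaleC_fun_def: "c *\<^sub>C f = (\<lambda>x. c *\<^sub>C f x)"
instance
  by standard (simp_all add: scaleC_fun_def fun_eq_iff scaleC_add_right scaleC_add_left
      scaleC_scaleC scaleC_one)
end

abbreviation csubspace :: "'a::complex_vector set \<Rightarrow> bool" where
  "csubspace \<equiv> complex_vector.subspace"

abbreviation cspan :: "'a::complex_vector set \<Rightarrow> 'a set" where
  "cspan \<equiv> complex_vector.span"

abbreviation clinear :: "('a::complex_vector \<Rightarrow> 'b::complex_vector) \<Rightarrow> bool" where
  "clinear \<equiv> Vector_Spaces.linear scaleC scaleC"

text \<open>
  The vector spaces of interest are subspaces of a type of class \<open>complex_vector\<close>. A linear map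
  between subspaces is represented by a function that vanishes outside its domain, so that
  \<open>Lin V W\<close> with the pointwise operations is the vector space of linear maps \<open>V \<rightarrow> W\<close>.
\<close>

definition fin_dim :: "'a::complex_vector set \<Rightarrow> bool" where
  "fin_dim V \<longleftrightarrow> (\<exists>B. finite B \<and> cspan B = V)"

definition Lin :: "'a::complex_vector set \<Rightarrow> 'b::complex_vector set \<Rightarrow> ('a \<Rightarrow> 'b) set" where
  "Lin V W = {f. (\<forall>x\<in>V. f x \<in> W) \<and> (\<forall>x\<in>V. \<forall>y\<in>V. f (x + y) = f x + f y) \<and>
     (\<forall>c. \<forall>x\<in>V. f (c *\<^sub>C x) = c *\<^sub>C f x) \<and> (\<forall>x. x \<notin> V \<longrightarrow> f x = 0)}"

definition id_on :: "'a::complex_vector set \<Rightarrow> 'a \<Rightarrow> 'a" where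
  "id_on V = (\<lambda>x. if x \<in> V then x else 0)"

abbreviation dual :: "'a::complex_vector set \<Rightarrow> ('a \<Rightarrow> complex) set" where
  "dual V \<equiv> Lin V UNIV"


section \<open>Tensor products\<close>

text \<open>
  The pure tensor of \<open>v\<close> and \<open>w\<close> is represented by the bilinear form
  \<open>(\<phi>, \<psi>) \<mapsto> \<phi> v * \<psi> w\<close> on linear functionals (with a dummy value on non-linear \<open>\<phi>\<close>, \<open>\<psi>\<close>), and
  \<open>V \<otimes> W\<close> is the span of the pure tensors. Over a field this is a model of the algebraic tensor
  product: linear functionals separate independent pure tensors. The tensor product of a finite
  family is treated in the same way; for the empty family it is the line spanned by the
  constant 1.
\<close>

type_synonym ('a, 'b) tensor2 = "('a \<Rightarrow> complex) \<Rightarrow> ('b \<Rightarrow> complex) \<Rightarrow> complex"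
type_synonym ('i, 'a) tensors = "('i \<Rightarrow> 'a \<Rightarrow> complex) \<Rightarrow> complex"

definition tens :: "'a::complex_vector \<Rightarrow> 'b::complex_vector \<Rightarrow> ('a, 'b) tensor2"
    (infixl \<open>\<otimes>\<^sub>v\<close> 70) where
  "v \<otimes>\<^sub>v w = (\<lambda>\<phi> \<psi>. if clinear \<phi> \<and> clinear \<psi> then \<phi> v * \<psi> w else 0)"

definition tensor :: "'a::complex_vector set \<Rightarrow> 'b::complex_vector set \<Rightarrow>
    ('a, 'b) tensor2 set" (infixl \<open>\<otimes>\<^sub>V\<close> 70) where
  "V \<otimes>\<^sub>V W = cspan {v \<otimes>\<^sub>v w | v w. v \<in> V \<and> w \<in> W}"

definition Tens :: "'i set \<Rightarrow> ('i \<Rightarrow> 'a::complex_vector) \<Rightarrow> ('i, 'a) tensors" where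
  "Tens I v = (\<lambda>\<phi>. if \<forall>i\<in>I. clinear (\<phi> i) then \<Prod>i\<in>I. \<phi> i (v i) else 0)"

definition Tensor :: "'i set \<Rightarrow> ('i \<Rightarrow> 'a::complex_vector set) \<Rightarrow> ('i, 'a) tensors set" where
  "Tensor I V = cspan {Tens I v | v. \<forall>i\<in>I. v i \<in> V i}"

text \<open>Tensor products of linear maps.\<close>

definition tensor_map :: "'a::complex_vector set \<Rightarrow> 'b::complex_vector set \<Rightarrow>
    ('a \<Rightarrow> 'c::complex_vector) \<Rightarrow> ('b \<Rightarrow> 'd::complex_vector) \<Rightarrow>
    ('a, 'b) tensor2 \<Rightarrow> ('c, 'd) tensor2" where
  "tensor_map V W f g = (THE F. F \<in> Lin (V \<otimes>\<^sub>V W) UNIV \<and>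
     (\<forall>v\<in>V. \<forall>w\<in>W. F (v \<otimes>\<^sub>v w) = f v \<otimes>\<^sub>v g w))"

definition Tensor_map :: "'i set \<Rightarrow> ('i \<Rightarrow> 'a::complex_vector set) \<Rightarrow> ('i \<Rightarrow> 'a \<Rightarrow> 'b::complex_vector) \<Rightarrow>
    ('i, 'a) tensors \<Rightarrow> ('i, 'b) tensors" where
  "Tensor_map I V f = (THE F. F \<in> Lin (Tensor I V) UNIV \<and>
     (\<forall>v. (\<forall>i\<in>I. v i \<in> V i) \<longrightarrow> F (Tens I v) = Tens I (\<lambda>i. f i (v i))))"

text \<open>
  The canonical identification
  \<open>(V \<otimes> S\<^sub>i) \<otimes> (S\<^sub>i\<^sub>+\<^sub>1 \<otimes> \<dots> \<otimes> S\<^sub>n) \<rightarrow> V \<otimes> (S\<^sub>i \<otimes> S\<^sub>i\<^sub>+\<^sub>1 \<otimes> \<dots> \<otimes> S\<^sub>n)\<close>, for \<open>i \<le> n\<close>.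
\<close>

definition tensor_assoc :: "'a::complex_vector set \<Rightarrow> (nat \<Rightarrow> 'b::complex_vector set) \<Rightarrow> nat \<Rightarrow> nat \<Rightarrow>
    (('a, 'b) tensor2, (nat, 'b) tensors) tensor2 \<Rightarrow> ('a, (nat, 'b) tensors) tensor2" where
  "tensor_assoc V S i n = (THE F. F \<in> Lin ((V \<otimes>\<^sub>V S i) \<otimes>\<^sub>V Tensor {i+1..n} S) UNIV \<and>
     (\<forall>v\<in>V. \<forall>s. (\<forall>j\<in>{i..n}. s j \<in> S j) \<longrightarrow>
        F ((v \<otimes>\<^sub>v s i) \<otimes>\<^sub>v Tens {i+1..n} s) = v \<otimes>\<^sub>v Tens {i..n} s))"


subsection \<open>Existence and uniqueness of the maps above\<close>

lemma clinear_iff: "clinear f \<longleftrightarrow> (\<forall>x y. f (x + y) = f x + f y) \<and> (\<forall>c x. f (c *\<^sub>C x) = c *\<^sub>C f x)"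
  unfolding Vector_Spaces.linear_iff by (simp add: complex_vector.vector_space_axioms)

lemma Lin_0: assumes "f \<in> Lin V W" shows "f 0 = 0"
proof (cases "0 \<in> V")
  case True
  hence "f (0 + 0) = f 0 + f 0" using assms unfolding Lin_def by blast
  thus ?thesis by simp
qed (use assms in \<open>auto simp: Lin_def\<close>)

lemma clinear_0: "clinear f \<Longrightarrow> f 0 = 0"
  by (rule Lin_0[of f UNIV UNIV]) (simp add: Lin_def clinear_iff)

lemma Lin_extend:
  assumes V: "csubspace V" and f: "f \<in> Lin V W"
  shows "\<exists>F. clinear F \<and> (\<forall>v\<in>V. F v = f v)"
proof -
  interpret P: vector_space_pair "scaleC :: complex \<Rightarrow> 'a \<Rightarrow> 'a" "scaleC :: complex \<Rightarrow> 'b \<Rightarrow> 'b" ..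
  obtain B where B: "B \<subseteq> V" "complex_vector.independent B" "V \<subseteq> cspan B"
    using complex_vector.basis_exists[of V] by metis
  define F where "F = P.construct B f"
  have lin: "clinear F" unfolding F_def by (rule P.linear_construct[OF B(2)])
  have "F 0 = 0" by (rule clinear_0[OF lin])
  hence "csubspace {v \<in> V. F v = f v}"
    unfolding complex_vector.subspace_def
    using f lin V Lin_0[OF f] by (auto simp: Lin_def clinear_iff complex_vector.subspace_add
        complex_vector.subspace_scale complex_vector.subspace_0)
  moreover have "B \<subseteq> {v \<in> V. F v = f v}"
    using B by (auto simp: F_def P.construct_basis)
  ultimately have "cspan B \<subseteq> {v \<in> V. F v = f v}"
    by (rule complex_vector.span_minimal[rotated])
  thus ?thesis using lin B(3) by blast
qed

lemma Lin_span_unique: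
  assumes F: "F \<in> Lin (cspan X) Y" and F': "F' \<in> Lin (cspan X) Y'" and eq: "\<And>x. x \<in> X \<Longrightarrow> F x = F' x"
  shows "F = F'"
proof -
  have "csubspace {x \<in> cspan X. F x = F' x}"
    unfolding complex_vector.subspace_def
    using F F' Lin_0[OF F] Lin_0[OF F'] by (auto simp: Lin_def complex_vector.span_add
        complex_vector.span_scale complex_vector.span_zero)
  moreover have "X \<subseteq> {x \<in> cspan X. F x = F' x}" using eq complex_vector.span_base by auto
  ultimately have "cspan X \<subseteq> {x \<in> cspan X. F x = F' x}"
    by (rule complex_vector.span_minimal[rotated])
  hence "F x = F' x" if "x \<in> cspan X" for x using that by blast
  thus ?thesis using F F' unfolding Lin_def fun_eq_iff by (metis (mono_tags, lifting) mem_Collect_eq)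
qed

lemma Lin_restrictI:
  assumes "csubspace V" "clinear F"
  shows "(\<lambda>x. if x \<in> V then F x else 0) \<in> Lin V UNIV"
  using assms by (auto simp: Lin_def clinear_iff complex_vector.subspace_add
        complex_vector.subspace_scale)

lemma clinear_comp: "clinear f \<Longrightarrow> clinear g \<Longrightarrow> clinear (f \<circ> g)"
  by (simp add: clinear_iff)

lemma tensor_map_wd:
  assumes "csubspace V" "csubspace W" "f \<in> Lin V X" "g \<in> Lin W Y"
  shows "\<exists>!F. F \<in> Lin (V \<otimes>\<^sub>V W) UNIV \<and> (\<forall>v\<in>V. \<forall>w\<in>W. F (v \<otimes>\<^sub>v w) = f v \<otimes>\<^sub>v g w)"
proof (rule ex_ex1I)
  obtain f' g' where f': "clinear f'" "\<forall>v\<in>V. f' v = f v" and g': "clinear g'" "\<forall>v\<in>W. g' v = g v"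
    using Lin_extend assms by metis
  let ?F = "\<lambda>t \<phi> \<psi>. if clinear \<phi> \<and> clinear \<psi> then t (\<phi> \<circ> f') (\<psi> \<circ> g') else (0::complex)"
  have "clinear ?F" by (auto simp: clinear_iff fun_eq_iff scaleC_fun_def scaleC_complex_def)
  moreover have "?F (v \<otimes>\<^sub>v w) = f v \<otimes>\<^sub>v g w" if "v \<in> V" "w \<in> W" for v w
    using that f' g' by (auto simp: tens_def fun_eq_iff clinear_comp)
  moreover have "v \<otimes>\<^sub>v w \<in> V \<otimes>\<^sub>V W" if "v \<in> V" "w \<in> W" for v w
    unfolding tensor_def using that by (blast intro: complex_vector.span_base)
  ultimately show "\<exists>F. F \<in> Lin (V \<otimes>\<^sub>V W) UNIV \<and> (\<forall>v\<in>V. \<forall>w\<in>W. F (v \<otimes>\<^sub>v w) = f v \<otimes>\<^sub>v g w)"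
    by (intro exI[of _ "\<lambda>x. if x \<in> V \<otimes>\<^sub>V W then ?F x else 0"] conjI Lin_restrictI)
       (auto simp: tensor_def)
next
  fix F F' assume "F \<in> Lin (V \<otimes>\<^sub>V W) UNIV \<and> (\<forall>v\<in>V. \<forall>w\<in>W. F (v \<otimes>\<^sub>v w) = f v \<otimes>\<^sub>v g w)"
   "F' \<in> Lin (V \<otimes>\<^sub>V W) UNIV \<and> (\<forall>v\<in>V. \<forall>w\<in>W. F' (v \<otimes>\<^sub>v w) = f v \<otimes>\<^sub>v g w)"
  thus "F = F'" unfolding tensor_def by - (elim conjE, rule Lin_span_unique, assumption, assumption, auto)
qed

lemma Tensor_map_wd:
  assumes "\<And>i. i \<in> I \<Longrightarrow> csubspace (V i)" "\<And>i. i \<in> I \<Longrightarrow> f i \<in> Lin (V i) (X i)"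
  shows "\<exists>!F. F \<in> Lin (Tensor I V) UNIV \<and>
     (\<forall>v. (\<forall>i\<in>I. v i \<in> V i) \<longrightarrow> F (Tens I v) = Tens I (\<lambda>i. f i (v i)))"
proof (rule ex_ex1I)
  have "\<forall>i. \<exists>F. i \<in> I \<longrightarrow> clinear F \<and> (\<forall>v\<in>V i. F v = f i v)"
    using Lin_extend assms by metis
  then obtain f' where f': "\<And>i. i \<in> I \<Longrightarrow> clinear (f' i)" "\<And>i v. i \<in> I \<Longrightarrow> v \<in> V i \<Longrightarrow> f' i v = f i v"
    by metis
  let ?F = "\<lambda>t \<phi>. if \<forall>i\<in>I. clinear (\<phi> i) then t (\<lambda>i. \<phi> i \<circ> f' i) else (0::complex)"
  have "clinear ?F" by (auto simp: clinear_iff fun_eq_iff scaleC_fun_def scaleC_complex_def)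
  moreover have "?F (Tens I v) = Tens I (\<lambda>i. f i (v i))" if "\<forall>i\<in>I. v i \<in> V i" for v
    using that f' by (auto simp: Tens_def fun_eq_iff clinear_comp intro!: prod.cong)
  moreover have "Tens I v \<in> Tensor I V" if "\<forall>i\<in>I. v i \<in> V i" for v
    unfolding Tensor_def using that by (blast intro: complex_vector.span_base)
  ultimately show "\<exists>F. F \<in> Lin (Tensor I V) UNIV \<and>
     (\<forall>v. (\<forall>i\<in>I. v i \<in> V i) \<longrightarrow> F (Tens I v) = Tens I (\<lambda>i. f i (v i)))"
    by (intro exI[of _ "\<lambda>x. if x \<in> Tensor I V then ?F x else 0"] conjI Lin_restrictI)
       (auto simp: Tensor_def)
next
  fix F F' assume "F \<in> Lin (Tensor I V) UNIV \<and>
     (\<forall>v. (\<forall>i\<in>I. v i \<in> V i) \<longrightarrow> F (Tens I v) = Tens I (\<lambda>i. f i (v i)))"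
   "F' \<in> Lin (Tensor I V) UNIV \<and>
     (\<forall>v. (\<forall>i\<in>I. v i \<in> V i) \<longrightarrow> F' (Tens I v) = Tens I (\<lambda>i. f i (v i)))"
  thus "F = F'" unfolding Tensor_def by - (elim conjE, rule Lin_span_unique, assumption, assumption, auto)
qed

lemma tens_linear:
  "(u + v) \<otimes>\<^sub>v w = u \<otimes>\<^sub>v w + v \<otimes>\<^sub>v w"
  "v \<otimes>\<^sub>v (w + x) = v \<otimes>\<^sub>v w + v \<otimes>\<^sub>v x"
  "(c *\<^sub>C v) \<otimes>\<^sub>v w = c *\<^sub>C (v \<otimes>\<^sub>v w)"
  "v \<otimes>\<^sub>v (c *\<^sub>C w) = c *\<^sub>C (v \<otimes>\<^sub>v w)"
  "0 \<otimes>\<^sub>v w = 0" "v \<otimes>\<^sub>v 0 = 0"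
  by (auto simp: tens_def fun_eq_iff clinear_0)
     (auto simp: clinear_iff scaleC_fun_def scaleC_complex_def algebra_simps)

lemma tensor_assoc_wd:
  fixes S :: "nat \<Rightarrow> 'b::complex_vector set"
  assumes "i \<le> n" and fd: "fin_dim (S i)"
  shows "\<exists>!F. F \<in> Lin ((V \<otimes>\<^sub>V S i) \<otimes>\<^sub>V Tensor {i+1..n} S) UNIV \<and>
     (\<forall>v\<in>V. \<forall>s. (\<forall>j\<in>{i..n}. s j \<in> S j) \<longrightarrow>
        F ((v \<otimes>\<^sub>v s i) \<otimes>\<^sub>v Tens {i+1..n} s) = v \<otimes>\<^sub>v Tens {i..n} s)"
   (is "\<exists>!F. F \<in> Lin ?D UNIV \<and> ?P F")
proof (rule ex_ex1I)
  interpret P: vector_space_pair "scaleC :: complex \<Rightarrow> 'b \<Rightarrow> 'b" "scaleC :: complex \<Rightarrow> complex \<Rightarrow> complex" ..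
  have ins: "{i..n} = insert i {i+1..n}" using assms by auto
  obtain B0 where B0: "finite B0" "cspan B0 = S i" using fd by (auto simp: fin_dim_def)
  obtain B where B: "B \<subseteq> B0" "complex_vector.independent B" "cspan B = S i"
    using complex_vector.maximal_independent_subset[of B0] B0(2)
    by (metis complex_vector.span_minimal complex_vector.span_mono complex_vector.subspace_span subset_antisym)
  have fin: "finite B" using B B0 finite_subset by blast
  define \<rho> where "\<rho> b = P.construct B (\<lambda>x. if x = b then 1 else 0)" for b
  have lin: "clinear (\<rho> b)" for b unfolding \<rho>_def by (rule P.linear_construct[OF B(2)])
  have \<rho>B: "\<rho> b x = (if x = b then 1 else 0)" if "x \<in> B" for b x
    unfolding \<rho>_def using P.construct_basis[OF B(2) that] by simp
  have expand: "(\<Sum>b\<in>B. \<rho> b x * h b) = h x" if h: "clinear h" and x: "x \<in> S i" for h x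
  proof -
    have "\<rho> b 0 = 0" "h 0 = 0" for b
      using clinear_0 lin h by blast+
    hence "csubspace {x. (\<Sum>b\<in>B. \<rho> b x * h b) = h x}"
      unfolding complex_vector.subspace_def using lin h
      by (simp add: clinear_iff algebra_simps sum.distrib scaleC_complex_def flip: sum_distrib_left)
    moreover have "B \<subseteq> {x. (\<Sum>b\<in>B. \<rho> b x * h b) = h x}"
      using fin by (auto simp: \<rho>B if_distrib[of "\<lambda>y. y * _"] cong: if_cong)
    ultimately show ?thesis using complex_vector.span_minimal B(3) x by blast
  qed
  define cons :: "'b \<Rightarrow> (nat, 'b) tensors \<Rightarrow> (nat, 'b) tensors"
    where "cons x y = (\<lambda>\<psi>. if clinear (\<psi> i) then \<psi> i x * y \<psi> else 0)" for x y
  have cons_lin: "clinear (cons x)" "clinear (\<lambda>x. cons x y)" for x y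
    by (auto simp: cons_def clinear_iff fun_eq_iff scaleC_fun_def scaleC_complex_def algebra_simps)
  have cons_Tens: "cons (s i) (Tens {i+1..n} s) = Tens {i..n} s" for s
    unfolding ins by (auto simp: cons_def Tens_def fun_eq_iff)
  let ?F = "\<lambda>t \<mu> \<tau>. if clinear \<mu> \<and> clinear \<tau> then
     (\<Sum>b\<in>B. t (\<lambda>p. p \<mu> (\<rho> b)) (\<lambda>y. \<tau> (cons b y))) else (0::complex)"
  have "clinear ?F"
    by (auto simp: clinear_iff fun_eq_iff scaleC_fun_def scaleC_complex_def sum.distrib sum_distrib_left)
  moreover have "?F ((v \<otimes>\<^sub>v s i) \<otimes>\<^sub>v Tens {i+1..n} s) = v \<otimes>\<^sub>v Tens {i..n} s"
    if "\<forall>j\<in>{i..n}. s j \<in> S j" for v :: 'a and s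
  proof (intro ext)
    fix \<mu> \<tau>
    show "?F ((v \<otimes>\<^sub>v s i) \<otimes>\<^sub>v Tens {i+1..n} s) \<mu> \<tau> = (v \<otimes>\<^sub>v Tens {i..n} s) \<mu> \<tau>"
    proof (cases "clinear \<mu> \<and> clinear \<tau>")
      case True
      have 1: "clinear (\<lambda>y. \<tau> (cons b y))" "clinear (\<lambda>b. \<tau> (cons b y))" for b y
        using clinear_comp[of \<tau>] True cons_lin by (auto simp: o_def)
      have 2: "clinear (\<lambda>p :: ('a, 'b) tensor2. p \<mu> (\<rho> b))" for b :: 'b
        by (simp add: clinear_iff scaleC_fun_def)
      have "(\<Sum>b\<in>B. \<rho> b (s i) * \<tau> (cons b (Tens {i+1..n} s))) = \<tau> (Tens {i..n} s)"
        using expand[OF 1(2), of "s i" "Tens {i+1..n} s"] that assms(1) unfolding cons_Tens by simp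
      hence "(\<Sum>b\<in>B. \<mu> v * \<rho> b (s i) * \<tau> (cons b (Tens {i+1..n} s))) = \<mu> v * \<tau> (Tens {i..n} s)"
        by (simp add: mult.assoc flip: sum_distrib_left)
      thus ?thesis using True 1(1) 2 lin by (simp add: tens_def)
    qed (auto simp: tens_def)
  qed
  moreover have "(v \<otimes>\<^sub>v s i) \<otimes>\<^sub>v Tens {i+1..n} s \<in> ?D" if "v \<in> V" "\<forall>j\<in>{i..n}. s j \<in> S j" for v s
  proof -
    have "v \<otimes>\<^sub>v s i \<in> V \<otimes>\<^sub>V S i" "Tens {i+1..n} s \<in> Tensor {i+1..n} S"
      unfolding tensor_def Tensor_def using that ins by (blast intro: complex_vector.span_base)+
    thus ?thesis unfolding tensor_def by (blast intro: complex_vector.span_base)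
  qed
  moreover have "csubspace ?D" by (simp add: tensor_def)
  ultimately show "\<exists>F. F \<in> Lin ?D UNIV \<and> ?P F"
    by (intro exI[of _ "\<lambda>x. if x \<in> ?D then ?F x else 0"] conjI Lin_restrictI) auto
next
  fix F F' assume "F \<in> Lin ?D UNIV \<and> ?P F" "F' \<in> Lin ?D UNIV \<and> ?P F'"
  hence F: "F \<in> Lin ?D UNIV" "?P F" and F': "F' \<in> Lin ?D UNIV" "?P F'" by blast+
  have ins: "{i..n} = insert i {i+1..n}" using assms by auto
  define E where "E = {x \<in> ?D. F x = F' x}"
  have E: "csubspace E"
    unfolding complex_vector.subspace_def E_def
    using F(1) F'(1) Lin_0[OF F(1)] Lin_0[OF F'(1)] by (auto simp: tensor_def Lin_def complex_vector.span_add
        complex_vector.span_scale complex_vector.span_zero)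
  have pure: "(v \<otimes>\<^sub>v x) \<otimes>\<^sub>v Tens {i+1..n} s \<in> E" if "v \<in> V" "x \<in> S i" "\<forall>j\<in>{i+1..n}. s j \<in> S j" for v x s
  proof -
    let ?s = "s(i := x)"
    have "Tens {i+1..n} ?s = Tens {i+1..n} s" by (auto simp: Tens_def fun_eq_iff)
    moreover have "\<forall>j\<in>{i..n}. ?s j \<in> S j" using that ins by auto
    ultimately have "F ((v \<otimes>\<^sub>v x) \<otimes>\<^sub>v Tens {i+1..n} s) = F' ((v \<otimes>\<^sub>v x) \<otimes>\<^sub>v Tens {i+1..n} s)"
      using F(2)[rule_format, of v ?s] F'(2)[rule_format, of v ?s] \<open>v \<in> V\<close> by simp
    moreover have "v \<otimes>\<^sub>v x \<in> V \<otimes>\<^sub>V S i" "Tens {i+1..n} s \<in> Tensor {i+1..n} S"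
      unfolding tensor_def Tensor_def using that by (blast intro: complex_vector.span_base)+
    hence "(v \<otimes>\<^sub>v x) \<otimes>\<^sub>v Tens {i+1..n} s \<in> ?D" unfolding tensor_def[of "V \<otimes>\<^sub>V S i"] by (blast intro: complex_vector.span_base)
    ultimately show ?thesis by (simp add: E_def)
  qed
  have sub1: "csubspace {p. p \<otimes>\<^sub>v y \<in> E}" for y
    using E unfolding complex_vector.subspace_def by (simp add: tens_linear)
  have sub2: "csubspace {y. p \<otimes>\<^sub>v y \<in> E}" for p
    using E unfolding complex_vector.subspace_def by (simp add: tens_linear)
  have 1: "p \<otimes>\<^sub>v Tens {i+1..n} s \<in> E" if "p \<in> V \<otimes>\<^sub>V S i" "\<forall>j\<in>{i+1..n}. s j \<in> S j" for p s
  proof -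
    have "V \<otimes>\<^sub>V S i \<subseteq> {p. p \<otimes>\<^sub>v Tens {i+1..n} s \<in> E}"
      unfolding tensor_def by (rule complex_vector.span_minimal[OF _ sub1]) (use that(2) pure in blast)
    thus ?thesis using that(1) by blast
  qed
  have 2: "p \<otimes>\<^sub>v y \<in> E" if "p \<in> V \<otimes>\<^sub>V S i" "y \<in> Tensor {i+1..n} S" for p y
  proof -
    have "Tensor {i+1..n} S \<subseteq> {y. p \<otimes>\<^sub>v y \<in> E}"
      unfolding Tensor_def by (rule complex_vector.span_minimal[OF _ sub2]) (use that(1) 1 in blast)
    thus ?thesis using that(2) by blast
  qed
  show "F = F'"
    using F(1) F'(1) 2 unfolding tensor_def[of "V \<otimes>\<^sub>V S i"] E_def
    by - (rule Lin_span_unique, assumption, assumption, auto)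
qed

lemma csubspace_tensor: "csubspace (V \<otimes>\<^sub>V W)" "csubspace (Tensor I U)"
  by (simp_all add: tensor_def Tensor_def)


section \<open>Representations\<close>

definition GL :: "'a::complex_vector set \<Rightarrow> ('a \<Rightarrow> 'a) monoid" where
  "GL V = \<lparr>carrier = {f \<in> Lin V V. bij_betw f V V}, mult = (\<circ>), one = id_on V\<rparr>"

definition fd_rep :: "'g monoid \<Rightarrow> 'a::complex_vector set \<Rightarrow> ('g \<Rightarrow> 'a \<Rightarrow> 'a) \<Rightarrow> bool" where
  "fd_rep G V \<rho> \<longleftrightarrow> fin_dim V \<and> \<rho> \<in> hom G (GL V)"

text \<open>
  Continuity with respect to the canonical topology of a finite-dimensional space, i.e. the
  coarsest one making all linear functionals continuous.
\<close>

definition continuous_rep :: "'g topology \<Rightarrow> 'a::complex_vector set \<Rightarrow> ('g \<Rightarrow> 'a \<Rightarrow> 'a) \<Rightarrow> bool" where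
  "continuous_rep T V \<rho> \<longleftrightarrow>
     (\<forall>\<phi>\<in>dual V. \<forall>v\<in>V. continuous_map T euclidean (\<lambda>g. \<phi> (\<rho> g v)))"

definition irreducible_rep :: "'g monoid \<Rightarrow> 'a::complex_vector set \<Rightarrow> ('g \<Rightarrow> 'a \<Rightarrow> 'a) \<Rightarrow> bool" where
  "irreducible_rep G V \<rho> \<longleftrightarrow> V \<noteq> {0} \<and>
     (\<forall>W. csubspace W \<and> W \<subseteq> V \<and> (\<forall>g\<in>carrier G. \<rho> g ` W \<subseteq> W) \<longrightarrow> W = {0} \<or> W = V)"

definition Hom_rep :: "'g monoid \<Rightarrow> 'a::complex_vector set \<Rightarrow> ('g \<Rightarrow> 'a \<Rightarrow> 'a) \<Rightarrow>
    'b::complex_vector set \<Rightarrow> ('g \<Rightarrow> 'b \<Rightarrow> 'b) \<Rightarrow> ('a \<Rightarrow> 'b) set" where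
  "Hom_rep G V \<rho> W \<sigma> = {f \<in> Lin V W. \<forall>g\<in>carrier G. \<forall>v\<in>V. f (\<rho> g v) = \<sigma> g (f v)}"

definition tensor_rep :: "'a::complex_vector set \<Rightarrow> ('g \<Rightarrow> 'a \<Rightarrow> 'a) \<Rightarrow> 'b::complex_vector set \<Rightarrow>
    ('g \<Rightarrow> 'b \<Rightarrow> 'b) \<Rightarrow> 'g \<Rightarrow> ('a, 'b) tensor2 \<Rightarrow> ('a, 'b) tensor2" where
  "tensor_rep V \<rho> W \<sigma> g = tensor_map V W (\<rho> g) (\<sigma> g)"

definition dual_rep :: "'g monoid \<Rightarrow> 'a::complex_vector set \<Rightarrow> ('g \<Rightarrow> 'a \<Rightarrow> 'a) \<Rightarrow>
    'g \<Rightarrow> ('a \<Rightarrow> complex) \<Rightarrow> 'a \<Rightarrow> complex" where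
  "dual_rep G V \<rho> g = (\<lambda>\<phi>. if \<phi> \<in> dual V then \<phi> \<circ> \<rho> (inv\<^bsub>G\<^esub> g) else 0)"


section \<open>The gauge action on the linear graph\<close>

definition Gpow :: "'g monoid \<Rightarrow> nat \<Rightarrow> (nat \<Rightarrow> 'g) set" where
  "Gpow G n = (\<Pi>\<^sub>E i\<in>{1..n}. carrier G)"

text \<open>
  The element \<open>(h, g\<^sub>2, \<dots>, g\<^sub>n, k)\<close> of \<open>H \<times> G\<^bsup>n-1\<^esup> \<times> K\<close> is the family with entry \<open>h\<close> at the
  vertex 1, \<open>g\<^sub>i\<close> at the vertex \<open>i\<close> and \<open>k\<close> at the vertex \<open>n + 1\<close>.
\<close>

definition gauge_group :: "'g monoid \<Rightarrow> 'g set \<Rightarrow> 'g set \<Rightarrow> nat \<Rightarrow> (nat \<Rightarrow> 'g) set" where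
  "gauge_group G H K n =
     (\<Pi>\<^sub>E i\<in>{1..n+1}. if i = 1 then H else if i = n + 1 then K else carrier G)"

definition gauge_inv :: "'g monoid \<Rightarrow> nat \<Rightarrow> (nat \<Rightarrow> 'g) \<Rightarrow> nat \<Rightarrow> 'g" where
  "gauge_inv G n k = (\<lambda>i\<in>{1..n+1}. inv\<^bsub>G\<^esub> (k i))"

definition gauge_act :: "'g monoid \<Rightarrow> nat \<Rightarrow> (nat \<Rightarrow> 'g) \<Rightarrow> (nat \<Rightarrow> 'g) \<Rightarrow> nat \<Rightarrow> 'g" where
  "gauge_act G n k g = (\<lambda>i\<in>{1..n}. k i \<otimes>\<^bsub>G\<^esub> g i \<otimes>\<^bsub>G\<^esub> inv\<^bsub>G\<^esub> (k (i + 1)))"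

text \<open>
  Functions on \<open>G\<^bsup>n\<^esup>\<close> are extended by 0, and \<open>R \<otimes> S\<close>, for a space \<open>R\<close> of scalar functions, is
  identified with the space of \<open>S\<close>-valued functions spanned by the \<open>g \<mapsto> r(g) s\<close>.
\<close>

definition matrix_coeffs :: "'g monoid \<Rightarrow> nat \<Rightarrow> (nat \<Rightarrow> 'm::complex_vector set) \<Rightarrow>
    (nat \<Rightarrow> 'g \<Rightarrow> 'm \<Rightarrow> 'm) \<Rightarrow> ((nat \<Rightarrow> 'g) \<Rightarrow> complex) set" where
  "matrix_coeffs G n M \<pi> = cspan {\<lambda>g. if g \<in> Gpow G n
       then \<phi> (Tensor_map {1..n} M (\<lambda>i. \<pi> i (g i)) m) else 0
     | \<phi> m. \<phi> \<in> dual (Tensor {1..n} M) \<and> m \<in> Tensor {1..n} M}"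

definition vector_valued :: "('x \<Rightarrow> complex) set \<Rightarrow> 'a::complex_vector set \<Rightarrow> ('x \<Rightarrow> 'a) set" where
  "vector_valued R S = cspan {\<lambda>x. r x *\<^sub>C s | r s. r \<in> R \<and> s \<in> S}"

definition gauge_rep :: "nat \<Rightarrow> 'l::complex_vector set \<Rightarrow> ('g \<Rightarrow> 'l \<Rightarrow> 'l) \<Rightarrow>
    (nat \<Rightarrow> 's::complex_vector set) \<Rightarrow> (nat \<Rightarrow> 'g \<Rightarrow> 's \<Rightarrow> 's) \<Rightarrow>
    'n::complex_vector set \<Rightarrow> ('g \<Rightarrow> 'n \<Rightarrow> 'n) \<Rightarrow> (nat \<Rightarrow> 'g) \<Rightarrow>
    (('l, (nat, 's) tensors) tensor2, 'n) tensor2 \<Rightarrow> (('l, (nat, 's) tensors) tensor2, 'n) tensor2" where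
  "gauge_rep n L \<tau> S \<sigma> N \<nu> k =
     tensor_map (L \<otimes>\<^sub>V Tensor {2..n} S) N
       (tensor_map L (Tensor {2..n} S) (\<tau> (k 1)) (Tensor_map {2..n} S (\<lambda>i. \<sigma> i (k i))))
       (\<nu> (k (n + 1)))"

definition gauge_invariants :: "'g monoid \<Rightarrow> 'g set \<Rightarrow> 'g set \<Rightarrow> nat \<Rightarrow>
    ((nat \<Rightarrow> 'g) \<Rightarrow> 'a \<Rightarrow> 'a) \<Rightarrow> ((nat \<Rightarrow> 'g) \<Rightarrow> 'a::complex_vector) set \<Rightarrow> ((nat \<Rightarrow> 'g) \<Rightarrow> 'a) set" where
  "gauge_invariants G H K n \<rho> F = {f \<in> F. \<forall>k\<in>gauge_group G H K n. \<forall>g\<in>Gpow G n.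
     \<rho> k (f (gauge_act G n (gauge_inv G n k) g)) = f g}"


section \<open>The functions \<open>f\<close>\<close>

text \<open>
  \<open>\<lambda>v. representation B v b\<close> is the element of the dual basis corresponding to \<open>b\<close>. The value does
  not depend on the choice of the basis \<open>B\<close> of \<open>N\<close>.
\<close>

definition Qmap :: "'n::complex_vector set \<Rightarrow> (('n \<Rightarrow> complex) \<Rightarrow> 'a::complex_vector) \<Rightarrow>
    ('a, 'n) tensor2" where
  "Qmap N t =
     (let B = (SOME B. finite B \<and> complex_vector.independent B \<and> cspan B = N)
      in \<Sum>b\<in>B. t (\<lambda>v. complex_vector.representation B v b) \<otimes>\<^sub>v b)"

text \<open>
  \<open>\<Phi>\<^sub>i \<pi>\<^sub>i(g\<^sub>i) \<otimes> id\<close>, as a map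
  \<open>M\<^sub>i \<otimes> (S\<^sub>i\<^sub>+\<^sub>1 \<otimes> \<dots> \<otimes> S\<^sub>n) \<rightarrow> M\<^sub>i\<^sub>-\<^sub>1 \<otimes> (S\<^sub>i \<otimes> \<dots> \<otimes> S\<^sub>n)\<close>.
\<close>

definition transport :: "nat \<Rightarrow> (nat \<Rightarrow> 'm::complex_vector set) \<Rightarrow> (nat \<Rightarrow> 'g \<Rightarrow> 'm \<Rightarrow> 'm) \<Rightarrow>
    (nat \<Rightarrow> 's::complex_vector set) \<Rightarrow> (nat \<Rightarrow> 'm \<Rightarrow> ('m, 's) tensor2) \<Rightarrow> (nat \<Rightarrow> 'g) \<Rightarrow> nat \<Rightarrow>
    ('m, (nat, 's) tensors) tensor2 \<Rightarrow> ('m, (nat, 's) tensors) tensor2" where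
  "transport n M \<pi> S \<Phi> g i =
     tensor_assoc (M (i - 1)) S i n \<circ> tensor_map (M i) (Tensor {i+1..n} S) (\<Phi> i \<circ> \<pi> i (g i))
       (id_on (Tensor {i+1..n} S))"

text \<open>
  The innermost map \<open>m \<mapsto> m \<otimes> 1\<close> identifies \<open>M\<^sub>n\<close> with its tensor product with the empty product
  \<open>\<complex>\<close>; for \<open>n = 1\<close> the list of transports is empty.
\<close>

definition f_fun :: "'g monoid \<Rightarrow> nat \<Rightarrow> (nat \<Rightarrow> 'm::complex_vector set) \<Rightarrow> (nat \<Rightarrow> 'g \<Rightarrow> 'm \<Rightarrow> 'm) \<Rightarrow>
    (nat \<Rightarrow> 's::complex_vector set) \<Rightarrow> 'n::complex_vector set \<Rightarrow> ('m \<Rightarrow> 'l::complex_vector) \<Rightarrow>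
    (nat \<Rightarrow> 'm \<Rightarrow> ('m, 's) tensor2) \<Rightarrow> (('n \<Rightarrow> complex) \<Rightarrow> 'm) \<Rightarrow>
    (nat \<Rightarrow> 'g) \<Rightarrow> (('l, (nat, 's) tensors) tensor2, 'n) tensor2" where
  "f_fun G n M \<pi> S N \<Theta> \<Phi> \<Xi> = (\<lambda>g. if g \<in> Gpow G n
     then Qmap N
       (tensor_map (M 1) (Tensor {2..n} S) (\<Theta> \<circ> \<pi> 1 (g 1)) (id_on (Tensor {2..n} S))
        \<circ> foldr (\<circ>) (map (transport n M \<pi> S \<Phi> g) [2..<n+1]) id
        \<circ> (\<lambda>m. m \<otimes>\<^sub>v Tens {} 0)
        \<circ> \<Xi>)
     else 0)"

end

theory Submission
  imports Defs "Jordan_Normal_Form.Spectral_Radius"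
begin

text \<open>
Choose bases of all the representation spaces. The products of matrix coefficients of the
\<open>\<pi>\<^sub>i\<close> with pure tensors of basis vectors of \<open>L\<close>, the \<open>S\<^sub>i\<close> and \<open>N\<close> are functions \<open>efun z\<close> on
\<open>G\<^bsup>n\<^esup>\<close>, and the point is that their index \<open>z\<close> can be read in two ways. By edges, it is a pair
(row, column) for each \<open>\<pi>\<^sub>i\<close> and one basis vector for each of \<open>L\<close>, \<open>S\<^sub>i\<close>, \<open>N\<close>. By vertices,
the entry \<open>z\<^sub>i\<close> is a triple of basis vectors of the three spaces \<open>M\<^sub>i\<^sub>-\<^sub>1\<close>, \<open>S\<^sub>i\<close>, \<open>M\<^sub>i\<close> that meet
there, hence a coordinate on \<open>Hom(M\<^sub>i, M\<^sub>i\<^sub>-\<^sub>1 \<otimes> S\<^sub>i)\<close>; at the two ends of the graph it is a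
coordinate on \<open>Hom(M\<^sub>1, L)\<close> and on \<open>Hom(N\<^sup>*, M\<^sub>n)\<close>.

Multiplying out the definition of \<open>f\<close> shows that its coefficient at \<open>efun z\<close> is the product
over the vertices of the \<open>z\<^sub>i\<close>-th coordinates of \<open>\<Theta>\<close>, the \<open>\<Phi>\<^sub>i\<close> and \<open>\<Xi>\<close> (\<open>f_fun_expand\<close>). So, before
any invariance is imposed, the map of the statement is the identity on coefficient arrays, and it is
bijective onto \<open>R \<otimes> S\<close> because the \<open>efun z\<close> form a basis of that space. They span it by
multilinearity (\<open>vector_valued_eq\<close>). They are independent (\<open>efun_independent\<close>) because the
matrix coefficients of an irreducible complex representation are independent, which is Burnside's
theorem (\<open>irreducible_matrix_coeffs_independent\<close>), and because products of independent
functions of separate variables are independent (\<open>products_independent\<close>).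

A gauge transformation acts on coefficient arrays by a matrix in each slot, and the one in slot
\<open>i\<close> depends only on its component at the vertex \<open>i\<close> (\<open>gauge_rep_efun\<close>). It is the matrix of
conjugation on the Hom space at that vertex, whose fixed vectors are the intertwiners (\<open>HomH_iff\<close>,
\<open>HomG_iff\<close>, \<open>HomK_iff\<close>). Letting one component vary at a time, an invariant array has all its
slices in the spaces of intertwiners, and projecting onto these in every slot writes it as a
combination of products of intertwiners (\<open>array_of_slices\<close>).
\<close>

section \<open>Coordinates on subspaces and spaces of linear maps\<close>

lemma sum_fun_apply: "(\<Sum>a\<in>A. f a) x = (\<Sum>a\<in>A. f a x)"
  by (induction A rule: infinite_finite_induct) auto

lemma scaleC_apply [simp]: "(c *\<^sub>C f) x = c *\<^sub>C f x"
  by (simp add: scaleC_fun_def)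

lemma scaleC_complex [simp]: "c *\<^sub>C (x :: complex) = c * x"
  by (simp add: scaleC_complex_def)

lemma clinear_sum: "clinear f \<Longrightarrow> f (\<Sum>a\<in>A. g a) = (\<Sum>a\<in>A. f (g a))"
  by (induction A rule: infinite_finite_induct) (auto simp: clinear_0 clinear_iff)

lemma clinear_expand:
  "clinear f \<Longrightarrow> f (\<Sum>a\<in>A. c a *\<^sub>C v a) = (\<Sum>a\<in>A. c a *\<^sub>C f (v a))"
  by (simp add: clinear_sum) (simp add: clinear_iff)

lemma csubspace_sum:
  "csubspace V \<Longrightarrow> (\<And>a. a \<in> A \<Longrightarrow> v a \<in> V) \<Longrightarrow> (\<Sum>a\<in>A. c a *\<^sub>C v a) \<in> V"
  by (intro complex_vector.subspace_sum complex_vector.subspace_scale)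

lemma csubspace_range: "clinear F \<Longrightarrow> csubspace (range F)"
  unfolding complex_vector.subspace_def
proof (intro conjI ballI allI)
  assume F: "clinear F"
  show "0 \<in> range F" using rangeI[of F 0] clinear_0[OF F] by simp
  show "x + y \<in> range F" if xy: "x \<in> range F" "y \<in> range F" for x y
  proof -
    obtain a b where "x = F a" "y = F b" using xy by auto
    thus ?thesis using F rangeI[of F "a + b"] by (simp add: clinear_iff)
  qed
  show "c *\<^sub>C x \<in> range F" if x: "x \<in> range F" for c x
  proof -
    obtain a where "x = F a" using x by auto
    thus ?thesis using F rangeI[of F "c *\<^sub>C a"] by (simp add: clinear_iff)
  qed
qed

lemma sum_scaleC_sum:
  "(\<Sum>y\<in>B. p y) *\<^sub>C (\<Sum>r\<in>A. d r *\<^sub>C w r) = (\<Sum>r\<in>A. \<Sum>y\<in>B. (d r * p y) *\<^sub>C w r)"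
  by (simp only: complex_vector.scale_sum_right)
    (simp add: scaleC_scaleC mult.commute sum_distrib_left flip: complex_vector.scale_sum_left)

lemma Lin_mem: "f \<in> Lin V W \<Longrightarrow> v \<in> V \<Longrightarrow> f v \<in> W"
  by (simp add: Lin_def)

lemma Lin_codomain: "f \<in> Lin V X \<Longrightarrow> (\<And>v. v \<in> V \<Longrightarrow> f v \<in> W) \<Longrightarrow> f \<in> Lin V W"
  by (simp add: Lin_def)

lemma Lin_compose:
  assumes "f \<in> Lin V W" "h \<in> Lin W X"
  shows "h \<circ> f \<in> Lin V X"
  using assms Lin_0[OF assms(2)] by (auto simp: Lin_def)

lemma id_on_Lin: "csubspace V \<Longrightarrow> id_on V \<in> Lin V V"
  by (auto simp: Lin_def id_on_def complex_vector.subspace_add complex_vector.subspace_scale)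

lemma csubspace_vimage:
  assumes V: "csubspace V" and E: "csubspace E"
    and add: "\<And>x y. x \<in> V \<Longrightarrow> y \<in> V \<Longrightarrow> F (x + y) = F x + F y"
    and scale: "\<And>x c. x \<in> V \<Longrightarrow> F (c *\<^sub>C x) = c *\<^sub>C F x"
  shows "csubspace {x \<in> V. F x \<in> E}"
proof -
  have "F 0 = 0" using scale[OF complex_vector.subspace_0[OF V], of 0] by simp
  thus ?thesis using V E add scale unfolding complex_vector.subspace_def by simp
qed

lemma Lin_span_codomain:
  assumes f: "f \<in> Lin (cspan X) UNIV" and Y: "csubspace Y" and X: "\<And>x. x \<in> X \<Longrightarrow> f x \<in> Y"
  shows "f \<in> Lin (cspan X) Y"
proof (rule Lin_codomain[OF f])
  have "csubspace {x \<in> cspan X. f x \<in> Y}"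
    by (rule csubspace_vimage[OF complex_vector.subspace_span Y]) (use f in \<open>auto simp: Lin_def\<close>)
  moreover have "X \<subseteq> {x \<in> cspan X. f x \<in> Y}" using X complex_vector.span_base by auto
  ultimately have "cspan X \<subseteq> {x \<in> cspan X. f x \<in> Y}" by (rule complex_vector.span_minimal[rotated])
  thus "f x \<in> Y" if "x \<in> cspan X" for x using that by blast
qed

lemma Lin_expand:
  assumes "csubspace V" "f \<in> Lin V W" "\<And>a. a \<in> A \<Longrightarrow> v a \<in> V"
  shows "f (\<Sum>a\<in>A. c a *\<^sub>C v a) = (\<Sum>a\<in>A. c a *\<^sub>C f (v a))"
proof -
  obtain F where F: "clinear F" "\<forall>v\<in>V. F v = f v" using Lin_extend assms by metis
  thus ?thesis
    using clinear_expand[OF F(1), of c v A] csubspace_sum[OF assms(1), of A v c] assms(3) by simp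
qed

text \<open>
The functionals are required to be linear on the whole type, since the tensors of the model are
evaluated on such functionals only.
\<close>

definition dual_bases :: "'a::complex_vector set \<Rightarrow> 'j set \<Rightarrow> ('j \<Rightarrow> 'a) \<Rightarrow> ('j \<Rightarrow> 'a \<Rightarrow> complex) \<Rightarrow> bool" where
  "dual_bases V J b \<beta> \<longleftrightarrow> finite J \<and> csubspace V \<and> (\<forall>j\<in>J. b j \<in> V) \<and>
     (\<forall>j. clinear (\<beta> j)) \<and> (\<forall>i\<in>J. \<forall>j\<in>J. \<beta> i (b j) = of_bool (i = j)) \<and> (\<forall>v\<in>V. (\<Sum>j\<in>J. \<beta> j v *\<^sub>C b j) = v)"

lemma dual_bases_finite: "dual_bases V J b \<beta> \<Longrightarrow> finite J"
  by (simp add: dual_bases_def)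

lemma dual_bases_biorthogonal:
  "dual_bases V J b \<beta> \<Longrightarrow> i \<in> J \<Longrightarrow> j \<in> J \<Longrightarrow> \<beta> i (b j) = of_bool (i = j)"
  by (simp add: dual_bases_def)

lemma dual_bases_of_basis:
  assumes B: "finite B" "complex_vector.independent B" "cspan B = V"
  obtains d :: nat and b \<beta> where "dual_bases V {..<d} b \<beta>" "bij_betw b {..<d} B"
    "\<And>v j. v \<in> V \<Longrightarrow> j < d \<Longrightarrow> \<beta> j v = complex_vector.representation B v (b j)"
proof -
  obtain b where b: "bij_betw b {..<card B} B"
    using ex_bij_betw_nat_finite[OF B(1)] by (auto simp: lessThan_atLeast0)
  have V: "csubspace V" using B(3) by auto
  define r where "r j v = (if v \<in> V then complex_vector.representation B v (b j) else 0)" for j v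
  have "r j \<in> Lin V UNIV" for j
    unfolding Lin_def r_def using B V
    by (auto simp: complex_vector.representation_add complex_vector.representation_scale
        complex_vector.subspace_add complex_vector.subspace_scale)
  hence "\<exists>F. clinear F \<and> (\<forall>v\<in>V. F v = r j v)" for j using Lin_extend V by blast
  then obtain \<beta> where \<beta>: "\<And>j. clinear (\<beta> j)" "\<And>j v. v \<in> V \<Longrightarrow> \<beta> j v = r j v" by metis
  have bV: "b j \<in> V" "b j \<in> B" if "j < card B" for j
    using that b B(3) complex_vector.span_base by (auto simp: bij_betw_def)
  have eq: "\<beta> i (b j) = of_bool (i = j)" if "i < card B" "j < card B" for i j
    using that b bV[of j] B(2) inj_onD[OF bij_betw_imp_inj_on[OF b], of i j]
    by (auto simp: \<beta> r_def complex_vector.representation_basis)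
  have sum: "(\<Sum>j<card B. \<beta> j v *\<^sub>C b j) = v" if v: "v \<in> V" for v
  proof -
    have "(\<Sum>j<card B. \<beta> j v *\<^sub>C b j)
        = (\<Sum>j<card B. complex_vector.representation B v (b j) *\<^sub>C b j)"
      using v by (simp add: \<beta> r_def)
    also have "\<dots> = (\<Sum>x\<in>B. complex_vector.representation B v x *\<^sub>C x)"
      by (rule sum.reindex_bij_betw[OF b])
    also have "\<dots> = v"
      using complex_vector.sum_representation_eq[OF B(2) _ B(1) order.refl] v B(3) by simp
    finally show ?thesis .
  qed
  show thesis
    using that[of "card B" b \<beta>] V bV(1) \<beta> eq sum b unfolding dual_bases_def
    by (auto simp: r_def)
qed

lemma fin_dim_basis:
  assumes "fin_dim V"
  obtains B where "finite B" "complex_vector.independent B" "cspan B = V"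
proof -
  obtain B0 where B0: "finite B0" "cspan B0 = V" using assms by (auto simp: fin_dim_def)
  obtain B where "B \<subseteq> B0" "complex_vector.independent B" "cspan B = V"
    using complex_vector.maximal_independent_subset[of B0] B0(2)
    by (metis complex_vector.span_minimal complex_vector.span_mono complex_vector.subspace_span subset_antisym)
  thus thesis using that B0(1) finite_subset by blast
qed

lemma dual_bases_coords_sum:
  assumes "dual_bases V J b \<beta>" "i \<in> J"
  shows "\<beta> i (\<Sum>j\<in>J. c j *\<^sub>C b j) = c i"
proof -
  have "\<beta> i (\<Sum>j\<in>J. c j *\<^sub>C b j) = (\<Sum>j\<in>J. c j * of_bool (i = j))"
    using assms unfolding dual_bases_def by (simp add: clinear_expand)
  thus ?thesis using assms by (simp add: dual_bases_def of_bool_def if_distrib cong: if_cong)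
qed

lemma dual_bases_Lin_ext:
  assumes V: "dual_bases V J b \<beta>" and "f \<in> Lin V W" "f' \<in> Lin V W'"
    and "\<And>j. j \<in> J \<Longrightarrow> f (b j) = f' (b j)"
  shows "f = f'"
proof
  fix v
  have bV: "csubspace V" "j \<in> J \<Longrightarrow> b j \<in> V" for j using V by (auto simp: dual_bases_def)
  show "f v = f' v"
  proof (cases "v \<in> V")
    case True
    hence v: "(\<Sum>j\<in>J. \<beta> j v *\<^sub>C b j) = v" using V by (simp add: dual_bases_def)
    show ?thesis
      using Lin_expand[where v = b and A = J and c = "\<lambda>j. \<beta> j v", OF bV(1) assms(2) bV(2)]
        Lin_expand[where v = b and A = J and c = "\<lambda>j. \<beta> j v", OF bV(1) assms(3) bV(2)] assms(4) unfolding v by simp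
  qed (use assms in \<open>auto simp: Lin_def\<close>)
qed

lemma Lin_of_coords:
  fixes x :: "'k \<Rightarrow> 'j \<Rightarrow> complex"
  assumes V: "dual_bases V J b \<beta>" and W: "dual_bases W J' w \<omega>"
  defines "f \<equiv> \<lambda>v. if v \<in> V then \<Sum>k\<in>J'. (\<Sum>j\<in>J. x k j * \<beta> j v) *\<^sub>C w k else 0"
  shows "f \<in> Lin V W" and "j \<in> J \<Longrightarrow> k \<in> J' \<Longrightarrow> \<omega> k (f (b j)) = x k j"
proof -
  have "clinear (\<lambda>v. \<Sum>k\<in>J'. (\<Sum>j\<in>J. x k j * \<beta> j v) *\<^sub>C w k)"
    using V by (simp add: clinear_iff dual_bases_def distrib_left sum.distrib scaleC_add_left
        complex_vector.scale_sum_right scaleC_scaleC sum_distrib_left ac_simps cong: sum.cong)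
  moreover have "csubspace V" using V by (simp add: dual_bases_def)
  moreover have "(\<Sum>k\<in>J'. (\<Sum>j\<in>J. x k j * \<beta> j v) *\<^sub>C w k) \<in> W" for v
    using W by (intro csubspace_sum) (auto simp: dual_bases_def)
  ultimately show "f \<in> Lin V W"
    unfolding f_def by (intro Lin_codomain[OF Lin_restrictI]) auto
  assume jk: "j \<in> J" "k \<in> J'"
  have "\<omega> k (f (b j)) = (\<Sum>j'\<in>J. x k j' * \<beta> j' (b j))"
    using jk V dual_bases_coords_sum[OF W jk(2)] by (simp add: f_def dual_bases_def)
  also have "\<dots> = (\<Sum>j'\<in>J. x k j' * of_bool (j' = j))" using jk V by (simp add: dual_bases_def)
  also have "\<dots> = x k j"
    using jk V by (simp add: dual_bases_def of_bool_def if_distrib cong: if_cong)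
  finally show "\<omega> k (f (b j)) = x k j" .
qed

lemma Lin_basis_expand:
  assumes V: "dual_bases V J b \<beta>" and W: "dual_bases W J' w \<omega>" and f: "f \<in> Lin V W"
  shows "(\<Sum>k\<in>J'. \<Sum>j\<in>J. \<omega> k (f (b j)) *\<^sub>C (\<lambda>v. if v \<in> V then \<beta> j v *\<^sub>C w k else 0)) = f"
proof
  fix v
  have sub: "csubspace V" "\<And>j. j \<in> J \<Longrightarrow> b j \<in> V" using V by (auto simp: dual_bases_def)
  show "(\<Sum>k\<in>J'. \<Sum>j\<in>J. \<omega> k (f (b j)) *\<^sub>C (\<lambda>v. if v \<in> V then \<beta> j v *\<^sub>C w k else 0)) v = f v"
  proof (cases "v \<in> V")
    case True
    have "f v = f (\<Sum>j\<in>J. \<beta> j v *\<^sub>C b j)" using True V by (simp add: dual_bases_def)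
    also have "\<dots> = (\<Sum>j\<in>J. \<beta> j v *\<^sub>C f (b j))" by (rule Lin_expand[OF sub(1) f sub(2)])
    also have "\<dots> = (\<Sum>j\<in>J. \<beta> j v *\<^sub>C (\<Sum>k\<in>J'. \<omega> k (f (b j)) *\<^sub>C w k))"
      using W Lin_mem[OF f sub(2)] by (simp add: dual_bases_def)
    also have "\<dots> = (\<Sum>k\<in>J'. \<Sum>j\<in>J. \<omega> k (f (b j)) *\<^sub>C \<beta> j v *\<^sub>C w k)"
      by (subst sum.swap) (simp add: complex_vector.scale_sum_right scaleC_scaleC mult.commute)
    finally show ?thesis using True by (simp add: sum_fun_apply)
  qed (use f in \<open>simp add: Lin_def sum_fun_apply\<close>)
qed

lemma dual_bases_dual:
  assumes V: "dual_bases V J v \<alpha>"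
  shows "dual_bases (dual V) J (\<lambda>j x. if x \<in> V then \<alpha> j x else 0) (\<lambda>j \<phi>. \<phi> (v j))"
proof -
  have sub: "csubspace V" "\<And>j. j \<in> J \<Longrightarrow> v j \<in> V" using V by (auto simp: dual_bases_def)
  have "csubspace (dual V)"
    using sub unfolding complex_vector.subspace_def Lin_def by (auto simp: algebra_simps)
  moreover have "(\<lambda>x. if x \<in> V then \<alpha> j x else 0) \<in> dual V" if "j \<in> J" for j
    using that V sub by (intro Lin_restrictI) (auto simp: dual_bases_def)
  moreover have "clinear (\<lambda>\<phi>. \<phi> (v j) :: complex)" for j by (simp add: clinear_iff)
  moreover have "(\<Sum>j\<in>J. \<phi> (v j) *\<^sub>C (\<lambda>x. if x \<in> V then \<alpha> j x else 0)) = \<phi>" if \<phi>: "\<phi> \<in> dual V" for \<phi>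
  proof
    fix x
    show "(\<Sum>j\<in>J. \<phi> (v j) *\<^sub>C (\<lambda>x. if x \<in> V then \<alpha> j x else 0)) x = \<phi> x"
    proof (cases "x \<in> V")
      case True
      have "\<phi> (\<Sum>j\<in>J. \<alpha> j x *\<^sub>C v j) = (\<Sum>j\<in>J. \<alpha> j x *\<^sub>C \<phi> (v j))"
        by (rule Lin_expand[OF sub(1) \<phi> sub(2)])
      thus ?thesis using True V by (simp add: dual_bases_def sum_fun_apply mult.commute)
    qed (use \<phi> in \<open>simp add: Lin_def sum_fun_apply\<close>)
  qed
  ultimately show ?thesis using V unfolding dual_bases_def by auto
qed

section \<open>Matrix coefficients of irreducible representations\<close>

lemma exists_eigenvector:
  fixes a :: "nat \<Rightarrow> nat \<Rightarrow> complex"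
  assumes "d > 0"
  obtains \<kappa> x where "\<exists>i<d. x i \<noteq> 0" "\<And>i. i < d \<Longrightarrow> (\<Sum>j<d. a i j * x j) = \<kappa> * x i"
proof -
  define A where "A = mat d d (\<lambda>(i, j). a i j)"
  have A: "A \<in> carrier_mat d d" by (simp add: A_def)
  obtain \<kappa> x where "eigenvector A x \<kappa>"
    using spectrum_non_empty[OF A assms] by (auto simp: spectrum_def eigenvalue_def)
  hence x: "x \<in> carrier_vec d" "x \<noteq> 0\<^sub>v d" "A *\<^sub>v x = \<kappa> \<cdot>\<^sub>v x"
    using A by (auto simp: eigenvector_def)
  show thesis
  proof (rule that[of "vec_index x" \<kappa>])
    show "\<exists>i<d. vec_index x i \<noteq> 0"
      using x(1,2) eq_vecI[of x "0\<^sub>v d"] by auto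
    fix i assume i: "i < d"
    have "vec_index (A *\<^sub>v x) i = (\<Sum>j<d. a i j * vec_index x j)"
      using i x(1) by (simp add: A_def scalar_prod_def lessThan_atLeast0)
    thus "(\<Sum>j<d. a i j * vec_index x j) = \<kappa> * vec_index x i" using x(1,3) i by simp
  qed
qed

lemma hom_GL:
  assumes "group G" "csubspace V" "\<rho> \<in> hom G (GL V)"
  shows "g \<in> carrier G \<Longrightarrow> \<rho> g \<in> Lin V V"
    and "g \<in> carrier G \<Longrightarrow> h \<in> carrier G \<Longrightarrow> \<rho> (g \<otimes>\<^bsub>G\<^esub> h) v = \<rho> g (\<rho> h v)"
    and "v \<in> V \<Longrightarrow> \<rho> \<one>\<^bsub>G\<^esub> v = v"
proof -
  interpret group G by fact
  show lin: "\<rho> g \<in> Lin V V" if "g \<in> carrier G" for g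
    using that assms(3) by (auto simp: hom_def GL_def)
  show mult: "\<rho> (g \<otimes>\<^bsub>G\<^esub> h) v = \<rho> g (\<rho> h v)" if "g \<in> carrier G" "h \<in> carrier G" for g h v
    using that assms(3) by (auto simp: hom_def GL_def)
  have "bij_betw (\<rho> \<one>\<^bsub>G\<^esub>) V V" using assms(3) by (auto simp: hom_def GL_def)
  hence inj: "inj_on (\<rho> \<one>\<^bsub>G\<^esub>) V" by (rule bij_betw_imp_inj_on)
  show "\<rho> \<one>\<^bsub>G\<^esub> v = v" if "v \<in> V"
    using inj_onD[OF inj mult[of "\<one>\<^bsub>G\<^esub>" "\<one>\<^bsub>G\<^esub>" v, simplified, symmetric]] that lin[of "\<one>\<^bsub>G\<^esub>"]
    by (auto simp: Lin_def)
qed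

lemma irreducible_rep_subspace_eq:
  assumes "irreducible_rep G V \<rho>" "csubspace W" "W \<subseteq> V" "w \<in> W" "w \<noteq> 0"
    and "\<And>g x. g \<in> carrier G \<Longrightarrow> x \<in> W \<Longrightarrow> \<rho> g x \<in> W"
  shows "W = V"
  using assms unfolding irreducible_rep_def by (metis image_subset_iff singletonD)

text \<open>
Schur's lemma: an eigenspace of an intertwiner is an invariant subspace.
\<close>

lemma intertwiner_scalar:
  assumes V: "dual_bases V {..<d::nat} b \<beta>" and irr: "irreducible_rep G V \<rho>"
    and lin: "\<And>g. g \<in> carrier G \<Longrightarrow> \<rho> g \<in> Lin V V"
    and f: "f \<in> Lin V V" and comm: "\<And>g v. g \<in> carrier G \<Longrightarrow> v \<in> V \<Longrightarrow> f (\<rho> g v) = \<rho> g (f v)"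
  obtains \<kappa> where "\<And>v. v \<in> V \<Longrightarrow> f v = \<kappa> *\<^sub>C v"
proof -
  have sub: "csubspace V" and bV: "\<And>j. j < d \<Longrightarrow> b j \<in> V" using V by (auto simp: dual_bases_def)
  have "d > 0"
  proof (rule ccontr)
    assume "\<not> d > 0"
    hence "V \<subseteq> {0}" using V by (auto simp: dual_bases_def)
    thus False using irr complex_vector.subspace_0[OF sub] by (auto simp: irreducible_rep_def)
  qed
  then obtain \<kappa> x where x: "\<exists>i<d. x i \<noteq> 0"
    "\<And>i. i < d \<Longrightarrow> (\<Sum>j<d. \<beta> i (f (b j)) * x j) = \<kappa> * x i"
    using exists_eigenvector[of d "\<lambda>i j. \<beta> i (f (b j))"] by metis
  define w where "w = (\<Sum>j<d. x j *\<^sub>C b j)"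
  have wV: "w \<in> V" unfolding w_def using csubspace_sum sub bV by (metis lessThan_iff)
  have "f w = (\<Sum>j<d. x j *\<^sub>C f (b j))"
    unfolding w_def by (rule Lin_expand[OF sub f]) (use bV in auto)
  also have "\<dots> = (\<Sum>j<d. x j *\<^sub>C (\<Sum>i<d. \<beta> i (f (b j)) *\<^sub>C b i))"
    using V f bV by (simp add: dual_bases_def Lin_def)
  also have "\<dots> = (\<Sum>i<d. \<Sum>j<d. (x j * \<beta> i (f (b j))) *\<^sub>C b i)"
    by (subst sum.swap) (simp add: complex_vector.scale_sum_right)
  also have "\<dots> = (\<Sum>i<d. (\<kappa> * x i) *\<^sub>C b i)"
    using x(2) by (simp add: mult.commute flip: complex_vector.scale_sum_left)
  also have "\<dots> = \<kappa> *\<^sub>C w" by (simp add: w_def complex_vector.scale_sum_right)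
  finally have fw: "f w = \<kappa> *\<^sub>C w" .
  have w0: "w \<noteq> 0"
  proof
    assume "w = 0"
    hence "x i = 0" if "i < d" for i
      using dual_bases_coords_sum[OF V, of i x] that V clinear_0[of "\<beta> i"]
      by (simp add: w_def dual_bases_def)
    thus False using x(1) by blast
  qed
  have "{v \<in> V. f v = \<kappa> *\<^sub>C v} = V"
  proof (rule irreducible_rep_subspace_eq[OF irr _ _ _ w0])
    show "csubspace {v \<in> V. f v = \<kappa> *\<^sub>C v}"
      using sub f Lin_0[OF f] unfolding complex_vector.subspace_def Lin_def
      by (auto simp: complex_vector.scale_right_distrib complex_vector.scale_left_commute)
    fix g v assume "g \<in> carrier G" "v \<in> {v \<in> V. f v = \<kappa> *\<^sub>C v}"
    thus "\<rho> g v \<in> {v \<in> V. f v = \<kappa> *\<^sub>C v}" using lin[of g] comm[of g v] by (auto simp: Lin_def)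
  qed (use wV fw in auto)
  thus thesis using that by blast
qed

text \<open>
The relations \<open>\<Sum>\<^sub>j \<beta>\<^sub>j (\<rho>(g) v\<^sub>j) = 0\<close> between the first \<open>k\<close> coordinate functionals form a
subrepresentation \<open>R\<close> of \<open>V\<^sup>k\<close>. By induction, a relation is determined by its last entry. If some
last entry is nonzero, the last entries fill \<open>V\<close> by irreducibility, and the other entries are
intertwining functions of the last one, hence multiples of it. So \<open>\<Sum>\<^sub>j \<kappa>\<^sub>j \<beta>\<^sub>j\<close> vanishes on \<open>V\<close> with
last coefficient 1, which is absurd.
\<close>

lemma Burnside_relations:
  assumes G: "group G" and V: "dual_bases V {..<d::nat} b \<beta>" and hom: "\<rho> \<in> hom G (GL V)"
    and irr: "irreducible_rep G V \<rho>"
    and "k \<le> d" "\<And>j. j < k \<Longrightarrow> v j \<in> V"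
    and "\<And>g. g \<in> carrier G \<Longrightarrow> (\<Sum>j<k. \<beta> j (\<rho> g (v j))) = 0"
  shows "j < k \<Longrightarrow> v j = 0"
  using assms(5-)
proof (induction k arbitrary: v j)
  case (Suc k)
  interpret group G by fact
  have sub: "csubspace V" using V by (simp add: dual_bases_def)
  note rep = hom_GL[OF G sub hom]
  define R where "R = {u. (\<forall>j\<le>k. u j \<in> V) \<and> (\<forall>g\<in>carrier G. (\<Sum>j\<le>k. \<beta> j (\<rho> g (u j))) = 0)}"
  have \<beta>: "clinear (\<beta> j)" if "j \<le> k" for j using V that Suc.prems(2) by (auto simp: dual_bases_def)
  have unique: "u j = u' j" if "u \<in> R" "u' \<in> R" "u k = u' k" "j \<le> k" for u u' j
  proof (cases "j = k")
    case False
    have lin: "\<beta> i (\<rho> g (u i + c *\<^sub>C u' i)) = \<beta> i (\<rho> g (u i)) + c * \<beta> i (\<rho> g (u' i))"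
      if "i \<le> k" "g \<in> carrier G" for i g c
      using that rep(1)[of g] \<open>u \<in> R\<close> \<open>u' \<in> R\<close> \<beta>[of i] sub
      by (simp add: R_def Lin_def clinear_iff complex_vector.subspace_scale)
    have *: "\<beta> i (\<rho> g (u i - u' i)) = \<beta> i (\<rho> g (u i)) - \<beta> i (\<rho> g (u' i))"
      if "i \<le> k" "g \<in> carrier G" for i g
      using lin[OF that, of "- 1"] by simp
    have "u j - u' j = 0"
    proof (rule Suc.IH)
      show "(\<Sum>i<k. \<beta> i (\<rho> g (u i - u' i))) = 0" if g: "g \<in> carrier G" for g
      proof -
        have "(\<Sum>i\<le>k. \<beta> i (\<rho> g (u i))) = 0" "(\<Sum>i\<le>k. \<beta> i (\<rho> g (u' i))) = 0"
          using \<open>u \<in> R\<close> \<open>u' \<in> R\<close> g by (auto simp: R_def)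
        hence "(\<Sum>i<k. \<beta> i (\<rho> g (u i))) = (\<Sum>i<k. \<beta> i (\<rho> g (u' i)))"
          using \<open>u k = u' k\<close> unfolding lessThan_Suc_atMost[symmetric] sum.lessThan_Suc
          by (metis add_right_cancel)
        thus ?thesis using * g by (simp add: sum_subtractf)
      qed
    qed (use False that Suc.prems(2) sub in \<open>auto simp: R_def complex_vector.subspace_diff\<close>)
    thus ?thesis by simp
  qed (use that in auto)
  have R_add: "(\<lambda>j. u j + u' j) \<in> R" if "u \<in> R" "u' \<in> R" for u u'
    using that sub rep(1) \<beta> unfolding R_def Lin_def
    by (auto simp: complex_vector.subspace_add clinear_iff sum.distrib)
  have R_scale: "(\<lambda>j. c *\<^sub>C u j) \<in> R" if "u \<in> R" for u c
    using that sub rep(1) \<beta> unfolding R_def Lin_def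
    by (auto simp: complex_vector.subspace_scale clinear_iff simp flip: sum_distrib_left)
  have R_act: "(\<lambda>j. \<rho> h (u j)) \<in> R" if "u \<in> R" "h \<in> carrier G" for u h
    using that rep(1)[of h] rep(2)[symmetric] unfolding R_def Lin_def by auto
  have vR: "v \<in> R" using Suc.prems by (auto simp: R_def lessThan_Suc_atMost less_Suc_eq_le)
  have zR: "(\<lambda>_. 0) \<in> R" using R_scale[OF vR, of 0] by simp
  show ?case
  proof (cases "v k = 0")
    case True
    thus ?thesis using unique[OF vR zR] Suc.prems(1) by (simp add: less_Suc_eq_le)
  next
    case False
    have "(\<lambda>u. u k) ` R = V"
    proof (rule irreducible_rep_subspace_eq[OF irr _ _ _ False])
      show "csubspace ((\<lambda>u. u k) ` R)"
        unfolding complex_vector.subspace_def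
        using imageI[OF zR, of "\<lambda>u. u k"] imageI[OF R_add, of _ _ "\<lambda>u. u k"]
          imageI[OF R_scale, of _ "\<lambda>u. u k"] by auto
      show "\<rho> g x \<in> (\<lambda>u. u k) ` R" if "g \<in> carrier G" "x \<in> (\<lambda>u. u k) ` R" for g x
        using that imageI[OF R_act, of _ _ "\<lambda>u. u k"] by auto
    qed (use vR in \<open>auto simp: R_def\<close>)
    hence "\<forall>x\<in>V. \<exists>u. u \<in> R \<and> u k = x" by blast
    from bchoice[OF this] obtain U where U: "\<And>x. x \<in> V \<Longrightarrow> U x \<in> R \<and> U x k = x" by blast
    (* The entry j of a relation is an intertwining function of its last entry. *)
    have "\<exists>\<kappa>. \<forall>x\<in>V. U x j = \<kappa> *\<^sub>C x" if j: "j \<le> k" for j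
    proof -
      have U_eq: "U (u k) j = u j" if "u \<in> R" for u
      proof -
        have "u k \<in> V" using that by (simp add: R_def)
        thus ?thesis using unique[OF _ that _ j, of "U (u k)"] U by blast
      qed
      let ?f = "\<lambda>x. if x \<in> V then U x j else 0"
      have add: "U (x + y) j = U x j + U y j" if "x \<in> V" "y \<in> V" for x y
        using U_eq[OF R_add, of "U x" "U y"] U that by simp
      have scale: "U (c *\<^sub>C x) j = c *\<^sub>C U x j" if "x \<in> V" for x c
        using U_eq[OF R_scale, of "U x" c] U that by simp
      have comm: "U (\<rho> g x) j = \<rho> g (U x j)" if "x \<in> V" "g \<in> carrier G" for x g
        using U_eq[OF R_act, of "U x" g] U that by simp
      have UV: "U x j \<in> V" if "x \<in> V" for x using U[OF that] j by (simp add: R_def)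
      have f: "?f \<in> Lin V V"
        using add scale UV sub
        by (auto simp: Lin_def complex_vector.subspace_add complex_vector.subspace_scale)
      have "?f (\<rho> g x) = \<rho> g (?f x)" if "g \<in> carrier G" "x \<in> V" for g x
        using comm that rep(1)[of g] by (auto simp: Lin_def)
      then obtain \<kappa> where "\<And>x. x \<in> V \<Longrightarrow> ?f x = \<kappa> *\<^sub>C x"
        using intertwiner_scalar[OF V irr rep(1) f] by blast
      thus ?thesis by auto
    qed
    then obtain \<kappa> where \<kappa>: "\<And>j x. j \<le> k \<Longrightarrow> x \<in> V \<Longrightarrow> U x j = \<kappa> j *\<^sub>C x" by metis
    have kd: "k < d" using Suc.prems(2) by simp
    have bk: "b k \<in> V" "\<And>j. j \<le> k \<Longrightarrow> \<beta> j (b k) = of_bool (j = k)"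
      using V kd by (auto simp: dual_bases_def)
    have "0 = (\<Sum>j\<le>k. \<beta> j (\<rho> \<one>\<^bsub>G\<^esub> (U (b k) j)))" using U[OF bk(1)] by (simp add: R_def)
    also have "\<dots> = (\<Sum>j\<le>k. \<kappa> j * of_bool (j = k))"
      using \<kappa>[OF _ bk(1)] bk rep(3) \<beta> complex_vector.subspace_scale[OF sub bk(1)]
      by (intro sum.cong) (simp_all add: clinear_iff)
    also have "\<dots> = \<kappa> k" by (simp add: of_bool_def if_distrib cong: if_cong)
    finally have "\<kappa> k = 0" by simp
    hence "b k = 0" using \<kappa>[OF order.refl bk(1)] U[OF bk(1)] by simp
    hence "\<beta> k (b k) = 0" using \<beta>[of k] clinear_0 by simp
    thus ?thesis using bk(2)[of k] by simp
  qed
qed simp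

text \<open>
Burnside's theorem, in the form that no linear functional on the endomorphisms of \<open>V\<close> other than 0
vanishes on all the operators of an irreducible representation.
\<close>

theorem irreducible_matrix_coeffs_independent:
  assumes G: "group G" and V: "dual_bases V {..<d::nat} b \<beta>" and hom: "\<rho> \<in> hom G (GL V)"
    and irr: "irreducible_rep G V \<rho>"
    and 0: "\<And>g. g \<in> carrier G \<Longrightarrow> (\<Sum>(p, q)\<in>{..<d} \<times> {..<d}. a p q * \<beta> p (\<rho> g (b q))) = 0"
    and "p < d" "q < d"
  shows "a p q = 0"
proof -
  have sub: "csubspace V" and bV: "\<And>j. j < d \<Longrightarrow> b j \<in> V" using V by (auto simp: dual_bases_def)
  note rep = hom_GL[OF G sub hom]
  define v where "v p = (\<Sum>q<d. a p q *\<^sub>C b q)" for p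
  have "v p = 0"
  proof (rule Burnside_relations[OF G V hom irr order.refl _ _ \<open>p < d\<close>])
    show "v j \<in> V" for j unfolding v_def using csubspace_sum sub bV by (metis lessThan_iff)
    fix g assume g: "g \<in> carrier G"
    have "\<rho> g (v j) = (\<Sum>q<d. a j q *\<^sub>C \<rho> g (b q))" for j
      unfolding v_def using rep(1)[OF g] bV by (intro Lin_expand[OF sub]) auto
    hence "\<beta> j (\<rho> g (v j)) = (\<Sum>q<d. a j q * \<beta> j (\<rho> g (b q)))" if "j < d" for j
      using that V by (simp add: clinear_expand[of "\<beta> j"] dual_bases_def)
    thus "(\<Sum>j<d. \<beta> j (\<rho> g (v j))) = 0"
      using 0[OF g] by (simp add: sum.cartesian_product)
  qed
  hence "\<beta> q (\<Sum>q<d. a p q *\<^sub>C b q) = 0"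
    using V \<open>q < d\<close> clinear_0[of "\<beta> q"] by (simp add: v_def dual_bases_def)
  thus ?thesis using dual_bases_coords_sum[OF V, of q] \<open>q < d\<close> by simp
qed

section \<open>Sums and products over finite products of index sets\<close>

text \<open>
By induction on the set of variables: independence in the variable \<open>g i\<close> allows the terms to be
sorted by their factor in that variable. The terms are indexed by an arbitrary finite set, so that
sorting only shrinks this set.
\<close>

lemma products_independent:
  fixes u :: "'i \<Rightarrow> 'y \<Rightarrow> 'x \<Rightarrow> complex"
  assumes "finite I" "finite Z"
    and indep: "\<And>i c a. i \<in> I \<Longrightarrow> (\<And>x. x \<in> X i \<Longrightarrow> (\<Sum>a\<in>Y i. c a * u i a x) = 0) \<Longrightarrow> a \<in> Y i \<Longrightarrow> c a = 0"
    and "\<And>i. i \<in> I \<Longrightarrow> finite (Y i)" "\<And>i z. i \<in> I \<Longrightarrow> z \<in> Z \<Longrightarrow> y z i \<in> Y i"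
    and "\<And>g. g \<in> PiE I X \<Longrightarrow> (\<Sum>z\<in>Z. c z * (\<Prod>i\<in>I. u i (y z i) (g i))) = 0"
    and "\<And>i. i \<in> I \<Longrightarrow> a i \<in> Y i"
  shows "(\<Sum>z | z \<in> Z \<and> (\<forall>i\<in>I. y z i = a i). c z) = 0"
  using assms
proof (induction I arbitrary: Z rule: finite_induct)
  case empty
  thus ?case by simp
next
  case (insert i I)
  let ?Z = "{z \<in> Z. y z i = a i}"
  have "(\<Sum>z | z \<in> ?Z \<and> (\<forall>i\<in>I. y z i = a i). c z) = 0"
  proof (rule insert.IH)
    fix g assume g: "g \<in> PiE I X"
    let ?P = "\<lambda>z. \<Prod>i\<in>I. u i (y z i) (g i)"
    have "(\<Sum>a\<in>Y i. (\<Sum>z | z \<in> Z \<and> y z i = a. c z * ?P z) * u i a x) = 0" if x: "x \<in> X i" for x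
    proof -
      have "(\<Sum>z\<in>Z. c z * (\<Prod>j\<in>insert i I. u j (y z j) ((g(i := x)) j))) = 0"
        using insert.prems(5)[OF PiE_fun_upd[OF x g]] .
      moreover have "(\<Prod>j\<in>I. u j (y z j) ((g(i := x)) j)) = ?P z" for z
        using insert.hyps by (intro prod.cong) auto
      ultimately have "0 = (\<Sum>z\<in>Z. c z * ?P z * u i (y z i) x)"
        using insert.hyps by (simp add: ac_simps)
      also have "\<dots> = (\<Sum>a\<in>Y i. \<Sum>z | z \<in> Z \<and> y z i = a. c z * ?P z * u i (y z i) x)"
        using insert.prems by (intro sum.group[symmetric]) auto
      also have "\<dots> = (\<Sum>a\<in>Y i. (\<Sum>z | z \<in> Z \<and> y z i = a. c z * ?P z) * u i a x)"
        by (auto simp: sum_distrib_right intro!: sum.cong)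
      finally show ?thesis ..
    qed
    from insert.prems(2)[OF _ this, of "a i"] insert.prems(6)[of i]
    show "(\<Sum>z\<in>?Z. c z * ?P z) = 0" by simp
  qed (use insert.prems in auto)
  moreover have "{z \<in> ?Z. \<forall>i\<in>I. y z i = a i} = {z \<in> Z. \<forall>i\<in>insert i I. y z i = a i}" by auto
  ultimately show ?case by simp
qed

lemma sum_PiE_insert:
  assumes "i \<notin> I"
  shows "(\<Sum>z\<in>PiE (insert i I) Z. h z) = (\<Sum>a\<in>Z i. \<Sum>z\<in>PiE I Z. h (z(i := a)))"
  unfolding PiE_insert_eq sum.cartesian_product
  by (subst sum.reindex[OF inj_combinator[OF assms]]) (simp add: case_prod_unfold)

lemma sum_Times: "(\<Sum>c\<in>A \<times> B. f c) = (\<Sum>q\<in>A. \<Sum>r\<in>B. f (q, r))"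
  by (simp add: sum.cartesian_product)

text \<open>
Let \<open>p\<^sub>i\<close> be a linear projection onto \<open>V\<^sub>i\<close>. It does not change the slices in direction \<open>i\<close>, so
the array is not changed if the projections are applied in all directions. This replaces
the unit array at \<open>w\<close> by the product of the vectors \<open>p\<^sub>i (\<delta> (w i))\<close>.
\<close>

lemma array_of_slices:
  fixes c :: "('i \<Rightarrow> 'z) \<Rightarrow> complex" and V :: "'i \<Rightarrow> ('z \<Rightarrow> complex) set"
  assumes "finite I" and fin: "\<And>i. i \<in> I \<Longrightarrow> finite (Z i)" and V: "\<And>i. i \<in> I \<Longrightarrow> csubspace (V i)"
    and slice: "\<And>i z. i \<in> I \<Longrightarrow> z \<in> PiE I Z \<Longrightarrow> (\<lambda>a. if a \<in> Z i then c (z(i := a)) else 0) \<in> V i"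
  obtains P where "\<And>i a. i \<in> I \<Longrightarrow> P i a \<in> V i"
    "\<And>z. z \<in> PiE I Z \<Longrightarrow> c z = (\<Sum>w\<in>PiE I Z. c w * (\<Prod>i\<in>I. P i (w i) (z i)))"
proof -
  interpret vector_space_pair "scaleC :: complex \<Rightarrow> ('z \<Rightarrow> complex) \<Rightarrow> _" "scaleC :: complex \<Rightarrow> ('z \<Rightarrow> complex) \<Rightarrow> _" ..
  have "\<exists>p. range p \<subseteq> V i \<and> clinear p \<and> (\<forall>v\<in>V i. p v = v)" if "i \<in> I" for i
    using linear_exists_left_inverse_on[of id "V i"] V[OF that] complex_vector.linear_id by auto
  then obtain p where p: "\<And>i. i \<in> I \<Longrightarrow> range (p i) \<subseteq> V i" "\<And>i. i \<in> I \<Longrightarrow> clinear (p i)"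
    "\<And>i v. i \<in> I \<Longrightarrow> v \<in> V i \<Longrightarrow> p i v = v" by metis
  define P where "P i a = p i (\<lambda>b. of_bool (a = b))" for i a
  have one: "c z = (\<Sum>a\<in>Z i. c (z(i := a)) * P i a (z i))" if i: "i \<in> I" and z: "z \<in> PiE I Z" for i z
  proof -
    let ?s = "\<lambda>a. if a \<in> Z i then c (z(i := a)) else 0"
    have "?s = (\<Sum>a\<in>Z i. c (z(i := a)) *\<^sub>C (\<lambda>b. of_bool (a = b)))"
      using fin[OF i] by (simp add: fun_eq_iff sum_fun_apply of_bool_def if_distrib cong: if_cong)
    hence "p i ?s = (\<Sum>a\<in>Z i. c (z(i := a)) *\<^sub>C P i a)"
      by (simp add: clinear_expand[OF p(2)[OF i]] P_def)
    hence "?s = (\<Sum>a\<in>Z i. c (z(i := a)) *\<^sub>C P i a)" unfolding p(3)[OF i slice[OF i z]] .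
    from fun_cong[OF this, of "z i"]
    have "?s (z i) = (\<Sum>a\<in>Z i. c (z(i := a)) * P i a (z i))" by (simp add: sum_fun_apply)
    moreover have "z i \<in> Z i" using z i by (rule PiE_mem)
    ultimately show ?thesis by simp
  qed
  have "c z = (\<Sum>w\<in>PiE J Z. c (\<lambda>i. if i \<in> J then w i else z i) * (\<Prod>i\<in>J. P i (w i) (z i)))"
    if "J \<subseteq> I" "z \<in> PiE I Z" for J z
    using finite_subset[OF \<open>J \<subseteq> I\<close> \<open>finite I\<close>] that
  proof (induction J rule: finite_induct)
    case (insert i J)
    let ?z = "\<lambda>w i. if i \<in> J then w i else z i"
    have z: "?z w \<in> PiE I Z" if "w \<in> PiE J Z" for w
      using that insert.prems by (auto simp: PiE_iff extensional_def)
    have "c z = (\<Sum>w\<in>PiE J Z. c (?z w) * (\<Prod>i\<in>J. P i (w i) (z i)))" using insert by simp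
    also have "\<dots> = (\<Sum>w\<in>PiE J Z. (\<Sum>a\<in>Z i. c ((?z w)(i := a)) * P i a (z i)) * (\<Prod>i\<in>J. P i (w i) (z i)))"
      using one[OF _ z, of i] insert by (intro sum.cong refl) auto
    also have "\<dots> = (\<Sum>a\<in>Z i. \<Sum>w\<in>PiE J Z. c ((?z w)(i := a)) * (P i a (z i) * (\<Prod>i\<in>J. P i (w i) (z i))))"
      by (subst sum.swap) (simp add: sum_distrib_left sum_distrib_right ac_simps)
    also have "\<dots> = (\<Sum>w\<in>PiE (insert i J) Z. c (\<lambda>j. if j \<in> insert i J then w j else z j) *
        (\<Prod>j\<in>insert i J. P j (w j) (z j)))"
    proof -
      have "(?z w)(i := a) = (\<lambda>j. if j \<in> insert i J then (w(i := a)) j else z j)" for w a by auto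
      moreover have "(\<Prod>j\<in>J. P j ((w(i := a)) j) (z j)) = (\<Prod>j\<in>J. P j (w j) (z j))" for w a
        using insert.hyps by (intro prod.cong) auto
      ultimately show ?thesis using insert.hyps by (simp add: sum_PiE_insert)
    qed
    finally show ?case .
  qed simp
  note all = this[OF order.refl]
  have "c z = (\<Sum>w\<in>PiE I Z. c w * (\<Prod>i\<in>I. P i (w i) (z i)))" if "z \<in> PiE I Z" for z
  proof -
    have "(\<lambda>i. if i \<in> I then w i else z i) = w" if "w \<in> PiE I Z" for w
      using \<open>z \<in> PiE I Z\<close> that by (auto simp: PiE_iff extensional_def)
    thus ?thesis using all[OF that] by simp
  qed
  moreover have "P i a \<in> V i" if "i \<in> I" for i a using p(1)[OF that] by (auto simp: P_def)
  ultimately show thesis using that by blast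
qed

lemma PiE_vertices: "1 \<le> (n::nat) \<Longrightarrow> {1..n+1} = insert 1 (insert (n+1) {2..n})"
  by auto

lemma prod_vertices:
  "1 \<le> (n::nat) \<Longrightarrow> (\<Prod>i=1..n+1. f i) = f 1 * (\<Prod>i=2..n. f i) * (f (n+1) :: complex)"
  unfolding PiE_vertices by (subst prod.insert; simp)

lemma sum_vertices:
  assumes "1 \<le> (n::nat)"
  shows "(\<Sum>z\<in>PiE {1..n+1} Z. h z)
       = (\<Sum>a\<in>Z 1. \<Sum>y\<in>Z (n+1). \<Sum>z\<in>PiE {2..n} Z. h (z(n+1 := y, 1 := a)))"
  unfolding PiE_vertices[OF assms] using assms by (simp add: sum_PiE_insert)

section \<open>Tensor products in coordinates\<close>

lemma tens_in_tensor: "v \<in> V \<Longrightarrow> w \<in> W \<Longrightarrow> v \<otimes>\<^sub>v w \<in> V \<otimes>\<^sub>V W"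
  unfolding tensor_def by (blast intro: complex_vector.span_base)

lemma Tens_in_Tensor: "(\<And>i. i \<in> I \<Longrightarrow> v i \<in> V i) \<Longrightarrow> Tens I v \<in> Tensor I V"
  unfolding Tensor_def by (blast intro: complex_vector.span_base)

lemma tens_sum_left: "(\<Sum>a\<in>A. c a *\<^sub>C v a) \<otimes>\<^sub>v w = (\<Sum>a\<in>A. c a *\<^sub>C (v a \<otimes>\<^sub>v w))"
  by (induction A rule: infinite_finite_induct) (simp_all add: tens_linear)

lemma tens_sum_right: "v \<otimes>\<^sub>v (\<Sum>a\<in>A. c a *\<^sub>C w a) = (\<Sum>a\<in>A. c a *\<^sub>C (v \<otimes>\<^sub>v w a))"
  by (induction A rule: infinite_finite_induct) (simp_all add: tens_linear)

lemma Tens_sum: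
  assumes "finite I" "\<And>i. i \<in> I \<Longrightarrow> finite (Z i)"
  shows "Tens I (\<lambda>i. \<Sum>a\<in>Z i. c i a *\<^sub>C x i a)
       = (\<Sum>z\<in>PiE I Z. (\<Prod>i\<in>I. c i (z i)) *\<^sub>C Tens I (\<lambda>i. x i (z i)))"
proof
  fix \<phi>
  show "Tens I (\<lambda>i. \<Sum>a\<in>Z i. c i a *\<^sub>C x i a) \<phi>
      = (\<Sum>z\<in>PiE I Z. (\<Prod>i\<in>I. c i (z i)) *\<^sub>C Tens I (\<lambda>i. x i (z i))) \<phi>"
  proof (cases "\<forall>i\<in>I. clinear (\<phi> i)")
    case True
    hence "Tens I (\<lambda>i. \<Sum>a\<in>Z i. c i a *\<^sub>C x i a) \<phi> = (\<Prod>i\<in>I. \<Sum>a\<in>Z i. c i a * \<phi> i (x i a))"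
      unfolding Tens_def by (auto simp: clinear_expand intro!: prod.cong)
    also have "\<dots> = (\<Sum>z\<in>PiE I Z. \<Prod>i\<in>I. c i (z i) * \<phi> i (x i (z i)))"
      by (rule prod_sum_PiE) (use assms in auto)
    finally show ?thesis using True by (simp add: Tens_def sum_fun_apply prod.distrib)
  next
    case False
    have "Tens I v \<phi> = 0" for v unfolding Tens_def using False by (rule if_not_P)
    thus ?thesis by (simp add: sum_fun_apply)
  qed
qed

text \<open>
The index set \<open>{1..n+1}\<close> is that of the vertices of the graph. The first and the last factor stand
for the ends and may live in other types than the factors in between.
\<close>

lemma pure_tensor_sum:
  fixes n :: nat
  assumes n: "1 \<le> n" and fin: "\<And>i. i \<in> {1..n+1} \<Longrightarrow> finite (Z i)"
  shows "(\<Sum>a\<in>Z 1. c 1 a *\<^sub>C u a) \<otimes>\<^sub>v Tens {2..n} (\<lambda>i. \<Sum>a\<in>Z i. c i a *\<^sub>C x i a)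
           \<otimes>\<^sub>v (\<Sum>a\<in>Z (n+1). c (n+1) a *\<^sub>C y a)
       = (\<Sum>z\<in>PiE {1..n+1} Z. (\<Prod>i=1..n+1. c i (z i)) *\<^sub>C
           (u (z 1) \<otimes>\<^sub>v Tens {2..n} (\<lambda>i. x i (z i)) \<otimes>\<^sub>v y (z (n+1))))"
proof -
  have 1: "Tens {2..n} (\<lambda>i. x i ((z(n+1 := b, 1 := a)) i)) = Tens {2..n} (\<lambda>i. x i (z i))"
    "(\<Prod>i=2..n. c i ((z(n+1 := b, 1 := a)) i)) = (\<Prod>i=2..n. c i (z i))" for z a b
    by (auto simp: Tens_def fun_eq_iff intro!: prod.cong)
  have 2: "Tens {2..n} (\<lambda>i. \<Sum>a\<in>Z i. c i a *\<^sub>C x i a)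
       = (\<Sum>z\<in>PiE {2..n} Z. (\<Prod>i=2..n. c i (z i)) *\<^sub>C Tens {2..n} (\<lambda>i. x i (z i)))"
    by (rule Tens_sum) (use fin in auto)
  have 3: "(\<Sum>a\<in>A. f a *\<^sub>C u a) \<otimes>\<^sub>v t \<otimes>\<^sub>v (\<Sum>b\<in>B. g b *\<^sub>C y b)
      = (\<Sum>a\<in>A. \<Sum>b\<in>B. (f a * g b) *\<^sub>C (u a \<otimes>\<^sub>v t \<otimes>\<^sub>v y b))" for A B f g t
    by (simp only: tens_sum_left)
      (simp add: tens_sum_right complex_vector.scale_sum_right scaleC_scaleC)
  have 4: "w \<otimes>\<^sub>v (\<Sum>a\<in>A. f a *\<^sub>C t a) \<otimes>\<^sub>v w' = (\<Sum>a\<in>A. f a *\<^sub>C (w \<otimes>\<^sub>v t a \<otimes>\<^sub>v w'))" for w w' A f t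
    by (simp add: tens_sum_right tens_sum_left)
  show ?thesis
    unfolding sum_vertices[OF n] prod_vertices[OF n] 1 2 3 unfolding 4
    using n by (simp add: complex_vector.scale_sum_right scaleC_scaleC ac_simps)
qed

text \<open>
The induction principle for the triple tensor products of the statement.
\<close>

lemma tensor3_subset:
  assumes P: "csubspace P"
    and pure: "\<And>x v y. x \<in> U \<Longrightarrow> (\<And>i. i \<in> I \<Longrightarrow> v i \<in> X i) \<Longrightarrow> y \<in> Y \<Longrightarrow> x \<otimes>\<^sub>v Tens I v \<otimes>\<^sub>v y \<in> P"
  shows "U \<otimes>\<^sub>V Tensor I X \<otimes>\<^sub>V Y \<subseteq> P"
proof -
  have sub: "csubspace {p. p \<otimes>\<^sub>v y \<in> P}" "csubspace {t. x \<otimes>\<^sub>v t \<otimes>\<^sub>v y \<in> P}" for x y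
    using P unfolding complex_vector.subspace_def by (simp_all add: tens_linear)
  have 1: "x \<otimes>\<^sub>v t \<otimes>\<^sub>v y \<in> P" if "x \<in> U" "y \<in> Y" "t \<in> Tensor I X" for x y t
  proof -
    have "Tensor I X \<subseteq> {t. x \<otimes>\<^sub>v t \<otimes>\<^sub>v y \<in> P}"
      unfolding Tensor_def by (rule complex_vector.span_minimal[OF _ sub(2)]) (use that pure in blast)
    thus ?thesis using that by blast
  qed
  have "p \<otimes>\<^sub>v y \<in> P" if "p \<in> U \<otimes>\<^sub>V Tensor I X" "y \<in> Y" for p y
  proof -
    have "U \<otimes>\<^sub>V Tensor I X \<subseteq> {p. p \<otimes>\<^sub>v y \<in> P}"
      unfolding tensor_def by (rule complex_vector.span_minimal[OF _ sub(1)]) (use that 1 in blast)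
    thus ?thesis using that by blast
  qed
  thus ?thesis unfolding tensor_def[of _ Y] by (intro complex_vector.span_minimal P) blast
qed

text \<open>
A tensor is a form on functionals, so the value on it of a product of three functionals is found by
evaluation. This is linear on the whole type, which makes linear maps out of the tensor product
available without an appeal to its universal property.
\<close>

definition ev3 :: "('a \<Rightarrow> complex) \<Rightarrow> ('i \<Rightarrow> 'b \<Rightarrow> complex) \<Rightarrow> ('c \<Rightarrow> complex) \<Rightarrow>
    (('a::complex_vector, ('i, 'b::complex_vector) tensors) tensor2, 'c::complex_vector) tensor2 \<Rightarrow> complex" where
  "ev3 \<alpha> \<gamma> \<kappa> t = t (\<lambda>u. u \<alpha> (\<lambda>y. y \<gamma>)) \<kappa>"

lemma clinear_ev3: "clinear (ev3 \<alpha> \<gamma> \<kappa>)"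
  by (simp add: clinear_iff ev3_def)

lemma ev3_scale: "ev3 \<alpha> \<gamma> \<kappa> (c *\<^sub>C t) = c * ev3 \<alpha> \<gamma> \<kappa> t"
  by (simp add: ev3_def)

lemma ev3_pure:
  assumes "clinear \<alpha>" "\<And>i. i \<in> I \<Longrightarrow> clinear (\<gamma> i)" "clinear \<kappa>"
  shows "ev3 \<alpha> \<gamma> \<kappa> (x \<otimes>\<^sub>v Tens I v \<otimes>\<^sub>v y) = \<alpha> x * (\<Prod>i\<in>I. \<gamma> i (v i)) * \<kappa> y"
proof -
  have 1: "clinear (\<lambda>y. (y \<gamma> :: complex))" by (simp add: clinear_iff)
  have 2: "clinear (\<lambda>u. (u \<alpha> (\<lambda>y. (y \<gamma> :: complex)) :: complex))" by (simp add: clinear_iff)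
  show ?thesis using assms 1 2 by (simp add: ev3_def tens_def Tens_def)
qed

text \<open>
Products of coordinate functionals of the factors are coordinate functionals of the tensor product.
\<close>

lemma tensor3_expand:
  fixes n :: nat
  assumes n: "1 \<le> n" and fin: "\<And>i. i \<in> {1..n+1} \<Longrightarrow> finite (Z i)"
    and lin: "\<And>a. clinear (\<alpha> a)" "\<And>i a. i \<in> {2..n} \<Longrightarrow> clinear (\<gamma> i a)" "\<And>a. clinear (\<kappa> a)"
    and exp: "\<And>w. w \<in> U \<Longrightarrow> (\<Sum>a\<in>Z 1. \<alpha> a w *\<^sub>C u a) = w"
      "\<And>i w. i \<in> {2..n} \<Longrightarrow> w \<in> X i \<Longrightarrow> (\<Sum>a\<in>Z i. \<gamma> i a w *\<^sub>C x i a) = w"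
      "\<And>w. w \<in> Y \<Longrightarrow> (\<Sum>a\<in>Z (n+1). \<kappa> a w *\<^sub>C y a) = w"
    and t: "t \<in> U \<otimes>\<^sub>V Tensor {2..n} X \<otimes>\<^sub>V Y"
  shows "(\<Sum>z\<in>PiE {1..n+1} Z. ev3 (\<alpha> (z 1)) (\<lambda>i. \<gamma> i (z i)) (\<kappa> (z (n+1))) t *\<^sub>C
           (u (z 1) \<otimes>\<^sub>v Tens {2..n} (\<lambda>i. x i (z i)) \<otimes>\<^sub>v y (z (n+1)))) = t"
proof -
  let ?E = "\<lambda>t. \<Sum>z\<in>PiE {1..n+1} Z. ev3 (\<alpha> (z 1)) (\<lambda>i. \<gamma> i (z i)) (\<kappa> (z (n+1))) t *\<^sub>C
           (u (z 1) \<otimes>\<^sub>v Tens {2..n} (\<lambda>i. x i (z i)) \<otimes>\<^sub>v y (z (n+1)))"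
  have "U \<otimes>\<^sub>V Tensor {2..n} X \<otimes>\<^sub>V Y \<subseteq> {t. ?E t = t}"
  proof (rule tensor3_subset)
    have add: "?E (t + t') = ?E t + ?E t'" for t t'
      by (simp add: ev3_def scaleC_add_left sum.distrib)
    have scale: "?E (c *\<^sub>C t) = c *\<^sub>C ?E t" for c t
      by (simp add: ev3_def complex_vector.scale_sum_right scaleC_scaleC)
    show "csubspace {t. ?E t = t}"
      unfolding complex_vector.subspace_def using add scale scale[of 0 0] by auto
    fix v0 v v1 assume v: "v0 \<in> U" "\<And>i. i \<in> {2..n} \<Longrightarrow> v i \<in> X i" "v1 \<in> Y"
    define c where "c i a = (if i = 1 then \<alpha> a v0 else if i = n+1 then \<kappa> a v1 else \<gamma> i a (v i))" for i a
    have c: "ev3 (\<alpha> (z 1)) (\<lambda>i. \<gamma> i (z i)) (\<kappa> (z (n+1))) (v0 \<otimes>\<^sub>v Tens {2..n} v \<otimes>\<^sub>v v1) = (\<Prod>i=1..n+1. c i (z i))" for z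
      unfolding prod_vertices[OF n] using lin n by (subst ev3_pure) (auto simp: c_def intro!: prod.cong)
    have T: "Tens {2..n} (\<lambda>i. \<Sum>a\<in>Z i. c i a *\<^sub>C x i a) = Tens {2..n} v"
      using exp(2) v(2) n by (auto simp: Tens_def fun_eq_iff c_def intro!: prod.cong)
    have "?E (v0 \<otimes>\<^sub>v Tens {2..n} v \<otimes>\<^sub>v v1) = (\<Sum>a\<in>Z 1. c 1 a *\<^sub>C u a)
        \<otimes>\<^sub>v Tens {2..n} (\<lambda>i. \<Sum>a\<in>Z i. c i a *\<^sub>C x i a) \<otimes>\<^sub>v (\<Sum>a\<in>Z (n+1). c (n+1) a *\<^sub>C y a)"
      unfolding c by (rule pure_tensor_sum[OF n fin, symmetric])
    also have "\<dots> = v0 \<otimes>\<^sub>v Tens {2..n} v \<otimes>\<^sub>v v1"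
      unfolding T using exp(1)[OF v(1)] exp(3)[OF v(3)] n by (simp add: c_def)
    finally show "v0 \<otimes>\<^sub>v Tens {2..n} v \<otimes>\<^sub>v v1 \<in> {t. ?E t = t}" by simp
  qed
  thus ?thesis using t by blast
qed

lemma tensor_map_Lin:
  assumes "csubspace V" "csubspace W" "f \<in> Lin V X" "g \<in> Lin W Y"
  shows "tensor_map V W f g \<in> Lin (V \<otimes>\<^sub>V W) (X \<otimes>\<^sub>V Y)"
    and "v \<in> V \<Longrightarrow> w \<in> W \<Longrightarrow> tensor_map V W f g (v \<otimes>\<^sub>v w) = f v \<otimes>\<^sub>v g w"
proof -
  note wd = theI'[OF tensor_map_wd[OF assms], folded tensor_map_def]
  thus pure: "v \<in> V \<Longrightarrow> w \<in> W \<Longrightarrow> tensor_map V W f g (v \<otimes>\<^sub>v w) = f v \<otimes>\<^sub>v g w" for v w by blast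
  show "tensor_map V W f g \<in> Lin (V \<otimes>\<^sub>V W) (X \<otimes>\<^sub>V Y)"
    unfolding tensor_def[of V W]
  proof (rule Lin_span_codomain)
    show "tensor_map V W f g \<in> Lin (cspan {v \<otimes>\<^sub>v w |v w. v \<in> V \<and> w \<in> W}) UNIV"
      using wd unfolding tensor_def by blast
    show "tensor_map V W f g x \<in> X \<otimes>\<^sub>V Y" if "x \<in> {v \<otimes>\<^sub>v w |v w. v \<in> V \<and> w \<in> W}" for x
      using that pure Lin_mem[OF assms(3)] Lin_mem[OF assms(4)] by (auto intro!: tens_in_tensor)
  qed (rule csubspace_tensor)
qed

lemma Tensor_map_Lin:
  assumes "\<And>i. i \<in> I \<Longrightarrow> csubspace (V i)" "\<And>i. i \<in> I \<Longrightarrow> f i \<in> Lin (V i) (X i)"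
  shows "Tensor_map I V f \<in> Lin (Tensor I V) UNIV"
    and "(\<And>i. i \<in> I \<Longrightarrow> v i \<in> V i) \<Longrightarrow> Tensor_map I V f (Tens I v) = Tens I (\<lambda>i. f i (v i))"
proof -
  note wd = theI'[OF Tensor_map_wd[where I = I and V = V and f = f and X = X, OF assms], folded Tensor_map_def]
  show "Tensor_map I V f \<in> Lin (Tensor I V) UNIV" using wd by (rule conjunct1)
  show "Tensor_map I V f (Tens I v) = Tens I (\<lambda>i. f i (v i))" if "\<And>i. i \<in> I \<Longrightarrow> v i \<in> V i"
    using conjunct2[OF wd] that by blast
qed

lemma Tensor_map_codomain:
  assumes "\<And>i. i \<in> I \<Longrightarrow> csubspace (V i)" "\<And>i. i \<in> I \<Longrightarrow> f i \<in> Lin (V i) (X i)"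
  shows "Tensor_map I V f \<in> Lin (Tensor I V) (Tensor I X)"
  unfolding Tensor_def[of I V]
proof (rule Lin_span_codomain)
  show "Tensor_map I V f \<in> Lin (cspan {Tens I v |v. \<forall>i\<in>I. v i \<in> V i}) UNIV"
    using Tensor_map_Lin(1)[where I = I and V = V and X = X and f = f] assms
    unfolding Tensor_def by blast
  fix x assume "x \<in> {Tens I v |v. \<forall>i\<in>I. v i \<in> V i}"
  then obtain v where v: "x = Tens I v" "\<And>i. i \<in> I \<Longrightarrow> v i \<in> V i" by blast
  have "Tensor_map I V f x = Tens I (\<lambda>i. f i (v i))"
    unfolding v(1) by (rule Tensor_map_Lin(2)[where X = X]) (use assms v(2) in auto)
  thus "Tensor_map I V f x \<in> Tensor I X"
    using Tens_in_Tensor[of I "\<lambda>i. f i (v i)" X] Lin_mem[OF assms(2) v(2)] by simp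
qed (simp add: csubspace_tensor)

lemma tensor_assoc_Lin:
  fixes S :: "nat \<Rightarrow> 'b::complex_vector set"
  assumes "i \<le> n" "fin_dim (S i)"
  shows "tensor_assoc V S i n \<in> Lin ((V \<otimes>\<^sub>V S i) \<otimes>\<^sub>V Tensor {i+1..n} S) UNIV"
    and "v \<in> V \<Longrightarrow> (\<And>j. j \<in> {i..n} \<Longrightarrow> s j \<in> S j) \<Longrightarrow>
        tensor_assoc V S i n ((v \<otimes>\<^sub>v s i) \<otimes>\<^sub>v Tens {i+1..n} s) = v \<otimes>\<^sub>v Tens {i..n} s"
proof -
  note wd = theI'[OF tensor_assoc_wd[where S = S and i = i and n = n and V = V, OF assms], folded tensor_assoc_def]
  show "tensor_assoc V S i n \<in> Lin ((V \<otimes>\<^sub>V S i) \<otimes>\<^sub>V Tensor {i+1..n} S) UNIV"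
    using wd by (rule conjunct1)
  show "tensor_assoc V S i n ((v \<otimes>\<^sub>v s i) \<otimes>\<^sub>v Tens {i+1..n} s) = v \<otimes>\<^sub>v Tens {i..n} s"
    if "v \<in> V" "\<And>j. j \<in> {i..n} \<Longrightarrow> s j \<in> S j"
    using conjunct2[OF wd] that by blast
qed

lemma dual_bases_tensor:
  assumes V: "dual_bases V J v \<alpha>" and W: "dual_bases W J' w \<beta>"
  shows "dual_bases (V \<otimes>\<^sub>V W) (J \<times> J') (\<lambda>(a, b). v a \<otimes>\<^sub>v w b) (\<lambda>(a, b) t. t (\<alpha> a) (\<beta> b))"
proof -
  let ?E = "\<lambda>t. \<Sum>(a, b)\<in>J \<times> J'. t (\<alpha> a) (\<beta> b) *\<^sub>C (v a \<otimes>\<^sub>v w b)"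
  have "V \<otimes>\<^sub>V W \<subseteq> {t. ?E t = t}"
    unfolding tensor_def
  proof (rule complex_vector.span_minimal)
    have add: "?E (t + t') = ?E t + ?E t'" for t t'
      by (simp add: scaleC_add_left sum.distrib case_prod_unfold)
    have scale: "?E (c *\<^sub>C t) = c *\<^sub>C ?E t" for c t
      by (simp add: complex_vector.scale_sum_right scaleC_scaleC case_prod_unfold)
    show "csubspace {t. ?E t = t}"
      unfolding complex_vector.subspace_def using add scale scale[of 0 0] by auto
    show "{v \<otimes>\<^sub>v w |v w. v \<in> V \<and> w \<in> W} \<subseteq> {t. ?E t = t}"
    proof safe
      fix x y assume xy: "x \<in> V" "y \<in> W"
      have "?E (x \<otimes>\<^sub>v y) = (\<Sum>a\<in>J. \<Sum>b\<in>J'. (\<alpha> a x * \<beta> b y) *\<^sub>C (v a \<otimes>\<^sub>v w b))"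
        using V W by (auto simp: sum.cartesian_product dual_bases_def tens_def intro!: sum.cong)
      also have "\<dots> = (\<Sum>a\<in>J. \<alpha> a x *\<^sub>C v a) \<otimes>\<^sub>v (\<Sum>b\<in>J'. \<beta> b y *\<^sub>C w b)"
        by (simp only: tens_sum_left)
          (simp add: tens_sum_right complex_vector.scale_sum_right scaleC_scaleC)
      also have "\<dots> = x \<otimes>\<^sub>v y" using V W xy by (simp add: dual_bases_def)
      finally show "?E (x \<otimes>\<^sub>v y) = x \<otimes>\<^sub>v y" .
    qed
  qed
  hence "\<forall>t\<in>V \<otimes>\<^sub>V W. ?E t = t" by blast
  moreover have "clinear (\<lambda>t. t (\<alpha> a) (\<beta> b))" for a b by (simp add: clinear_iff)
  moreover have "v a \<otimes>\<^sub>v w b \<in> V \<otimes>\<^sub>V W" if "a \<in> J" "b \<in> J'" for a b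
    using that V W by (intro tens_in_tensor) (auto simp: dual_bases_def)
  moreover have "(v a' \<otimes>\<^sub>v w b') (\<alpha> a) (\<beta> b) = of_bool ((a, b) = (a', b'))"
    if "a \<in> J" "b \<in> J'" "a' \<in> J" "b' \<in> J'" for a b a' b'
    using that V W by (auto simp: dual_bases_def tens_def)
  ultimately show ?thesis
    using V W unfolding dual_bases_def by (auto simp: csubspace_tensor case_prod_unfold)
qed

lemma vector_valuedI: "r \<in> R \<Longrightarrow> s \<in> S \<Longrightarrow> (\<lambda>x. r x *\<^sub>C s) \<in> vector_valued R S"
  unfolding vector_valued_def by (rule complex_vector.span_base) blast

section \<open>Intertwiners in coordinates\<close>

lemma Lin_conjugate_coords:
  assumes V: "dual_bases V J b \<beta>" and W: "dual_bases W J' w \<omega>"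
    and f: "f \<in> Lin V W" and h: "h \<in> Lin V V" and s: "s \<in> Lin W W" and "j' \<in> J" "k' \<in> J'"
  shows "\<omega> k' (s (f (h (b j'))))
       = (\<Sum>k\<in>J'. \<Sum>j\<in>J. \<omega> k' (s (w k)) * \<beta> j (h (b j')) * \<omega> k (f (b j)))"
proof -
  have sub: "csubspace V" "\<And>j. j \<in> J \<Longrightarrow> b j \<in> V" "csubspace W" "\<And>k. k \<in> J' \<Longrightarrow> w k \<in> W"
    using V W by (auto simp: dual_bases_def)
  have eV: "(\<Sum>j\<in>J. \<beta> j x *\<^sub>C b j) = x" if "x \<in> V" for x using that V by (simp add: dual_bases_def)
  have eW: "(\<Sum>k\<in>J'. \<omega> k x *\<^sub>C w k) = x" if "x \<in> W" for x using that W by (simp add: dual_bases_def)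
  have "h (b j') \<in> V" using h sub \<open>j' \<in> J\<close> by (simp add: Lin_def)
  hence "f (h (b j')) = (\<Sum>j\<in>J. \<beta> j (h (b j')) *\<^sub>C f (b j))"
    using Lin_expand[where v = b and A = J and c = "\<lambda>j. \<beta> j (h (b j'))", OF sub(1) f sub(2)] eV by simp
  also have "\<dots> = (\<Sum>j\<in>J. \<beta> j (h (b j')) *\<^sub>C (\<Sum>k\<in>J'. \<omega> k (f (b j)) *\<^sub>C w k))"
    using f sub eW by (simp add: Lin_def)
  also have "\<dots> = (\<Sum>k\<in>J'. (\<Sum>j\<in>J. \<beta> j (h (b j')) * \<omega> k (f (b j))) *\<^sub>C w k)"
    by (simp add: complex_vector.scale_sum_right complex_vector.scale_sum_left scaleC_scaleC)
      (rule sum.swap)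
  finally have "s (f (h (b j'))) = (\<Sum>k\<in>J'. (\<Sum>j\<in>J. \<beta> j (h (b j')) * \<omega> k (f (b j))) *\<^sub>C s (w k))"
    using Lin_expand[OF sub(3) s sub(4)] by simp
  hence "\<omega> k' (s (f (h (b j')))) = (\<Sum>k\<in>J'. (\<Sum>j\<in>J. \<beta> j (h (b j')) * \<omega> k (f (b j))) * \<omega> k' (s (w k)))"
    using W \<open>k' \<in> J'\<close> by (simp add: clinear_expand[of "\<omega> k'"] dual_bases_def)
  thus ?thesis by (simp add: sum_distrib_left sum_distrib_right ac_simps)
qed

lemma Hom_rep_iff_conjugate:
  assumes \<rho>: "\<And>g. g \<in> carrier G \<Longrightarrow> \<rho> g \<in> Lin V V"
    and i: "\<And>g. g \<in> carrier G \<Longrightarrow> i g \<in> carrier G"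
      "\<And>g v. g \<in> carrier G \<Longrightarrow> v \<in> V \<Longrightarrow> \<rho> g (\<rho> (i g) v) = v"
      "\<And>g v. g \<in> carrier G \<Longrightarrow> v \<in> V \<Longrightarrow> \<rho> (i g) (\<rho> g v) = v"
  shows "f \<in> Hom_rep G V \<rho> W \<sigma> \<longleftrightarrow>
    f \<in> Lin V W \<and> (\<forall>g\<in>carrier G. \<forall>v\<in>V. \<sigma> g (f (\<rho> (i g) v)) = f v)"
proof -
  have mem: "\<rho> g v \<in> V" if "g \<in> carrier G" "v \<in> V" for g v using \<rho>[OF that(1)] that by (auto simp: Lin_def)
  show ?thesis unfolding Hom_rep_def
    using mem i by (smt (verit, ccfv_threshold) mem_Collect_eq)
qed

text \<open>
A linear map is an intertwiner if and only if it is fixed by conjugation with the group elements, and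
in coordinates this is a system of linear equations. The map \<open>i\<close> stands for the inverse.
\<close>

lemma Hom_rep_coords:
  assumes V: "dual_bases V J b \<beta>" and W: "dual_bases W J' w \<omega>"
    and \<rho>: "\<And>g. g \<in> carrier G \<Longrightarrow> \<rho> g \<in> Lin V V" and \<sigma>: "\<And>g. g \<in> carrier G \<Longrightarrow> \<sigma> g \<in> Lin W W"
    and i: "\<And>g. g \<in> carrier G \<Longrightarrow> i g \<in> carrier G"
      "\<And>g v. g \<in> carrier G \<Longrightarrow> v \<in> V \<Longrightarrow> \<rho> g (\<rho> (i g) v) = v"
      "\<And>g v. g \<in> carrier G \<Longrightarrow> v \<in> V \<Longrightarrow> \<rho> (i g) (\<rho> g v) = v"
  shows "f \<in> Hom_rep G V \<rho> W \<sigma> \<longleftrightarrow> f \<in> Lin V W \<and> (\<forall>g\<in>carrier G. \<forall>k'\<in>J'. \<forall>j'\<in>J.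
    (\<Sum>k\<in>J'. \<Sum>j\<in>J. \<omega> k' (\<sigma> g (w k)) * \<beta> j (\<rho> (i g) (b j')) * \<omega> k (f (b j))) = \<omega> k' (f (b j')))"
proof (cases "f \<in> Lin V W")
  case f: True
  have sub: "csubspace V" "\<And>j. j \<in> J \<Longrightarrow> b j \<in> V" using V by (auto simp: dual_bases_def)
  have mem: "\<rho> (i g) v \<in> V" if "g \<in> carrier G" "v \<in> V" for g v
    using \<rho>[OF i(1)] that by (auto simp: Lin_def)
  have *: "(\<forall>v\<in>V. \<sigma> g (f (\<rho> (i g) v)) = f v) \<longleftrightarrow>
      (\<forall>k'\<in>J'. \<forall>j'\<in>J. \<omega> k' (\<sigma> g (f (\<rho> (i g) (b j')))) = \<omega> k' (f (b j')))"
    if g: "g \<in> carrier G" for g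
  proof
    assume R: "\<forall>k'\<in>J'. \<forall>j'\<in>J. \<omega> k' (\<sigma> g (f (\<rho> (i g) (b j')))) = \<omega> k' (f (b j'))"
    let ?f = "\<lambda>v. if v \<in> V then \<sigma> g (f (\<rho> (i g) v)) else 0"
    have L: "?f \<in> Lin V W"
      using f \<sigma>[OF g] \<rho>[OF i(1)[OF g]] sub
      by (auto simp: Lin_def complex_vector.subspace_add complex_vector.subspace_scale)
    have eq: "?f = f"
    proof (rule dual_bases_Lin_ext[OF V L f])
      fix j assume j: "j \<in> J"
      have e: "(\<Sum>k\<in>J'. \<omega> k x *\<^sub>C w k) = x" if "x \<in> W" for x
        using that W by (simp add: dual_bases_def)
      have "f (b j) \<in> W" using f sub(2)[OF j] by (simp add: Lin_def)
      note fb = e[OF this]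
      have "?f (b j) \<in> W" using L sub(2)[OF j] unfolding Lin_def by blast
      note fb' = e[OF this]
      have "\<omega> k (?f (b j)) = \<omega> k (f (b j))" if "k \<in> J'" for k
        using R that j sub(2) by simp
      hence "(\<Sum>k\<in>J'. \<omega> k (?f (b j)) *\<^sub>C w k) = (\<Sum>k\<in>J'. \<omega> k (f (b j)) *\<^sub>C w k)"
        by (intro sum.cong refl) (simp only:)
      thus "?f (b j) = f (b j)" unfolding fb fb' .
    qed
    show "\<forall>v\<in>V. \<sigma> g (f (\<rho> (i g) v)) = f v"
    proof
      fix v assume "v \<in> V"
      thus "\<sigma> g (f (\<rho> (i g) v)) = f v" using fun_cong[OF eq, of v] by simp
    qed
  qed (use sub in auto)
  have "f \<in> Hom_rep G V \<rho> W \<sigma> \<longleftrightarrow> (\<forall>g\<in>carrier G. \<forall>v\<in>V. \<sigma> g (f (\<rho> (i g) v)) = f v)"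
    using Hom_rep_iff_conjugate[where i = i and G = G and V = V and \<rho> = \<rho> and f = f and W = W and \<sigma> = \<sigma>, OF \<rho> i] f by simp
  also have "\<dots> \<longleftrightarrow> (\<forall>g\<in>carrier G. \<forall>k'\<in>J'. \<forall>j'\<in>J.
    \<omega> k' (\<sigma> g (f (\<rho> (i g) (b j')))) = \<omega> k' (f (b j')))" using * by simp
  also have "\<dots> \<longleftrightarrow> (\<forall>g\<in>carrier G. \<forall>k'\<in>J'. \<forall>j'\<in>J.
    (\<Sum>k\<in>J'. \<Sum>j\<in>J. \<omega> k' (\<sigma> g (w k)) * \<beta> j (\<rho> (i g) (b j')) * \<omega> k (f (b j))) = \<omega> k' (f (b j')))"
    using Lin_conjugate_coords[OF V W f \<rho>[OF i(1)] \<sigma>] by simp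
  finally show ?thesis using f by simp
qed (simp add: Hom_rep_def)

section \<open>The linear graph in coordinates\<close>

abbreviation lft :: "nat \<times> nat \<times> nat \<Rightarrow> nat" where "lft z \<equiv> fst z"

abbreviation mid :: "nat \<times> nat \<times> nat \<Rightarrow> nat" where "mid z \<equiv> fst (snd z)"

abbreviation rgt :: "nat \<times> nat \<times> nat \<Rightarrow> nat" where "rgt z \<equiv> snd (snd z)"

text \<open>
The edge \<open>i\<close> carries the space \<open>M i\<close> with basis index set \<open>I i\<close>, and the vertex \<open>i\<close> carries the
space \<open>L\<close>, \<open>S i\<close> or \<open>N\<close> with basis index set \<open>J i\<close>. The sets \<open>I 0\<close> and \<open>I (n+1)\<close> belong to the
missing edges beyond the ends of the graph. They are singletons, which lets the end vertices be
treated like the others.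
\<close>

locale linear_graph =
  fixes G :: "'g monoid" and H K :: "'g set" and n :: nat
    and M :: "nat \<Rightarrow> 'm::complex_vector set" and \<pi> :: "nat \<Rightarrow> 'g \<Rightarrow> 'm \<Rightarrow> 'm"
    and S :: "nat \<Rightarrow> 's::complex_vector set" and \<sigma> :: "nat \<Rightarrow> 'g \<Rightarrow> 's \<Rightarrow> 's"
    and L :: "'l::complex_vector set" and \<tau> :: "'g \<Rightarrow> 'l \<Rightarrow> 'l"
    and N :: "'n::complex_vector set" and \<nu> :: "'g \<Rightarrow> 'n \<Rightarrow> 'n"
    and I J :: "nat \<Rightarrow> nat set"
    and b :: "nat \<Rightarrow> nat \<Rightarrow> 'm" and \<beta> :: "nat \<Rightarrow> nat \<Rightarrow> 'm \<Rightarrow> complex"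
    and s :: "nat \<Rightarrow> nat \<Rightarrow> 's" and s' :: "nat \<Rightarrow> nat \<Rightarrow> 's \<Rightarrow> complex"
    and l :: "nat \<Rightarrow> 'l" and l' :: "nat \<Rightarrow> 'l \<Rightarrow> complex"
    and m :: "nat \<Rightarrow> 'n" and m' :: "nat \<Rightarrow> 'n \<Rightarrow> complex"
  assumes n: "1 \<le> n" and G: "group G" and H: "subgroup H G" and K: "subgroup K G"
    and M: "\<And>i. i \<in> {1..n} \<Longrightarrow> \<pi> i \<in> hom G (GL (M i))"
      "\<And>i. i \<in> {1..n} \<Longrightarrow> dual_bases (M i) (I i) (b i) (\<beta> i)"
    and I0: "I 0 = {0}" "I (n+1) = {0}"
    and S: "\<And>i. i \<in> {2..n} \<Longrightarrow> fd_rep G (S i) (\<sigma> i)"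
      "\<And>i. i \<in> {2..n} \<Longrightarrow> dual_bases (S i) (J i) (s i) (s' i)"
    and L: "\<tau> \<in> hom (G\<lparr>carrier := H\<rparr>) (GL L)" "dual_bases L (J 1) l l'"
    and N: "\<nu> \<in> hom (G\<lparr>carrier := K\<rparr>) (GL N)" "dual_bases N (J (n+1)) m m'"
    and indep: "\<And>i a p q. i \<in> {1..n} \<Longrightarrow>
      (\<And>g. g \<in> carrier G \<Longrightarrow> (\<Sum>(p, q)\<in>I i \<times> I i. a p q * \<beta> i p (\<pi> i g (b i q))) = 0) \<Longrightarrow>
      p \<in> I i \<Longrightarrow> q \<in> I i \<Longrightarrow> a p q = 0"
    and Q: "\<And>t :: ('n \<Rightarrow> complex) \<Rightarrow> ('l, (nat, 's) tensors) tensor2.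
      Qmap N t = (\<Sum>r\<in>J (n+1). t (\<lambda>v. if v \<in> N then m' r v else 0) \<otimes>\<^sub>v m r)"
begin

abbreviation LSN :: "(('l, (nat, 's) tensors) tensor2, 'n) tensor2 set" where
  "LSN \<equiv> L \<otimes>\<^sub>V Tensor {2..n} S \<otimes>\<^sub>V N"

abbreviation MS :: "nat \<Rightarrow> ('m, 's) tensor2 set" where
  "MS i \<equiv> M (i - 1) \<otimes>\<^sub>V S i"

abbreviation gauge :: "(nat \<Rightarrow> 'g) \<Rightarrow>
    (('l, (nat, 's) tensors) tensor2, 'n) tensor2 \<Rightarrow> (('l, (nat, 's) tensors) tensor2, 'n) tensor2" where
  "gauge \<equiv> gauge_rep n L \<tau> S \<sigma> N \<nu>"

abbreviation Ndual :: "'g \<Rightarrow> ('n \<Rightarrow> complex) \<Rightarrow> 'n \<Rightarrow> complex" where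
  "Ndual \<equiv> dual_rep (G\<lparr>carrier := K\<rparr>) N \<nu>"

abbreviation MSrep :: "nat \<Rightarrow> 'g \<Rightarrow> ('m, 's) tensor2 \<Rightarrow> ('m, 's) tensor2" where
  "MSrep i \<equiv> tensor_rep (M (i - 1)) (\<pi> (i - 1)) (S i) (\<sigma> i)"

sublocale G: group G by (rule G)

lemma carrier_sub: "h \<in> H \<Longrightarrow> h \<in> carrier G" "k \<in> K \<Longrightarrow> k \<in> carrier G"
  using H K subgroup.mem_carrier by metis+

lemma groups: "group (G\<lparr>carrier := H\<rparr>)" "group (G\<lparr>carrier := K\<rparr>)"
  using H K G.subgroup_imp_group by auto

lemma M_sub: "i \<in> {1..n} \<Longrightarrow> csubspace (M i)" "i \<in> {1..n} \<Longrightarrow> p \<in> I i \<Longrightarrow> b i p \<in> M i"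
  and S_sub: "i \<in> {2..n} \<Longrightarrow> csubspace (S i)" "i \<in> {2..n} \<Longrightarrow> r \<in> J i \<Longrightarrow> s i r \<in> S i"
  and L_sub: "csubspace L" "r \<in> J 1 \<Longrightarrow> l r \<in> L"
  and N_sub: "csubspace N" "r \<in> J (n+1) \<Longrightarrow> m r \<in> N"
  using M(2) S(2) L(2) N(2) by (auto simp: dual_bases_def)

lemma M_lin: "i \<in> {1..n} \<Longrightarrow> clinear (\<beta> i p)"
  and S_lin: "i \<in> {2..n} \<Longrightarrow> clinear (s' i r)"
  and L_lin: "clinear (l' r)"
  and N_lin: "clinear (m' r)"
  using M(2) S(2) L(2) N(2) by (auto simp: dual_bases_def)

lemma M_expand: "i \<in> {1..n} \<Longrightarrow> v \<in> M i \<Longrightarrow> (\<Sum>p\<in>I i. \<beta> i p v *\<^sub>C b i p) = v"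
  and S_expand: "i \<in> {2..n} \<Longrightarrow> w \<in> S i \<Longrightarrow> (\<Sum>r\<in>J i. s' i r w *\<^sub>C s i r) = w"
  and L_expand: "x \<in> L \<Longrightarrow> (\<Sum>r\<in>J 1. l' r x *\<^sub>C l r) = x"
  and N_expand: "y \<in> N \<Longrightarrow> (\<Sum>r\<in>J (n+1). m' r y *\<^sub>C m r) = y"
  using M(2) S(2) L(2) N(2) by (auto simp: dual_bases_def)

lemma M_rep:
  assumes "i \<in> {1..n}"
  shows "g \<in> carrier G \<Longrightarrow> \<pi> i g \<in> Lin (M i) (M i)"
    "g \<in> carrier G \<Longrightarrow> h \<in> carrier G \<Longrightarrow> \<pi> i (g \<otimes>\<^bsub>G\<^esub> h) v = \<pi> i g (\<pi> i h v)"
    "v \<in> M i \<Longrightarrow> \<pi> i \<one>\<^bsub>G\<^esub> v = v"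
  using hom_GL[OF G M_sub(1) M(1), OF assms assms] by blast+

lemma S_rep:
  assumes "i \<in> {2..n}"
  shows "g \<in> carrier G \<Longrightarrow> \<sigma> i g \<in> Lin (S i) (S i)"
    "g \<in> carrier G \<Longrightarrow> h \<in> carrier G \<Longrightarrow> \<sigma> i (g \<otimes>\<^bsub>G\<^esub> h) v = \<sigma> i g (\<sigma> i h v)"
    "v \<in> S i \<Longrightarrow> \<sigma> i \<one>\<^bsub>G\<^esub> v = v"
  using hom_GL[OF G S_sub(1)] S(1) assms unfolding fd_rep_def by blast+

lemma L_rep:
  shows "h \<in> H \<Longrightarrow> \<tau> h \<in> Lin L L" "v \<in> L \<Longrightarrow> \<tau> \<one>\<^bsub>G\<^esub> v = v"
  using hom_GL[OF groups(1) L_sub(1) L(1)] by auto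

lemma N_rep:
  shows "k \<in> K \<Longrightarrow> \<nu> k \<in> Lin N N" "v \<in> N \<Longrightarrow> \<nu> \<one>\<^bsub>G\<^esub> v = v"
    "k \<in> K \<Longrightarrow> k' \<in> K \<Longrightarrow> \<nu> (k \<otimes>\<^bsub>G\<^esub> k') v = \<nu> k (\<nu> k' v)"
  using hom_GL[OF groups(2) N_sub(1) N(1)] by auto

subsection \<open>Labels of the vertices, and the functions they index\<close>

definition vgroup :: "nat \<Rightarrow> 'g set" where
  "vgroup i = (if i = 1 then H else if i = n + 1 then K else carrier G)"

text \<open>
The matrix of \<open>\<pi>\<^sub>i(g)\<close>; for the missing edges, that of the trivial representation.
\<close>

definition mcoef :: "nat \<Rightarrow> 'g \<Rightarrow> nat \<Rightarrow> nat \<Rightarrow> complex" where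
  "mcoef i g p q = (if i \<in> {1..n} then \<beta> i p (\<pi> i g (b i q)) else 1)"

abbreviation eprod :: "(nat \<Rightarrow> 'g) \<Rightarrow> (nat \<Rightarrow> nat \<times> nat) \<Rightarrow> complex" where
  "eprod g y \<equiv> \<Prod>i=1..n. mcoef i (g i) (fst (y i)) (snd (y i))"

text \<open>
The matrix of \<open>k\<close> on the space carried by the vertex \<open>i\<close>.
\<close>

definition smat :: "nat \<Rightarrow> 'g \<Rightarrow> nat \<Rightarrow> nat \<Rightarrow> complex" where
  "smat i k r' r = (if i = 1 then l' r' (\<tau> k (l r)) else if i = n + 1 then m' r' (\<nu> k (m r))
     else s' i r' (\<sigma> i k (s i r)))"

text \<open>
The matrix of \<open>k\<close> acting by conjugation on the maps from the space on the edge \<open>i\<close> to the tensor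
product of those on the edge \<open>i - 1\<close> and on the vertex \<open>i\<close>.
\<close>

definition vmat :: "nat \<Rightarrow> 'g \<Rightarrow> nat \<times> nat \<times> nat \<Rightarrow> nat \<times> nat \<times> nat \<Rightarrow> complex" where
  "vmat i k z' z = mcoef (i - 1) k (lft z') (lft z) * smat i k (mid z') (mid z)
     * mcoef i (inv\<^bsub>G\<^esub> k) (rgt z) (rgt z')"

abbreviation gmat :: "(nat \<Rightarrow> 'g) \<Rightarrow> (nat \<Rightarrow> nat \<times> nat \<times> nat) \<Rightarrow> (nat \<Rightarrow> nat \<times> nat \<times> nat) \<Rightarrow> complex" where
  "gmat k z' z \<equiv> \<Prod>i=1..n+1. vmat i (k i) (z' i) (z i)"

definition Idx :: "nat \<Rightarrow> (nat \<times> nat \<times> nat) set" where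
  "Idx i = I (i - 1) \<times> J i \<times> I i"

abbreviation Lab :: "(nat \<Rightarrow> nat \<times> nat \<times> nat) set" where
  "Lab \<equiv> PiE {1..n+1} Idx"

definition ptens :: "(nat \<Rightarrow> nat) \<Rightarrow> (('l, (nat, 's) tensors) tensor2, 'n) tensor2" where
  "ptens r = l (r 1) \<otimes>\<^sub>v Tens {2..n} (\<lambda>i. s i (r i)) \<otimes>\<^sub>v m (r (n+1))"

abbreviation zprod :: "(nat \<Rightarrow> 'g) \<Rightarrow> (nat \<Rightarrow> nat \<times> nat \<times> nat) \<Rightarrow> complex" where
  "zprod g z \<equiv> \<Prod>i=1..n. mcoef i (g i) (rgt (z i)) (lft (z (i+1)))"

definition efun :: "(nat \<Rightarrow> nat \<times> nat \<times> nat) \<Rightarrow> (nat \<Rightarrow> 'g) \<Rightarrow> (('l, (nat, 's) tensors) tensor2, 'n) tensor2" where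
  "efun z g = (if g \<in> Gpow G n
     then zprod g z *\<^sub>C ptens (\<lambda>i. mid (z i)) else 0)"

lemma finite_I:
  assumes "i \<le> n + 1"
  shows "finite (I i)"
proof -
  consider "i = 0" | "i = n + 1" | "i \<in> {1..n}" using assms by fastforce
  thus ?thesis using M(2)[THEN dual_bases_finite] I0 by cases simp_all
qed

lemma finite_J:
  assumes "i \<in> {1..n+1}"
  shows "finite (J i)"
proof -
  consider "i = 1" | "i = n + 1" | "i \<in> {2..n}" using assms by fastforce
  thus ?thesis
    using S(2)[THEN dual_bases_finite] L(2)[THEN dual_bases_finite] N(2)[THEN dual_bases_finite]
    by cases simp_all
qed

lemma finite_Idx: "i \<in> {1..n+1} \<Longrightarrow> finite (Idx i)"
  unfolding Idx_def using finite_I finite_J by auto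

lemma finite_Lab: "finite Lab"
  by (intro finite_PiE finite_Idx) auto

lemma vgroup_carrier: "k \<in> vgroup i \<Longrightarrow> k \<in> carrier G"
  using carrier_sub by (auto simp: vgroup_def split: if_splits)

lemma gauge_group_eq: "gauge_group G H K n = PiE {1..n+1} vgroup"
  unfolding gauge_group_def vgroup_def ..

lemma mcoef_mult:
  assumes i: "i \<in> {1..n}" and gh: "g \<in> carrier G" "h \<in> carrier G" and pq: "p \<in> I i" "q \<in> I i"
  shows "mcoef i (g \<otimes>\<^bsub>G\<^esub> h) p q = (\<Sum>k\<in>I i. mcoef i g p k * mcoef i h k q)"
proof -
  have "\<pi> i h (b i q) \<in> M i" using M_rep(1)[OF i gh(2)] M_sub(2)[OF i pq(2)] by (simp add: Lin_def)
  hence "\<pi> i g (\<pi> i h (b i q)) = \<pi> i g (\<Sum>k\<in>I i. \<beta> i k (\<pi> i h (b i q)) *\<^sub>C b i k)"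
    using M_expand[OF i] by simp
  also have "\<dots> = (\<Sum>k\<in>I i. \<beta> i k (\<pi> i h (b i q)) *\<^sub>C \<pi> i g (b i k))"
    by (rule Lin_expand[OF M_sub(1)[OF i] M_rep(1)[OF i gh(1)] M_sub(2)[OF i]])
  finally show ?thesis
    using i M_rep(2)[OF i gh] clinear_expand[OF M_lin[OF i]] by (simp add: mcoef_def mult.commute)
qed

lemma mcoef_one:
  assumes "i \<le> n + 1" "p \<in> I i" "q \<in> I i"
  shows "mcoef i \<one>\<^bsub>G\<^esub> p q = of_bool (p = q)"
proof -
  consider "i = 0" | "i = n + 1" | "i \<in> {1..n}" using assms(1) by fastforce
  thus ?thesis
  proof cases
    case 1
    thus ?thesis using assms(2,3) I0(1) by (simp add: mcoef_def)
  next
    case 2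
    thus ?thesis using assms(2,3) I0(2) by (simp add: mcoef_def)
  next
    case 3
    thus ?thesis
      using dual_bases_biorthogonal[OF M(2)[OF 3] assms(2,3)] M_rep(3)[OF 3 M_sub(2)[OF 3 assms(3)]]
      by (simp add: mcoef_def)
  qed
qed

lemma smat_one:
  assumes "i \<in> {1..n+1}" "r' \<in> J i" "r \<in> J i"
  shows "smat i \<one>\<^bsub>G\<^esub> r' r = of_bool (r' = r)"
proof -
  consider "i = 1" | "i = n + 1" "i \<noteq> 1" | "i \<in> {2..n}" using assms(1) by fastforce
  thus ?thesis
  proof cases
    case 1 thus ?thesis using L(2)[THEN dual_bases_biorthogonal] L_rep(2) L_sub(2) assms by (simp add: smat_def)
  next
    case 2 thus ?thesis using N(2)[THEN dual_bases_biorthogonal] N_rep(2) N_sub(2) assms by (simp add: smat_def)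
  next
    case 3 thus ?thesis using S(2)[THEN dual_bases_biorthogonal] S_rep(3) S_sub(2) assms by (simp add: smat_def)
  qed
qed

lemma vmat_one:
  assumes i: "i \<in> {1..n+1}" and z: "z' \<in> Idx i" "z \<in> Idx i"
  shows "vmat i \<one>\<^bsub>G\<^esub> z' z = of_bool (z' = z)"
proof -
  have "i - 1 \<le> n + 1" "i \<le> n + 1" using i by auto
  thus ?thesis using z smat_one[OF i] mcoef_one
    by (auto simp: vmat_def Idx_def)
qed

subsection \<open>Sums over vertex labels and over edge labels\<close>

text \<open>
The passage between the two readings of an index, by vertices and by edges.
\<close>

definition label :: "(nat \<Rightarrow> nat) \<Rightarrow> (nat \<Rightarrow> nat \<times> nat) \<Rightarrow> nat \<Rightarrow> nat \<times> nat \<times> nat" where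
  "label r y = (\<lambda>i\<in>{1..n+1}. (if i = 1 then 0 else snd (y (i - 1)), r i, if i = n + 1 then 0 else fst (y i)))"

definition edges_of :: "(nat \<Rightarrow> nat \<times> nat \<times> nat) \<Rightarrow> nat \<Rightarrow> nat \<times> nat" where
  "edges_of z = (\<lambda>i\<in>{1..n}. (rgt (z i), lft (z (i + 1))))"

lemma label_simps:
  "i \<in> {1..n+1} \<Longrightarrow> mid (label r y i) = r i"
  "i \<in> {1..n} \<Longrightarrow> rgt (label r y i) = fst (y i)"
  "i \<in> {1..n} \<Longrightarrow> lft (label r y (i + 1)) = snd (y i)"
  by (auto simp: label_def)

lemma edges_of_label: "y \<in> PiE {1..n} Y \<Longrightarrow> edges_of (label r y) = y"
  unfolding edges_of_def using label_simps(2,3) by (auto simp: PiE_iff extensional_def restrict_def fun_eq_iff)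

lemma sum_edges:
  "(\<Sum>z\<in>Lab. h z) = (\<Sum>r\<in>PiE {1..n+1} J. \<Sum>y\<in>PiE {1..n} (\<lambda>i. I i \<times> I i). h (label r y))"
  unfolding sum.cartesian_product
proof (rule sum.reindex_bij_witness[of _ "\<lambda>(r, y). label r y" "\<lambda>z. (\<lambda>i\<in>{1..n+1}. mid (z i), edges_of z)"])
  fix z assume z: "z \<in> Lab"
  have zi: "lft (z i) \<in> I (i - 1)" "mid (z i) \<in> J i" "rgt (z i) \<in> I i" if "i \<in> {1..n+1}" for i
    using PiE_mem[OF z that] by (auto simp: Idx_def)
  show "(case (\<lambda>i\<in>{1..n+1}. mid (z i), edges_of z) of (r, y) \<Rightarrow> label r y) = z"
  proof
    fix i
    show "(case (\<lambda>i\<in>{1..n+1}. mid (z i), edges_of z) of (r, y) \<Rightarrow> label r y) i = z i"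
    proof (cases "i \<in> {1..n+1}")
      case i: True
      have "lft (z i) = (if i = 1 then 0 else snd (edges_of z (i - 1)))"
      proof (cases "i = 1")
        case True
        thus ?thesis using zi(1)[OF i] I0(1) by simp
      next
        case False
        hence "i - 1 \<in> {1..n}" "i - 1 + 1 = i" using i by auto
        thus ?thesis using False unfolding edges_of_def by (simp only: restrict_apply' if_False snd_conv)
      qed
      moreover have "rgt (z i) = (if i = n + 1 then 0 else fst (edges_of z i))"
      proof (cases "i = n + 1")
        case True
        thus ?thesis using zi(3)[OF i] I0(2) by simp
      next
        case False
        hence "i \<in> {1..n}" using i by auto
        thus ?thesis using False unfolding edges_of_def by (simp only: restrict_apply' if_False fst_conv)
      qed
      ultimately show ?thesis using i unfolding label_def by (simp add: prod_eq_iff)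
    qed (use z in \<open>auto simp: label_def PiE_def extensional_def\<close>)
  qed
  have "edges_of z i \<in> I i \<times> I i" if "i \<in> {1..n}" for i
    using zi(1)[of "i + 1"] zi(3)[of i] that unfolding edges_of_def by simp
  thus "(\<lambda>i\<in>{1..n+1}. mid (z i), edges_of z) \<in> PiE {1..n+1} J \<times> PiE {1..n} (\<lambda>i. I i \<times> I i)"
    using zi(2) by (auto simp: edges_of_def)
  thus "(case (\<lambda>i\<in>{1..n+1}. mid (z i), edges_of z) of (r, y) \<Rightarrow> h (label r y)) = h z"
    using \<open>(case (\<lambda>i\<in>{1..n+1}. mid (z i), edges_of z) of (r, y) \<Rightarrow> label r y) = z\<close> by simp
next
  fix x assume "x \<in> PiE {1..n+1} J \<times> PiE {1..n} (\<lambda>i. I i \<times> I i)"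
  then obtain r y where x: "x = (r, y)" and r: "r \<in> PiE {1..n+1} J" and y: "y \<in> PiE {1..n} (\<lambda>i. I i \<times> I i)"
    by auto
  have "(\<lambda>i\<in>{1..n+1}. mid (label r y i)) = r"
    using r by (auto simp: label_simps PiE_iff extensional_def restrict_def fun_eq_iff)
  thus "(\<lambda>z. (\<lambda>i\<in>{1..n+1}. mid (z i), edges_of z)) (case x of (r, y) \<Rightarrow> label r y) = x"
    using edges_of_label[OF y] x by simp
  have yi: "fst (y i) \<in> I i" "snd (y i) \<in> I i" if "i \<in> {1..n}" for i
    using PiE_mem[OF y that] by auto
  have "label r y i \<in> Idx i" if i: "i \<in> {1..n+1}" for i
  proof -
    have "(if i = 1 then 0 else snd (y (i - 1))) \<in> I (i - 1)"
    proof (cases "i = 1")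
      case False
      hence "i - 1 \<in> {1..n}" using i by auto
      from yi(2)[OF this] show ?thesis using False by simp
    qed (simp add: I0(1))
    moreover have "(if i = n + 1 then 0 else fst (y i)) \<in> I i"
      using yi(1)[of i] i I0(2) by (cases "i = n + 1") simp_all
    ultimately show ?thesis using i PiE_mem[OF r i] unfolding label_def Idx_def by simp
  qed
  moreover have "label r y \<in> extensional {1..n+1}" by (simp add: label_def)
  ultimately show "(case x of (r, y) \<Rightarrow> label r y) \<in> Lab" using x by (simp add: PiE_iff)
qed

subsection \<open>The gauge action on the spanning functions\<close>

lemma vgroup_parts:
  assumes "k \<in> PiE {1..n+1} vgroup"
  shows "k 1 \<in> H" "k (n+1) \<in> K" "i \<in> {2..n} \<Longrightarrow> k i \<in> carrier G"
  using PiE_mem[OF assms, of 1] PiE_mem[OF assms, of "n+1"] PiE_mem[OF assms, of i] n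
  by (auto simp: vgroup_def)

lemma gauge_rep_Lin:
  assumes k: "k \<in> PiE {1..n+1} vgroup"
  shows "gauge k \<in> Lin LSN UNIV"
    and "x \<in> L \<Longrightarrow> (\<And>i. i \<in> {2..n} \<Longrightarrow> w i \<in> S i) \<Longrightarrow> y \<in> N \<Longrightarrow>
      gauge k (x \<otimes>\<^sub>v Tens {2..n} w \<otimes>\<^sub>v y) =
      \<tau> (k 1) x \<otimes>\<^sub>v Tens {2..n} (\<lambda>i. \<sigma> i (k i) (w i)) \<otimes>\<^sub>v \<nu> (k (n+1)) y"
proof -
  have k1: "k 1 \<in> H" and kn: "k (n+1) \<in> K" and ki: "\<And>i. i \<in> {2..n} \<Longrightarrow> k i \<in> carrier G"
    using vgroup_parts[OF k] by blast+
  have T: "Tensor_map {2..n} S (\<lambda>i. \<sigma> i (k i)) \<in> Lin (Tensor {2..n} S) UNIV"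
    "(\<And>i. i \<in> {2..n} \<Longrightarrow> w i \<in> S i) \<Longrightarrow>
      Tensor_map {2..n} S (\<lambda>i. \<sigma> i (k i)) (Tens {2..n} w) = Tens {2..n} (\<lambda>i. \<sigma> i (k i) (w i))" for w
    using Tensor_map_Lin[where I = "{2..n}" and V = S and X = S and f = "\<lambda>i. \<sigma> i (k i)"]
      S_sub(1) S_rep(1) ki by auto
  note T1 = tensor_map_Lin[OF L_sub(1) csubspace_tensor(2) L_rep(1)[OF k1] T(1)]
  note T2 = tensor_map_Lin[OF csubspace_tensor(1) N_sub(1) T1(1) N_rep(1)[OF kn]]
  show "gauge k \<in> Lin LSN UNIV"
    unfolding gauge_rep_def using T2(1) by (rule Lin_codomain) simp
  show "gauge k (x \<otimes>\<^sub>v Tens {2..n} w \<otimes>\<^sub>v y) =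
      \<tau> (k 1) x \<otimes>\<^sub>v Tens {2..n} (\<lambda>i. \<sigma> i (k i) (w i)) \<otimes>\<^sub>v \<nu> (k (n+1)) y"
    if x: "x \<in> L" and w: "\<And>i. i \<in> {2..n} \<Longrightarrow> w i \<in> S i" and y: "y \<in> N"
  proof -
    have t: "Tens {2..n} w \<in> Tensor {2..n} S" using w by (rule Tens_in_Tensor)
    have "Tensor_map {2..n} S (\<lambda>i. \<sigma> i (k i)) (Tens {2..n} w) = Tens {2..n} (\<lambda>i. \<sigma> i (k i) (w i))"
      by (rule T(2)) (rule w)
    thus ?thesis
      unfolding gauge_rep_def T2(2)[OF tens_in_tensor[OF x t] y] T1(2)[OF x t] by (simp only:)
  qed
qed

lemma ptens_in:
  assumes "\<And>i. i \<in> {1..n+1} \<Longrightarrow> r i \<in> J i"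
  shows "ptens r \<in> LSN"
  unfolding ptens_def using assms n L_sub N_sub S_sub by (intro tens_in_tensor Tens_in_Tensor) auto

lemma gauge_rep_ptens:
  assumes k: "k \<in> PiE {1..n+1} vgroup" and r: "\<And>i. i \<in> {1..n+1} \<Longrightarrow> r i \<in> J i"
  shows "gauge k (ptens r) =
    (\<Sum>r'\<in>PiE {1..n+1} J. (\<Prod>i=1..n+1. smat i (k i) (r' i) (r i)) *\<^sub>C ptens r')"
proof -
  have k1: "k 1 \<in> H" and kn: "k (n+1) \<in> K" and ki: "\<And>i. i \<in> {2..n} \<Longrightarrow> k i \<in> carrier G"
    using vgroup_parts[OF k] by blast+
  have mem: "l (r 1) \<in> L" "m (r (n+1)) \<in> N" "\<And>i. i \<in> {2..n} \<Longrightarrow> s i (r i) \<in> S i"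
    using r n L_sub N_sub S_sub by auto
  have 1: "(\<Sum>a\<in>J 1. smat 1 (k 1) a (r 1) *\<^sub>C l a) = \<tau> (k 1) (l (r 1))"
    using L_expand[OF Lin_mem[OF L_rep(1)[OF k1] mem(1)]] by (simp add: smat_def)
  have 2: "(\<Sum>a\<in>J (n+1). smat (n+1) (k (n+1)) a (r (n+1)) *\<^sub>C m a) = \<nu> (k (n+1)) (m (r (n+1)))"
    using N_expand[OF Lin_mem[OF N_rep(1)[OF kn] mem(2)]] n by (simp add: smat_def)
  have 3: "(\<Sum>a\<in>J i. smat i (k i) a (r i) *\<^sub>C s i a) = \<sigma> i (k i) (s i (r i))" if i: "i \<in> {2..n}" for i
    using S_expand[OF i Lin_mem[OF S_rep(1)[OF i ki[OF i]] mem(3)[OF i]]] i by (simp add: smat_def)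
  have 4: "Tens {2..n} (\<lambda>i. \<Sum>a\<in>J i. smat i (k i) a (r i) *\<^sub>C s i a) = Tens {2..n} (\<lambda>i. \<sigma> i (k i) (s i (r i)))"
    using 3 by (auto simp: Tens_def fun_eq_iff intro!: prod.cong)
  have 5: "gauge k (l (r 1) \<otimes>\<^sub>v Tens {2..n} (\<lambda>i. s i (r i)) \<otimes>\<^sub>v m (r (n+1)))
      = \<tau> (k 1) (l (r 1)) \<otimes>\<^sub>v Tens {2..n} (\<lambda>i. \<sigma> i (k i) (s i (r i))) \<otimes>\<^sub>v \<nu> (k (n+1)) (m (r (n+1)))"
    by (rule gauge_rep_Lin(2)[OF k mem(1) _ mem(2)]) (rule mem(3))
  show ?thesis
    unfolding ptens_def 5
    using pure_tensor_sum[where Z = J and c = "\<lambda>i a. smat i (k i) a (r i)" and u = l and x = s and y = m,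
        OF n finite_J]
    unfolding 1 2 4 by simp
qed

text \<open>
The component \<open>k i\<close> enters through the argument of \<open>\<pi>\<^sub>i\<^sub>-\<^sub>1\<close>, through the argument of \<open>\<pi>\<^sub>i\<close> and
through the action on the space at the vertex \<open>i\<close>. These are the three factors of \<open>vmat i (k i)\<close>.
\<close>

lemma gauge_rep_efun:
  assumes k: "k \<in> PiE {1..n+1} vgroup" and g: "g \<in> Gpow G n" and z: "z \<in> Lab"
  shows "gauge k (efun z (gauge_act G n (gauge_inv G n k) g)) =
    (\<Sum>z'\<in>Lab. gmat k z' z *\<^sub>C efun z' g)"
proof -
  let ?Y = "PiE {1..n} (\<lambda>i. I i \<times> I i)"
  have kc: "k i \<in> carrier G" if "i \<in> {1..n+1}" for i
    using PiE_mem[OF k that] vgroup_carrier by blast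
  have gc: "g i \<in> carrier G" if "i \<in> {1..n}" for i
    using g that by (auto simp: Gpow_def)
  have zi: "lft (z i) \<in> I (i - 1)" "mid (z i) \<in> J i" "rgt (z i) \<in> I i" if "i \<in> {1..n+1}" for i
    using PiE_mem[OF z that] by (auto simp: Idx_def)
  define g' where "g' = gauge_act G n (gauge_inv G n k) g"
  have g'i: "g' i = inv\<^bsub>G\<^esub> (k i) \<otimes>\<^bsub>G\<^esub> g i \<otimes>\<^bsub>G\<^esub> k (i+1)" if "i \<in> {1..n}" for i
    using that kc[of i] kc[of "i+1"] by (simp add: g'_def gauge_act_def gauge_inv_def)
  have g': "g' \<in> Gpow G n"
    unfolding Gpow_def
  proof (rule PiE_I)
    show "g' i \<in> carrier G" if "i \<in> {1..n}" for i using that kc[of i] kc[of "i+1"] gc[of i] by (simp add: g'i)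
  qed (auto simp: g'_def gauge_act_def)
  let ?P = "\<lambda>y i. mcoef i (inv\<^bsub>G\<^esub> (k i)) (rgt (z i)) (fst (y i)) * mcoef i (g i) (fst (y i)) (snd (y i))
    * mcoef i (k (i+1)) (snd (y i)) (lft (z (i+1)))"
  have Ri: "mcoef i (g' i) (rgt (z i)) (lft (z (i+1))) = (\<Sum>a\<in>I i \<times> I i. ?P (\<lambda>_. a) i)" if i: "i \<in> {1..n}" for i
  proof -
    have "mcoef i (g' i) (rgt (z i)) (lft (z (i+1)))
        = (\<Sum>q\<in>I i. (\<Sum>p\<in>I i. mcoef i (inv\<^bsub>G\<^esub> (k i)) (rgt (z i)) p * mcoef i (g i) p q) * mcoef i (k (i+1)) q (lft (z (i+1))))"
      using i kc[of i] kc[of "i+1"] gc[of i] zi(3)[of i] zi(1)[of "i+1"]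
      by (simp add: g'i mcoef_mult)
    also have "\<dots> = (\<Sum>p\<in>I i. \<Sum>q\<in>I i. mcoef i (inv\<^bsub>G\<^esub> (k i)) (rgt (z i)) p * mcoef i (g i) p q * mcoef i (k (i+1)) q (lft (z (i+1))))"
      by (subst sum.swap) (simp add: sum_distrib_right)
    finally show ?thesis by (simp add: sum.cartesian_product case_prod_unfold)
  qed
  have prod: "(\<Prod>i=1..n. mcoef i (g' i) (rgt (z i)) (lft (z (i+1)))) = (\<Sum>y\<in>?Y. \<Prod>i=1..n. ?P y i)"
  proof -
    have "(\<Prod>i=1..n. mcoef i (g' i) (rgt (z i)) (lft (z (i+1))))
        = (\<Prod>i=1..n. \<Sum>a\<in>I i \<times> I i. ?P (\<lambda>_. a) i)"
      by (intro prod.cong refl Ri)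
    also have "\<dots> = (\<Sum>y\<in>?Y. \<Prod>i=1..n. ?P y i)"
      by (rule prod_sum_PiE) (use finite_I in auto)
    finally show ?thesis .
  qed
  have prodA: "(\<Prod>i=1..n+1. vmat i (k i) (label r y i) (z i)) * (\<Prod>i=1..n. mcoef i (g i) (rgt (label r y i)) (lft (label r y (i+1))))
     = (\<Prod>i=1..n+1. smat i (k i) (r i) (mid (z i))) * (\<Prod>i=1..n. ?P y i)" for r y
  proof -
    have "(\<Prod>i=1..n+1. mcoef (i - 1) (k i) (lft (label r y i)) (lft (z i)))
        = (\<Prod>i=0..n. mcoef i (k (i+1)) (lft (label r y (i+1))) (lft (z (i+1))))"
      using prod.shift_bounds_cl_Suc_ivl[of "\<lambda>i. mcoef (i - 1) (k i) (lft (label r y i)) (lft (z i))" 0 n] by simp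
    also have "\<dots> = (\<Prod>i=1..n. mcoef i (k (i+1)) (snd (y i)) (lft (z (i+1))))"
      using label_simps(3) by (simp add: prod.atLeast_Suc_atMost[of 0] mcoef_def)
    finally have 1: "(\<Prod>i=1..n+1. mcoef (i - 1) (k i) (lft (label r y i)) (lft (z i))) = \<dots>" .
    have 2: "(\<Prod>i=1..n+1. mcoef i (inv\<^bsub>G\<^esub> (k i)) (rgt (z i)) (rgt (label r y i)))
        = (\<Prod>i=1..n. mcoef i (inv\<^bsub>G\<^esub> (k i)) (rgt (z i)) (fst (y i)))"
      using label_simps(2) by (simp add: mcoef_def)
    have 3: "(\<Prod>i=1..n+1. smat i (k i) (mid (label r y i)) (mid (z i))) = (\<Prod>i=1..n+1. smat i (k i) (r i) (mid (z i)))"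
      using label_simps(1) by (intro prod.cong) auto
    have 4: "(\<Prod>i=1..n. mcoef i (g i) (rgt (label r y i)) (lft (label r y (i+1)))) = eprod g y"
      using label_simps(2,3) by (intro prod.cong) auto
    show ?thesis unfolding vmat_def prod.distrib 1 2 3 4 by (simp only: ac_simps)
  qed
  have Wv: "ptens (\<lambda>i. mid (label r y i)) = ptens r" for r y
  proof -
    have "Tens {2..n} (\<lambda>i. s i (mid (label r y i))) = Tens {2..n} (\<lambda>i. s i (r i))"
      using label_simps(1) by (auto simp: Tens_def fun_eq_iff intro!: prod.cong)
    thus ?thesis using label_simps(1)[of 1 r y] label_simps(1)[of "n+1" r y] n by (simp add: ptens_def)
  qed
  have gW: "gauge k (ptens (\<lambda>i. mid (z i))) =
      (\<Sum>r\<in>PiE {1..n+1} J. (\<Prod>i=1..n+1. smat i (k i) (r i) (mid (z i))) *\<^sub>C ptens r)"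
    by (rule gauge_rep_ptens[OF k]) (rule zi(2))
  have "gauge k (efun z g') =
      (\<Prod>i=1..n. mcoef i (g' i) (rgt (z i)) (lft (z (i+1)))) *\<^sub>C gauge k (ptens (\<lambda>i. mid (z i)))"
    using gauge_rep_Lin(1)[OF k] ptens_in[of "\<lambda>i. mid (z i)"] zi(2) g' by (simp add: efun_def Lin_def)
  also have "\<dots> = (\<Sum>r\<in>PiE {1..n+1} J. \<Sum>y\<in>?Y.
      ((\<Prod>i=1..n+1. smat i (k i) (r i) (mid (z i))) * (\<Prod>i=1..n. ?P y i)) *\<^sub>C ptens r)"
    unfolding gW prod
    by (rule sum_scaleC_sum)
  also have "\<dots> = (\<Sum>z'\<in>Lab. gmat k z' z *\<^sub>C efun z' g)"
    unfolding sum_edges prodA[symmetric] using g by (simp only: efun_def if_True Wv scaleC_scaleC)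
  finally show ?thesis unfolding g'_def .
qed

subsection \<open>Independence of the spanning functions\<close>

lemma ev3_ptens:
  assumes "\<And>i. i \<in> {1..n+1} \<Longrightarrow> r i \<in> J i" "\<And>i. i \<in> {1..n+1} \<Longrightarrow> r' i \<in> J i"
  shows "ev3 (l' (r 1)) (\<lambda>i. s' i (r i)) (m' (r (n+1))) (ptens r') = of_bool (\<forall>i\<in>{1..n+1}. r' i = r i)"
proof -
  have "ev3 (l' (r 1)) (\<lambda>i. s' i (r i)) (m' (r (n+1))) (ptens r')
      = of_bool (r 1 = r' 1) * (\<Prod>i=2..n. of_bool (r i = r' i)) * of_bool (r (n+1) = r' (n+1))"
    unfolding ptens_def using L_lin S_lin N_lin assms n L(2)[THEN dual_bases_biorthogonal]
      S(2)[THEN dual_bases_biorthogonal] N(2)[THEN dual_bases_biorthogonal]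
    by (subst ev3_pure) (auto intro!: prod.cong)
  also have "\<dots> = of_bool (r 1 = r' 1 \<and> (\<forall>i\<in>{2..n}. r i = r' i) \<and> r (n+1) = r' (n+1))"
    by (auto simp: prod_zero_iff)
  also have "(r 1 = r' 1 \<and> (\<forall>i\<in>{2..n}. r i = r' i) \<and> r (n+1) = r' (n+1)) \<longleftrightarrow> (\<forall>i\<in>{1..n+1}. r' i = r i)"
    unfolding PiE_vertices[OF n] by auto
  finally show ?thesis .
qed

text \<open>
Evaluation on the dual basis of \<open>L \<otimes> S \<otimes> N\<close> picks out the labels with given middle entries. These
are told apart by the rows and columns of their matrix coefficients.
\<close>

lemma efun_independent:
  assumes 0: "\<And>g. g \<in> Gpow G n \<Longrightarrow> (\<Sum>z\<in>Lab. c z *\<^sub>C efun z g) = 0" and z0: "z0 \<in> Lab"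
  shows "c z0 = 0"
proof -
  have zi: "lft (z i) \<in> I (i - 1)" "mid (z i) \<in> J i" "rgt (z i) \<in> I i" if "i \<in> {1..n+1}" "z \<in> Lab" for i z
    using PiE_mem[OF that(2,1)] by (auto simp: Idx_def)
  let ?E = "ev3 (l' (mid (z0 1))) (\<lambda>i. s' i (mid (z0 i))) (m' (mid (z0 (n+1))))"
  define Z' where "Z' = {z \<in> Lab. \<forall>i\<in>{1..n+1}. mid (z i) = mid (z0 i)}"
  let ?y = "\<lambda>z i. (rgt (z i), lft (z (i+1)))"
  have "(\<Sum>z | z \<in> Z' \<and> (\<forall>i\<in>{1..n}. ?y z i = ?y z0 i). c z) = 0"
  proof (rule products_independent[where X = "\<lambda>_. carrier G" and Y = "\<lambda>i. I i \<times> I i"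
        and u = "\<lambda>i a g. mcoef i g (fst a) (snd a)"])
    fix i and c :: "nat \<times> nat \<Rightarrow> complex" and a
    assume "i \<in> {1..n}" "\<And>x. x \<in> carrier G \<Longrightarrow> (\<Sum>a\<in>I i \<times> I i. c a * mcoef i x (fst a) (snd a)) = 0"
      "a \<in> I i \<times> I i"
    thus "c a = 0" using indep[of i "\<lambda>p q. c (p, q)" "fst a" "snd a"]
      by (auto simp: mcoef_def case_prod_unfold)
  next
    fix g assume "g \<in> PiE {1..n} (\<lambda>_. carrier G)"
    hence g: "g \<in> Gpow G n" by (simp add: Gpow_def)
    have "0 = ?E (\<Sum>z\<in>Lab. c z *\<^sub>C efun z g)" using 0[OF g] clinear_0[OF clinear_ev3] by simp
    also have "\<dots> = (\<Sum>z\<in>Lab. c z * ?E (efun z g))" by (simp add: clinear_expand[OF clinear_ev3])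
    also have "\<dots> = (\<Sum>z\<in>Lab. if z \<in> Z' then c z * (\<Prod>i=1..n. mcoef i (g i) (fst (?y z i)) (snd (?y z i))) else 0)"
    proof (rule sum.cong)
      fix z assume z: "z \<in> Lab"
      have "?E (efun z g) = zprod g z * ?E (ptens (\<lambda>i. mid (z i)))"
        using g by (simp add: efun_def ev3_scale)
      also have "?E (ptens (\<lambda>i. mid (z i))) = of_bool (z \<in> Z')"
        using ev3_ptens[of "\<lambda>i. mid (z0 i)" "\<lambda>i. mid (z i)"] zi(2) z z0 by (simp add: Z'_def)
      finally show "c z * ?E (efun z g) =
          (if z \<in> Z' then c z * (\<Prod>i=1..n. mcoef i (g i) (fst (?y z i)) (snd (?y z i))) else 0)" by simp
    qed simp
    also have "\<dots> = (\<Sum>z\<in>Z'. c z * (\<Prod>i=1..n. mcoef i (g i) (fst (?y z i)) (snd (?y z i))))"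
      using finite_Lab by (simp add: Z'_def flip: sum.inter_filter)
    finally show "(\<Sum>z\<in>Z'. c z * (\<Prod>i=1..n. mcoef i (g i) (fst (?y z i)) (snd (?y z i)))) = 0" by simp
  next
    fix i z assume "i \<in> {1..n}" "z \<in> Z'"
    thus "?y z i \<in> I i \<times> I i" using zi(3)[of i z] zi(1)[of "i+1" z] by (auto simp: Z'_def)
  next
    fix i assume "i \<in> {1..n}"
    thus "?y z0 i \<in> I i \<times> I i" using zi(3)[of i z0] zi(1)[of "i+1" z0] z0 by auto
  next
    show "finite Z'" using finite_Lab by (simp add: Z'_def)
    show "finite (I i \<times> I i)" if "i \<in> {1..n}" for i using finite_I[of i] that by simp
  qed simp
  moreover have "{z. z \<in> Z' \<and> (\<forall>i\<in>{1..n}. ?y z i = ?y z0 i)} = {z0}"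
  proof safe
    fix z assume z: "z \<in> Z'" and y: "\<forall>i\<in>{1..n}. ?y z i = ?y z0 i"
    have zZ: "z \<in> Lab" using z by (simp add: Z'_def)
    show "z = z0"
    proof (rule PiE_ext[OF zZ z0])
      fix i assume i: "i \<in> {1..n+1}"
      have "lft (z i) = lft (z0 i)"
      proof (cases "i = 1")
        case True thus ?thesis using zi(1)[OF i zZ] zi(1)[OF i z0] I0 by simp
      next
        case False 
        hence "i - 1 \<in> {1..n}" "i - 1 + 1 = i" using i by auto
        thus ?thesis using y by (metis prod.inject)
      qed
      moreover have "rgt (z i) = rgt (z0 i)"
      proof (cases "i = n + 1")
        case True thus ?thesis using zi(3)[OF i zZ] zi(3)[OF i z0] I0 by simp
      next
        case False thus ?thesis using bspec[OF y, of i] i by simp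
      qed
      ultimately show "z i = z0 i" using z i by (simp add: Z'_def prod_eq_iff)
    qed
  qed (use z0 in \<open>auto simp: Z'_def\<close>)
  ultimately show ?thesis by simp
qed

subsection \<open>The spanning functions span\<close>

abbreviation Fns :: "((nat \<Rightarrow> 'g) \<Rightarrow> (('l, (nat, 's) tensors) tensor2, 'n) tensor2) set" where
  "Fns \<equiv> vector_valued (matrix_coeffs G n M \<pi>) LSN"

abbreviation Edges :: "(nat \<Rightarrow> nat \<times> nat) set" where
  "Edges \<equiv> PiE {1..n} (\<lambda>i. I i \<times> I i)"

lemma mid_label: "r \<in> PiE {1..n+1} J \<Longrightarrow> (\<lambda>i\<in>{1..n+1}. mid (label r y i)) = r"
  by (auto simp: label_simps PiE_iff extensional_def restrict_def fun_eq_iff)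

lemma ptens_cong: "(\<And>i. i \<in> {1..n+1} \<Longrightarrow> r i = r' i) \<Longrightarrow> ptens r = ptens r'"
proof -
  assume r: "\<And>i. i \<in> {1..n+1} \<Longrightarrow> r i = r' i"
  have "Tens {2..n} (\<lambda>i. s i (r i)) = Tens {2..n} (\<lambda>i. s i (r' i))"
    unfolding Tens_def using r by (intro ext if_cong refl prod.cong) auto
  thus ?thesis using r[of 1] r[of "n+1"] n by (simp add: ptens_def)
qed

lemma efun_label:
  assumes "g \<in> Gpow G n"
  shows "efun (label r y) g = eprod g y *\<^sub>C ptens r"
proof -
  have "(\<Prod>i=1..n. mcoef i (g i) (rgt (label r y i)) (lft (label r y (i+1)))) = eprod g y"
    using label_simps(2,3) by (intro prod.cong) auto
  moreover have "ptens (\<lambda>i. mid (label r y i)) = ptens r"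
    by (rule ptens_cong) (rule label_simps(1))
  ultimately show ?thesis using assms by (simp add: efun_def)
qed

lemma Gpow_carrier: "g \<in> Gpow G n \<Longrightarrow> i \<in> {1..n} \<Longrightarrow> g i \<in> carrier G"
  by (auto simp: Gpow_def)

lemma \<pi>_expand:
  assumes i: "i \<in> {1..n}" and g: "g \<in> carrier G" and q: "q \<in> I i"
  shows "\<pi> i g (b i q) = (\<Sum>p\<in>I i. mcoef i g p q *\<^sub>C b i p)"
  using M_expand[OF i Lin_mem[OF M_rep(1)[OF i g] M_sub(2)[OF i q]]] i by (simp add: mcoef_def)

lemma \<pi>_expand':
  assumes i: "i \<in> {1..n}" and g: "g \<in> carrier G" and v: "v \<in> M i"
  shows "\<pi> i g v = (\<Sum>a\<in>I i \<times> I i. (mcoef i g (fst a) (snd a) * \<beta> i (snd a) v) *\<^sub>C b i (fst a))"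
proof -
  have "\<pi> i g v = \<pi> i g (\<Sum>q\<in>I i. \<beta> i q v *\<^sub>C b i q)" using M_expand[OF i v] by simp
  also have "\<dots> = (\<Sum>q\<in>I i. \<beta> i q v *\<^sub>C \<pi> i g (b i q))"
    by (rule Lin_expand[OF M_sub(1)[OF i] M_rep(1)[OF i g] M_sub(2)[OF i]])
  also have "\<dots> = (\<Sum>q\<in>I i. \<Sum>p\<in>I i. (mcoef i g p q * \<beta> i q v) *\<^sub>C b i p)"
    using \<pi>_expand[OF i g] by (simp add: complex_vector.scale_sum_right scaleC_scaleC mult.commute)
  also have "\<dots> = (\<Sum>p\<in>I i. \<Sum>q\<in>I i. (mcoef i g p q * \<beta> i q v) *\<^sub>C b i p)" by (rule sum.swap)
  finally show ?thesis by (simp add: sum.cartesian_product case_prod_unfold)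
qed

lemma Tensor_map_\<pi>:
  assumes "g \<in> Gpow G n"
  shows "Tensor_map {1..n} M (\<lambda>i. \<pi> i (g i)) \<in> Lin (Tensor {1..n} M) (Tensor {1..n} M)"
    and "(\<And>i. i \<in> {1..n} \<Longrightarrow> v i \<in> M i) \<Longrightarrow>
      Tensor_map {1..n} M (\<lambda>i. \<pi> i (g i)) (Tens {1..n} v) = Tens {1..n} (\<lambda>i. \<pi> i (g i) (v i))"
  using Tensor_map_codomain[where I = "{1..n}" and V = M and X = M and f = "\<lambda>i. \<pi> i (g i)"]
    Tensor_map_Lin(2)[where I = "{1..n}" and V = M and X = M and f = "\<lambda>i. \<pi> i (g i)"]
    M_sub(1) M_rep(1) Gpow_carrier[OF assms] by blast+

text \<open>
Both the vector \<open>t\<close> and the operators \<open>\<pi>\<^sub>i(g\<^sub>i)\<close> are expanded in the bases; the functional \<open>\<phi>\<close> is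
then only evaluated on pure tensors of basis vectors, which contributes constants.
\<close>

lemma matrix_coeffs_expand:
  assumes "f \<in> matrix_coeffs G n M \<pi>"
  obtains a where "\<And>g. f g = (if g \<in> Gpow G n
    then \<Sum>y\<in>Edges. a y * eprod g y else 0)"
proof -
  define cmb :: "((nat \<Rightarrow> nat \<times> nat) \<Rightarrow> complex) \<Rightarrow> (nat \<Rightarrow> 'g) \<Rightarrow> complex"
    where "cmb a = (\<lambda>g. if g \<in> Gpow G n
      then \<Sum>y\<in>Edges. a y * eprod g y else 0)" for a
  have "clinear cmb"
    unfolding clinear_iff cmb_def
    by (auto simp: fun_eq_iff distrib_right sum.distrib sum_distrib_left mult.assoc)
  hence sub: "csubspace (range cmb)" by (rule csubspace_range)
  have "matrix_coeffs G n M \<pi> \<subseteq> range cmb"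
    unfolding matrix_coeffs_def
  proof (rule complex_vector.span_minimal[OF _ sub], safe)
    fix \<phi> t assume \<phi>: "\<phi> \<in> dual (Tensor {1..n} M)" and t: "t \<in> Tensor {1..n} M"
    let ?T = "\<lambda>g. Tensor_map {1..n} M (\<lambda>i. \<pi> i (g i))"
    let ?F = "\<lambda>t g. if g \<in> Gpow G n then \<phi> (?T g t) else 0"
    let ?U = "{t \<in> Tensor {1..n} M. ?F t \<in> range cmb}"
    have TL: "(\<lambda>t. \<phi> (?T g t)) \<in> Lin (Tensor {1..n} M) UNIV" if "g \<in> Gpow G n" for g
      using Lin_compose[OF Tensor_map_\<pi>(1)[OF that] \<phi>] by (simp add: o_def)
    have "Tensor {1..n} M \<subseteq> ?U"
    proof (subst (1) Tensor_def, rule complex_vector.span_minimal)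
      have add: "?F (x + y) = ?F x + ?F y" if "x \<in> Tensor {1..n} M" "y \<in> Tensor {1..n} M" for x y
        using TL that by (auto simp: fun_eq_iff Lin_def)
      have scale: "?F (c *\<^sub>C x) = c *\<^sub>C ?F x" if "x \<in> Tensor {1..n} M" for c x
        using TL that by (auto simp: fun_eq_iff Lin_def)
      have T: "csubspace (Tensor {1..n} M)" by (rule csubspace_tensor)
      show "csubspace ?U" by (rule csubspace_vimage[where F = "?F", OF T sub add scale])
      show "{Tens {1..n} v |v. \<forall>i\<in>{1..n}. v i \<in> M i} \<subseteq> ?U"
      proof safe
        fix v assume v: "\<forall>i\<in>{1..n}. v i \<in> M i"
        show "Tens {1..n} v \<in> Tensor {1..n} M" using v by (intro Tens_in_Tensor) auto
        let ?B = "\<lambda>y :: nat \<Rightarrow> nat \<times> nat. Tens {1..n} (\<lambda>i. b i (fst (y i)))"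
        have B: "?B y \<in> Tensor {1..n} M" if "y \<in> Edges" for y
          using that M_sub(2) by (intro Tens_in_Tensor) (auto dest!: PiE_mem)
        have "?F (Tens {1..n} v) = cmb (\<lambda>y. (\<Prod>i=1..n. \<beta> i (snd (y i)) (v i)) * \<phi> (?B y))"
        proof
          fix g
          show "?F (Tens {1..n} v) g = cmb (\<lambda>y. (\<Prod>i=1..n. \<beta> i (snd (y i)) (v i)) * \<phi> (?B y)) g"
          proof (cases "g \<in> Gpow G n")
            case g: True
            have "?T g (Tens {1..n} v) = Tens {1..n} (\<lambda>i. \<pi> i (g i) (v i))"
              by (rule Tensor_map_\<pi>(2)[OF g]) (use v in auto)
            also have "\<dots> = Tens {1..n} (\<lambda>i. \<Sum>a\<in>I i \<times> I i. (mcoef i (g i) (fst a) (snd a) * \<beta> i (snd a) (v i)) *\<^sub>C b i (fst a))"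
              unfolding Tens_def using \<pi>_expand'[OF _ Gpow_carrier[OF g]] v
              by (intro ext if_cong refl prod.cong) auto
            also have "\<dots> = (\<Sum>y\<in>Edges. (\<Prod>i=1..n. mcoef i (g i) (fst (y i)) (snd (y i)) * \<beta> i (snd (y i)) (v i)) *\<^sub>C ?B y)"
              by (rule Tens_sum) (use finite_I in auto)
            finally have "\<phi> (?T g (Tens {1..n} v)) = (\<Sum>y\<in>Edges. (\<Prod>i=1..n. mcoef i (g i) (fst (y i)) (snd (y i)) * \<beta> i (snd (y i)) (v i)) *\<^sub>C \<phi> (?B y))"
              using Lin_expand[OF csubspace_tensor(2) \<phi> B] by simp
            thus ?thesis using g by (simp add: cmb_def prod.distrib ac_simps)
          qed (simp add: cmb_def)
        qed
        thus "?F (Tens {1..n} v) \<in> range cmb" by blast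
      qed
    qed
    thus "?F t \<in> range cmb" using t by blast
  qed
  then obtain a where "f = cmb a" using assms by blast
  thus thesis using that[of a] by (simp add: cmb_def)
qed

definition lincomb :: "((nat \<Rightarrow> nat \<times> nat \<times> nat) \<Rightarrow> complex) \<Rightarrow> (nat \<Rightarrow> 'g) \<Rightarrow> (('l, (nat, 's) tensors) tensor2, 'n) tensor2" where
  "lincomb c = (\<lambda>g. \<Sum>z\<in>Lab. c z *\<^sub>C efun z g)"

lemma ptens_expand:
  assumes "t \<in> LSN"
  shows "(\<Sum>r\<in>PiE {1..n+1} J. ev3 (l' (r 1)) (\<lambda>i. s' i (r i)) (m' (r (n+1))) t *\<^sub>C ptens r) = t"
  unfolding ptens_def
  by (rule tensor3_expand[OF n finite_J L_lin S_lin N_lin L_expand S_expand N_expand assms])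

lemma efun_in_vector_valued:
  assumes z: "z \<in> Lab"
  shows "efun z \<in> Fns"
proof -
  have zi: "lft (z i) \<in> I (i - 1)" "mid (z i) \<in> J i" "rgt (z i) \<in> I i" if "i \<in> {1..n+1}" for i
    using PiE_mem[OF z that] by (auto simp: Idx_def)
  let ?\<gamma> = "\<lambda>i. \<beta> i (rgt (z i))"
  let ?T = "Tensor {1..n} M"
  define \<phi> where "\<phi> = (\<lambda>t. if t \<in> ?T then t ?\<gamma> else 0)"
  let ?v = "\<lambda>i. b i (lft (z (i+1)))"
  have v: "?v i \<in> M i" if "i \<in> {1..n}" for i
    using zi(1)[of "i+1"] M_sub(2)[OF that] that by simp
  have "\<phi> \<in> dual ?T"
    unfolding \<phi>_def by (rule Lin_restrictI) (auto simp: csubspace_tensor clinear_iff)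
  moreover have "Tens {1..n} ?v \<in> ?T" by (rule Tens_in_Tensor) (rule v)
  ultimately have "(\<lambda>g. if g \<in> Gpow G n then \<phi> (Tensor_map {1..n} M (\<lambda>i. \<pi> i (g i)) (Tens {1..n} ?v)) else 0)
      \<in> matrix_coeffs G n M \<pi>"
    unfolding matrix_coeffs_def by (intro complex_vector.span_base) blast
  moreover have "\<phi> (Tensor_map {1..n} M (\<lambda>i. \<pi> i (g i)) (Tens {1..n} ?v))
      = zprod g z" if g: "g \<in> Gpow G n" for g
  proof -
    have "Tensor_map {1..n} M (\<lambda>i. \<pi> i (g i)) (Tens {1..n} ?v) = Tens {1..n} (\<lambda>i. \<pi> i (g i) (?v i))"
      by (rule Tensor_map_\<pi>(2)[OF g]) (rule v)
    moreover have "\<dots> \<in> ?T"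
      by (rule Tens_in_Tensor) (rule Lin_mem[OF M_rep(1)[OF _ Gpow_carrier[OF g]] v])
    ultimately show ?thesis using M_lin by (simp add: \<phi>_def Tens_def mcoef_def)
  qed
  ultimately have "(\<lambda>g. if g \<in> Gpow G n then \<Prod>i=1..n. mcoef i (g i) (rgt (z i)) (lft (z (i+1))) else 0)
      \<in> matrix_coeffs G n M \<pi>"
    by (simp cong: if_cong)
  moreover have "ptens (\<lambda>i. mid (z i)) \<in> LSN" by (rule ptens_in) (rule zi(2))
  ultimately have "(\<lambda>g. (if g \<in> Gpow G n then \<Prod>i=1..n. mcoef i (g i) (rgt (z i)) (lft (z (i+1))) else 0) *\<^sub>C ptens (\<lambda>i. mid (z i)))
      \<in> Fns"
    by (rule vector_valuedI)
  moreover have "(\<lambda>g. (if g \<in> Gpow G n then \<Prod>i=1..n. mcoef i (g i) (rgt (z i)) (lft (z (i+1))) else 0) *\<^sub>C ptens (\<lambda>i. mid (z i))) = efun z"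
    by (auto simp: fun_eq_iff efun_def)
  ultimately show ?thesis by simp
qed

lemma vector_valued_eq:
  "Fns = range lincomb"
proof
  have "clinear lincomb"
    unfolding clinear_iff lincomb_def
    by (auto simp: fun_eq_iff scaleC_add_left sum.distrib complex_vector.scale_sum_right scaleC_scaleC
        sum_fun_apply distrib_right sum_distrib_left mult.assoc)
  hence sub: "csubspace (range lincomb)" by (rule csubspace_range)
  show "Fns \<subseteq> range lincomb"
    unfolding vector_valued_def
  proof (rule complex_vector.span_minimal[OF _ sub], safe)
    fix f t assume f: "f \<in> matrix_coeffs G n M \<pi>" and t: "t \<in> LSN"
    obtain a where a: "\<And>g. f g = (if g \<in> Gpow G n
        then \<Sum>y\<in>Edges. a y * eprod g y else 0)"
      using matrix_coeffs_expand[OF f] by blast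
    let ?E = "\<lambda>r. ev3 (l' (r 1)) (\<lambda>i. s' i (r i)) (m' (r (n+1))) t"
    have "f g *\<^sub>C t = lincomb (\<lambda>z. a (edges_of z) * ?E (\<lambda>i\<in>{1..n+1}. mid (z i))) g" for g
    proof (cases "g \<in> Gpow G n")
      case g: True
      have "f g *\<^sub>C t = (\<Sum>y\<in>Edges. a y * eprod g y) *\<^sub>C
          (\<Sum>r\<in>PiE {1..n+1} J. ?E r *\<^sub>C ptens r)"
        unfolding ptens_expand[OF t] using g a by simp
      also have "\<dots> = (\<Sum>r\<in>PiE {1..n+1} J. \<Sum>y\<in>Edges.
          (?E r * (a y * eprod g y)) *\<^sub>C ptens r)"
        by (rule sum_scaleC_sum)
      also have "\<dots> = lincomb (\<lambda>z. a (edges_of z) * ?E (\<lambda>i\<in>{1..n+1}. mid (z i))) g"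
        unfolding lincomb_def sum_edges efun_label[OF g]
      proof (intro sum.cong refl)
        fix r y assume r: "r \<in> PiE {1..n+1} J" and y: "y \<in> Edges"
        show "(?E r * (a y * eprod g y)) *\<^sub>C ptens r =
          (a (edges_of (label r y)) * ?E (\<lambda>i\<in>{1..n+1}. mid (label r y i))) *\<^sub>C
          eprod g y *\<^sub>C ptens r"
          unfolding edges_of_label[OF y] mid_label[OF r] scaleC_scaleC by (simp only: ac_simps)
      qed
      finally show ?thesis .
    qed (simp add: a efun_def lincomb_def)
    hence eq: "(\<lambda>g. f g *\<^sub>C t) = lincomb (\<lambda>z. a (edges_of z) * ?E (\<lambda>i\<in>{1..n+1}. mid (z i)))" by (rule ext)
    show "(\<lambda>g. f g *\<^sub>C t) \<in> range lincomb" unfolding eq by (rule rangeI[of lincomb])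
  qed
  show "range lincomb \<subseteq> Fns"
  proof safe
    fix c :: "(nat \<Rightarrow> nat \<times> nat \<times> nat) \<Rightarrow> complex"
    have "(\<Sum>z\<in>Lab. c z *\<^sub>C efun z) \<in> Fns"
      using efun_in_vector_valued by (intro csubspace_sum) (auto simp: vector_valued_def)
    moreover have "(\<Sum>z\<in>Lab. c z *\<^sub>C efun z) = lincomb c" by (simp add: fun_eq_iff sum_fun_apply lincomb_def)
    ultimately show "lincomb c \<in> Fns"
      by simp
  qed
qed

subsection \<open>The coefficients of the functions of the statement\<close>

text \<open>
Coordinates of \<open>\<Theta>\<close>, \<open>\<Phi>\<^sub>i\<close> and \<open>\<Xi>\<close>, indexed by the possible entries of a label at their vertex.
\<close>

definition cH :: "('m \<Rightarrow> 'l) \<Rightarrow> nat \<times> nat \<times> nat \<Rightarrow> complex" where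
  "cH \<Theta> a = l' (mid a) (\<Theta> (b 1 (rgt a)))"

definition cG :: "nat \<Rightarrow> ('m \<Rightarrow> ('m, 's) tensor2) \<Rightarrow> nat \<times> nat \<times> nat \<Rightarrow> complex" where
  "cG i \<Phi> a = \<Phi> (b i (rgt a)) (\<beta> (i - 1) (lft a)) (s' i (mid a))"

abbreviation ndual :: "nat \<Rightarrow> 'n \<Rightarrow> complex" where
  "ndual r \<equiv> (\<lambda>v. if v \<in> N then m' r v else 0)"

definition cK :: "(('n \<Rightarrow> complex) \<Rightarrow> 'm) \<Rightarrow> nat \<times> nat \<times> nat \<Rightarrow> complex" where
  "cK \<Xi> a = \<beta> n (lft a) (\<Xi> (ndual (mid a)))"

lemma cK_triple: "cK \<Xi> (q, r, p) = \<beta> n q (\<Xi> (ndual r))"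
  unfolding cK_def fst_conv snd_conv ..

definition crd :: "('m \<Rightarrow> 'l) \<Rightarrow> (nat \<Rightarrow> 'm \<Rightarrow> ('m, 's) tensor2) \<Rightarrow> (('n \<Rightarrow> complex) \<Rightarrow> 'm) \<Rightarrow>
    nat \<Rightarrow> nat \<times> nat \<times> nat \<Rightarrow> complex" where
  "crd \<Theta> \<Phi> \<Xi> i a = (if i = 1 then cH \<Theta> a else if i = n + 1 then cK \<Xi> a else cG i (\<Phi> i) a)"

lemma sum_Idx: "(\<Sum>a\<in>Idx i. h a) = (\<Sum>q\<in>I (i - 1). \<Sum>r\<in>J i. \<Sum>p\<in>I i. h (q, r, p))"
  by (simp add: Idx_def sum.cartesian_product)

lemma MS_bases:
  "i \<in> {2..n} \<Longrightarrow> dual_bases (MS i) (I (i - 1) \<times> J i)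
    (\<lambda>(q, r). b (i - 1) q \<otimes>\<^sub>v s i r) (\<lambda>(q, r) t. t (\<beta> (i - 1) q) (s' i r))"
  by (rule dual_bases_tensor[OF M(2) S(2)]) auto

lemma N_dual_bases: "dual_bases (dual N) (J (n+1)) ndual (\<lambda>r \<phi>. \<phi> (m r))"
  by (rule dual_bases_dual[OF N(2)])

lemma \<Theta>_expand:
  assumes \<Theta>: "\<Theta> \<in> Lin (M 1) L" and g: "g \<in> carrier G" and q: "q \<in> I 1"
  shows "\<Theta> (\<pi> 1 g (b 1 q)) = (\<Sum>a\<in>Idx 1. (mcoef 1 g (rgt a) q * cH \<Theta> a) *\<^sub>C l (mid a))"
proof -
  have 1: "1 \<in> {1..n}" using n by simp
  have "\<Theta> (\<pi> 1 g (b 1 q)) = (\<Sum>p\<in>I 1. mcoef 1 g p q *\<^sub>C \<Theta> (b 1 p))"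
    unfolding \<pi>_expand[OF 1 g q] by (rule Lin_expand[OF M_sub(1)[OF 1] \<Theta> M_sub(2)[OF 1]])
  also have "\<dots> = (\<Sum>p\<in>I 1. mcoef 1 g p q *\<^sub>C (\<Sum>r\<in>J 1. l' r (\<Theta> (b 1 p)) *\<^sub>C l r))"
    using L_expand[OF Lin_mem[OF \<Theta> M_sub(2)[OF 1]]] by simp
  also have "\<dots> = (\<Sum>r\<in>J 1. \<Sum>p\<in>I 1. (mcoef 1 g p q * cH \<Theta> (0, r, p)) *\<^sub>C l r)"
    by (subst sum.swap) (simp add: complex_vector.scale_sum_right scaleC_scaleC cH_def)
  also have "\<dots> = (\<Sum>a\<in>Idx 1. (mcoef 1 g (rgt a) q * cH \<Theta> a) *\<^sub>C l (mid a))"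
    unfolding sum_Idx by (simp add: I0(1))
  finally show ?thesis .
qed

lemma \<Phi>_expand:
  assumes i: "i \<in> {2..n}" and \<Phi>: "\<Phi> \<in> Lin (M i) (MS i)" and g: "g \<in> carrier G" and q: "q \<in> I i"
  shows "\<Phi> (\<pi> i g (b i q)) = (\<Sum>a\<in>Idx i. (mcoef i g (rgt a) q * cG i \<Phi> a) *\<^sub>C (b (i - 1) (lft a) \<otimes>\<^sub>v s i (mid a)))"
proof -
  have 1: "i \<in> {1..n}" using i by simp
  have eqMS: "(\<Sum>q\<in>I (i - 1). \<Sum>r\<in>J i. \<Phi> (b i p) (\<beta> (i - 1) q) (s' i r) *\<^sub>C (b (i - 1) q \<otimes>\<^sub>v s i r)) = \<Phi> (b i p)"
    if "p \<in> I i" for p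
    using MS_bases[OF i] Lin_mem[OF \<Phi> M_sub(2)[OF 1 that]]
    unfolding dual_bases_def by (simp add: sum.cartesian_product case_prod_unfold)
  have "\<Phi> (\<pi> i g (b i q)) = (\<Sum>p\<in>I i. mcoef i g p q *\<^sub>C \<Phi> (b i p))"
    unfolding \<pi>_expand[OF 1 g q] by (rule Lin_expand[OF M_sub(1)[OF 1] \<Phi> M_sub(2)[OF 1]])
  also have "\<dots> = (\<Sum>p\<in>I i. mcoef i g p q *\<^sub>C (\<Sum>q\<in>I (i - 1). \<Sum>r\<in>J i.
      \<Phi> (b i p) (\<beta> (i - 1) q) (s' i r) *\<^sub>C (b (i - 1) q \<otimes>\<^sub>v s i r)))"
    using eqMS by simp
  also have "\<dots> = (\<Sum>p\<in>I i. \<Sum>q'\<in>I (i - 1). \<Sum>r\<in>J i. (mcoef i g p q * cG i \<Phi> (q', r, p)) *\<^sub>C (b (i - 1) q' \<otimes>\<^sub>v s i r))"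
    by (simp add: complex_vector.scale_sum_right scaleC_scaleC cG_def)
  also have "\<dots> = (\<Sum>q'\<in>I (i - 1). \<Sum>p\<in>I i. \<Sum>r\<in>J i. (mcoef i g p q * cG i \<Phi> (q', r, p)) *\<^sub>C (b (i - 1) q' \<otimes>\<^sub>v s i r))"
    by (rule sum.swap)
  also have "\<dots> = (\<Sum>q'\<in>I (i - 1). \<Sum>r\<in>J i. \<Sum>p\<in>I i. (mcoef i g p q * cG i \<Phi> (q', r, p)) *\<^sub>C (b (i - 1) q' \<otimes>\<^sub>v s i r))"
    by (intro sum.cong refl sum.swap)
  also have "\<dots> = (\<Sum>a\<in>Idx i. (mcoef i g (rgt a) q * cG i \<Phi> a) *\<^sub>C (b (i - 1) (lft a) \<otimes>\<^sub>v s i (mid a)))"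
    unfolding sum_Idx by simp
  finally show ?thesis .
qed

lemma transport_expand:
  assumes i: "i \<in> {2..n}" and \<Phi>: "\<Phi> i \<in> Lin (M i) (MS i)" and g: "g \<in> Gpow G n"
  shows "transport n M \<pi> S \<Phi> g i \<in> Lin (M i \<otimes>\<^sub>V Tensor {i+1..n} S) UNIV"
    and "q \<in> I i \<Longrightarrow> (\<And>j. j \<in> {i+1..n} \<Longrightarrow> w j \<in> S j) \<Longrightarrow>
      transport n M \<pi> S \<Phi> g i (b i q \<otimes>\<^sub>v Tens {i+1..n} w) =
      (\<Sum>a\<in>Idx i. (mcoef i (g i) (rgt a) q * cG i (\<Phi> i) a) *\<^sub>C
        (b (i - 1) (lft a) \<otimes>\<^sub>v Tens {i..n} (w(i := s i (mid a)))))"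
proof -
  have i1: "i \<in> {1..n}" "i - 1 \<in> {1..n}" "i \<le> n" using i by auto
  have gi: "g i \<in> carrier G" by (rule Gpow_carrier[OF g i1(1)])
  have fd: "fin_dim (S i)" using S(1)[OF i] by (simp add: fd_rep_def)
  have P: "\<Phi> i \<circ> \<pi> i (g i) \<in> Lin (M i) (MS i)"
    by (rule Lin_compose[OF M_rep(1)[OF i1(1) gi] \<Phi>])
  note tm = tensor_map_Lin[OF M_sub(1)[OF i1(1)] csubspace_tensor(2) P id_on_Lin[OF csubspace_tensor(2)]]
  note ta = tensor_assoc_Lin(1)[where S = S and i = i and n = n and V = "M (i - 1)", OF i1(3) fd]
  show "transport n M \<pi> S \<Phi> g i \<in> Lin (M i \<otimes>\<^sub>V Tensor {i+1..n} S) UNIV"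
    unfolding transport_def by (rule Lin_compose[OF tm(1) ta])
  assume q: "q \<in> I i" and w: "\<And>j. j \<in> {i+1..n} \<Longrightarrow> w j \<in> S j"
  let ?w = "\<lambda>a. w(i := s i (mid a))"
  have Tw: "Tens {i+1..n} w \<in> Tensor {i+1..n} S" by (rule Tens_in_Tensor) (rule w)
  have Tw': "Tens {i+1..n} (?w a) = Tens {i+1..n} w" for a
    unfolding Tens_def by (intro ext if_cong refl prod.cong) auto
  have Za: "lft a \<in> I (i - 1)" "mid a \<in> J i" if "a \<in> Idx i" for a using that by (auto simp: Idx_def)
  have ta2: "tensor_assoc (M (i - 1)) S i n ((b (i - 1) (lft a) \<otimes>\<^sub>v s i (mid a)) \<otimes>\<^sub>v Tens {i+1..n} w)
      = b (i - 1) (lft a) \<otimes>\<^sub>v Tens {i..n} (?w a)" if a: "a \<in> Idx i" for a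
  proof -
    have "?w a j \<in> S j" if "j \<in> {i..n}" for j
      using S_sub(2)[OF i Za(2)[OF a]] w[of j] that by auto
    from tensor_assoc_Lin(2)[where S = S and i = i and n = n and V = "M (i - 1)" and s = "?w a", OF i1(3) fd M_sub(2)[OF i1(2) Za(1)[OF a]] this]
    show ?thesis unfolding Tw' by simp
  qed
  have mem: "(b (i - 1) (lft a) \<otimes>\<^sub>v s i (mid a)) \<otimes>\<^sub>v Tens {i+1..n} w \<in>
      (MS i) \<otimes>\<^sub>V Tensor {i+1..n} S" if "a \<in> Idx i" for a
    using Tw Za[OF that] M_sub(2)[OF i1(2)] S_sub(2)[OF i] by (intro tens_in_tensor) auto
  have "tensor_map (M i) (Tensor {i+1..n} S) (\<Phi> i \<circ> \<pi> i (g i)) (id_on (Tensor {i+1..n} S)) (b i q \<otimes>\<^sub>v Tens {i+1..n} w)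
      = \<Phi> i (\<pi> i (g i) (b i q)) \<otimes>\<^sub>v Tens {i+1..n} w"
    using tm(2)[OF M_sub(2)[OF i1(1) q] Tw] Tw by (simp add: id_on_def)
  also have "\<dots> = (\<Sum>a\<in>Idx i. (mcoef i (g i) (rgt a) q * cG i (\<Phi> i) a) *\<^sub>C
      ((b (i - 1) (lft a) \<otimes>\<^sub>v s i (mid a)) \<otimes>\<^sub>v Tens {i+1..n} w))"
    unfolding \<Phi>_expand[OF i \<Phi> gi q] by (rule tens_sum_left)
  finally show "transport n M \<pi> S \<Phi> g i (b i q \<otimes>\<^sub>v Tens {i+1..n} w) =
      (\<Sum>a\<in>Idx i. (mcoef i (g i) (rgt a) q * cG i (\<Phi> i) a) *\<^sub>C (b (i - 1) (lft a) \<otimes>\<^sub>v Tens {i..n} (?w a)))"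
  proof -
    assume tm_eq: "tensor_map (M i) (Tensor {i+1..n} S) (\<Phi> i \<circ> \<pi> i (g i)) (id_on (Tensor {i+1..n} S)) (b i q \<otimes>\<^sub>v Tens {i+1..n} w)
      = (\<Sum>a\<in>Idx i. (mcoef i (g i) (rgt a) q * cG i (\<Phi> i) a) *\<^sub>C
      ((b (i - 1) (lft a) \<otimes>\<^sub>v s i (mid a)) \<otimes>\<^sub>v Tens {i+1..n} w))"
    have "tensor_assoc (M (i - 1)) S i n (\<Sum>a\<in>Idx i. (mcoef i (g i) (rgt a) q * cG i (\<Phi> i) a) *\<^sub>C
        ((b (i - 1) (lft a) \<otimes>\<^sub>v s i (mid a)) \<otimes>\<^sub>v Tens {i+1..n} w))
      = (\<Sum>a\<in>Idx i. (mcoef i (g i) (rgt a) q * cG i (\<Phi> i) a) *\<^sub>C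
        tensor_assoc (M (i - 1)) S i n ((b (i - 1) (lft a) \<otimes>\<^sub>v s i (mid a)) \<otimes>\<^sub>v Tens {i+1..n} w))"
      by (rule Lin_expand[OF csubspace_tensor(1) ta mem])
    also have "\<dots> = (\<Sum>a\<in>Idx i. (mcoef i (g i) (rgt a) q * cG i (\<Phi> i) a) *\<^sub>C (b (i - 1) (lft a) \<otimes>\<^sub>v Tens {i..n} (?w a)))"
      using ta2 by (intro sum.cong refl) simp
    finally show ?thesis unfolding transport_def comp_apply tm_eq .
  qed
qed

text \<open>
The map \<open>Qmap\<close> sums over the basis of \<open>N\<close>, so the product of the remaining maps is first computed
on one element of the dual basis, that is, with the middle entry at the last vertex fixed.
\<close>

definition IdxAt :: "nat \<Rightarrow> nat \<Rightarrow> (nat \<times> nat \<times> nat) set" where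
  "IdxAt r i = (if i = n + 1 then I n \<times> {r} \<times> {0} else Idx i)"

lemma IdxAt_subset: "r \<in> J (n+1) \<Longrightarrow> IdxAt r i \<subseteq> Idx i"
  using I0(2) by (auto simp: IdxAt_def Idx_def)

lemma sum_IdxAt_last: "(\<Sum>a\<in>IdxAt r (Suc n). h a) = (\<Sum>q\<in>I n. h (q, r, 0))"
proof -
  have "IdxAt r (Suc n) = (\<lambda>q. (q, r, 0)) ` I n" by (auto simp: IdxAt_def)
  thus ?thesis by (simp add: sum.reindex inj_on_def)
qed

lemma sum_IdxAt:
  assumes "j \<le> n"
  shows "(\<Sum>r\<in>J (n+1). \<Sum>z\<in>PiE {j+1..n+1} (IdxAt r). h z) = (\<Sum>z\<in>PiE {j+1..n+1} Idx. h z)"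
proof -
  have ins: "{j+1..n+1} = insert (n+1) {j+1..n}" using assms by auto
  have eq: "PiE {Suc j..n} (IdxAt r) = PiE {Suc j..n} Idx" for r by (rule PiE_cong) (auto simp: IdxAt_def)
  have "(\<Sum>r\<in>J (n+1). \<Sum>z\<in>PiE {j+1..n+1} (IdxAt r). h z)
      = (\<Sum>r\<in>J (n+1). \<Sum>q\<in>I n. \<Sum>z\<in>PiE {j+1..n} Idx. h (z(n+1 := (q, r, 0))))"
    unfolding ins by (simp add: sum_PiE_insert eq sum_IdxAt_last)
  also have "\<dots> = (\<Sum>q\<in>I n. \<Sum>r\<in>J (n+1). \<Sum>z\<in>PiE {j+1..n} Idx. h (z(n+1 := (q, r, 0))))"
    by (rule sum.swap)
  also have "\<dots> = (\<Sum>z\<in>PiE {j+1..n+1} Idx. h z)"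
    unfolding ins using I0(2) by (simp add: sum_PiE_insert sum_Idx)
  finally show ?thesis .
qed

text \<open>
Downward induction on the number of edges that remain to be transported over. Transport over the
edge \<open>i\<close> contributes a matrix coefficient of \<open>\<pi>\<^sub>i\<close>, whose column is the index of the current vector
of \<open>M\<^sub>i\<close>, and a coordinate of \<open>\<Phi>\<^sub>i\<close>.
\<close>

lemma chain_expand:
  assumes \<Phi>: "\<And>i. i \<in> {2..n} \<Longrightarrow> \<Phi> i \<in> Lin (M i) (MS i)"
    and \<Xi>: "\<Xi> \<in> Lin (dual N) (M n)" and g: "g \<in> Gpow G n" and r: "r \<in> J (n+1)"
    and "j0 \<le> n" "1 \<le> j0"
  shows "foldr (\<circ>) (map (transport n M \<pi> S \<Phi> g) [j0+1..<n+1]) id (\<Xi> (ndual r) \<otimes>\<^sub>v Tens {} 0) =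
    (\<Sum>z\<in>PiE {j0+1..n+1} (IdxAt r). ((\<Prod>i=j0+1..n+1. crd \<Theta> \<Phi> \<Xi> i (z i))
        * (\<Prod>i=j0+1..n. mcoef i (g i) (rgt (z i)) (lft (z (i+1)))))
      *\<^sub>C (b j0 (lft (z (j0+1))) \<otimes>\<^sub>v Tens {j0+1..n} (\<lambda>i. s i (mid (z i)))))"
proof -
  let ?lhs = "\<lambda>j. foldr (\<circ>) (map (transport n M \<pi> S \<Phi> g) [j+1..<n+1]) id (\<Xi> (ndual r) \<otimes>\<^sub>v Tens {} 0)"
  let ?rhs = "\<lambda>j. \<Sum>z\<in>PiE {j+1..n+1} (IdxAt r). ((\<Prod>i=j+1..n+1. crd \<Theta> \<Phi> \<Xi> i (z i))
        * (\<Prod>i=j+1..n. mcoef i (g i) (rgt (z i)) (lft (z (i+1)))))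
      *\<^sub>C (b j (lft (z (j+1))) \<otimes>\<^sub>v Tens {j+1..n} (\<lambda>i. s i (mid (z i))))"
  show "?lhs j0 = ?rhs j0"
  proof (rule inc_induct[where P = "\<lambda>j. ?lhs j = ?rhs j", OF \<open>j0 \<le> n\<close>])
    have n1: "n \<in> {1..n}" using n by simp
    have T0: "Tens {n+1..n} w = Tens {} 0" for w :: "nat \<Rightarrow> 's" by (simp add: Tens_def)
    have ins: "{n+1..n+1} = insert (n+1) {}" by simp
    have ndr: "ndual r \<in> dual N" using N_dual_bases r by (simp add: dual_bases_def)
    have "(\<Sum>q\<in>I n. \<beta> n q (\<Xi> (ndual r)) *\<^sub>C b n q) \<otimes>\<^sub>v Tens {} (0 :: nat \<Rightarrow> 's)
        = (\<Sum>q\<in>I n. \<beta> n q (\<Xi> (ndual r)) *\<^sub>C (b n q \<otimes>\<^sub>v Tens {} 0))"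
      by (rule tens_sum_left)
    hence "\<Xi> (ndual r) \<otimes>\<^sub>v Tens {} (0 :: nat \<Rightarrow> 's) = (\<Sum>q\<in>I n. \<beta> n q (\<Xi> (ndual r)) *\<^sub>C (b n q \<otimes>\<^sub>v Tens {} 0))"
      unfolding M_expand[OF n1 Lin_mem[OF \<Xi> ndr]] .
    hence "?lhs n = (\<Sum>q\<in>I n. \<beta> n q (\<Xi> (ndual r)) *\<^sub>C (b n q \<otimes>\<^sub>v Tens {} 0))" by simp
    also have "\<dots> = ?rhs n"
    proof -
      have 1: "(\<Sum>z\<in>PiE (insert (n+1) {}) (IdxAt r). h z) = (\<Sum>q\<in>I n. h ((\<lambda>_. undefined)(n+1 := (q, r, 0))))"
        for h :: "(nat \<Rightarrow> nat \<times> nat \<times> nat) \<Rightarrow> ('m, (nat, 's) tensors) tensor2"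
        by (subst sum_PiE_insert) (simp_all add: sum_IdxAt_last PiE_empty_domain fun_upd_def)
      have 2: "(\<Prod>i=n+1..n. h i) = (1 :: complex)" for h by simp
      have 3: "(\<Prod>i\<in>insert (n+1) {}. h i) = (h (n+1) :: complex)" for h by simp
      have 4: "crd \<Theta> \<Phi> \<Xi> (n+1) (q, r, 0) = \<beta> n q (\<Xi> (ndual r))" for q using n by (simp add: crd_def cK_triple)
      show ?thesis unfolding ins 1 2 3 T0 fun_upd_same 4 mult_1_right fst_conv ..
    qed
    finally show "?lhs n = ?rhs n" .
  next
    fix j assume "j0 \<le> j" "j < n" and IH: "?lhs (Suc j) = ?rhs (Suc j)"
    define i where "i = j + 1"
    have i: "i \<in> {2..n}" "i - 1 = j" "Suc j = i" "i \<le> n" using \<open>j0 \<le> j\<close> \<open>j < n\<close> \<open>1 \<le> j0\<close> by (auto simp: i_def)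
    let ?C = "\<lambda>z. (\<Prod>j=i+1..n+1. crd \<Theta> \<Phi> \<Xi> j (z j)) * (\<Prod>j=i+1..n. mcoef j (g j) (rgt (z j)) (lft (z (j+1))))"
    let ?w = "\<lambda>z j. s j (mid (z j))"
    let ?t = "transport n M \<pi> S \<Phi> g"
    let ?v = "\<lambda>z. b i (lft (z (i+1))) \<otimes>\<^sub>v Tens {i+1..n} (?w z)"
    let ?P = "PiE {i+1..n+1} (IdxAt r)"
    have Zri: "IdxAt r i = Idx i" using i by (simp add: IdxAt_def)
    have zZ: "z k \<in> Idx k" if "z \<in> ?P" "k \<in> {i+1..n+1}" for z k
      using PiE_mem[OF that] IdxAt_subset[OF r] by blast
    have zi: "lft (z (i+1)) \<in> I i" if "z \<in> ?P" for z
      using zZ[OF that, of "i+1"] i by (auto simp: Idx_def)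
    have wS: "?w z k \<in> S k" if "z \<in> ?P" "k \<in> {i+1..n}" for z k
      using zZ[OF that(1), of k] that(2) S_sub(2)[of k "mid (z k)"] i(1) by (auto simp: Idx_def)
    have mem: "?v z \<in> M i \<otimes>\<^sub>V Tensor {i+1..n} S"
      if z: "z \<in> ?P" for z
    proof (rule tens_in_tensor)
      have "i \<in> {1..n}" using i(1) by simp
      thus "b i (lft (z (i+1))) \<in> M i" by (rule M_sub(2)[OF _ zi[OF z]])
      show "Tens {i+1..n} (?w z) \<in> Tensor {i+1..n} S" by (rule Tens_in_Tensor) (rule wS[OF z])
    qed
    have upt: "[j+1..<n+1] = i # [i+1..<n+1]" using upt_conv_Cons[of "j+1" "n+1"] \<open>j < n\<close> by (simp add: i_def)
    have E0: "?lhs j = ?t i (foldr (\<circ>) (map ?t [i+1..<n+1]) id (\<Xi> (ndual r) \<otimes>\<^sub>v Tens {} 0))"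
      unfolding upt by simp
    have E1: "foldr (\<circ>) (map ?t [i+1..<n+1]) id (\<Xi> (ndual r) \<otimes>\<^sub>v Tens {} 0)
        = (\<Sum>z\<in>?P. ?C z *\<^sub>C (?v z))"
      using IH unfolding i(3) .
    have "?t i (\<Sum>z\<in>?P. ?C z *\<^sub>C (?v z)) = (\<Sum>z\<in>?P. ?C z *\<^sub>C ?t i (?v z))"
      by (rule Lin_expand[OF csubspace_tensor(1) transport_expand(1)[where \<Phi> = \<Phi> and i = i, OF i(1) \<Phi>[OF i(1)] g] mem])
    also have "\<dots> = (\<Sum>z\<in>?P. \<Sum>a\<in>Idx i. (?C z * (mcoef i (g i) (rgt a) (lft (z (i+1))) * cG i (\<Phi> i) a)) *\<^sub>C
        (b j (lft a) \<otimes>\<^sub>v Tens {i..n} ((?w z)(i := s i (mid a)))))"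
    proof (intro sum.cong refl)
      fix z assume z: "z \<in> ?P"
      have "?t i (?v z) = (\<Sum>a\<in>Idx i. (mcoef i (g i) (rgt a) (lft (z (i+1))) * cG i (\<Phi> i) a) *\<^sub>C
          (b (i - 1) (lft a) \<otimes>\<^sub>v Tens {i..n} ((?w z)(i := s i (mid a)))))"
        by (rule transport_expand(2)[where \<Phi> = \<Phi> and i = i, OF i(1) \<Phi>[OF i(1)] g zi[OF z]]) (rule wS[OF z])
      thus "?C z *\<^sub>C ?t i (?v z) =
          (\<Sum>a\<in>Idx i. (?C z * (mcoef i (g i) (rgt a) (lft (z (i+1))) * cG i (\<Phi> i) a)) *\<^sub>C
          (b j (lft a) \<otimes>\<^sub>v Tens {i..n} ((?w z)(i := s i (mid a)))))"
        by (simp only: i(2) complex_vector.scale_sum_right scaleC_scaleC)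
    qed
    also have "\<dots> = (\<Sum>a\<in>Idx i. \<Sum>z\<in>?P. (?C z * (mcoef i (g i) (rgt a) (lft (z (i+1))) * cG i (\<Phi> i) a)) *\<^sub>C
        (b j (lft a) \<otimes>\<^sub>v Tens {i..n} ((?w z)(i := s i (mid a)))))"
      by (rule sum.swap)
    also have "\<dots> = (\<Sum>z\<in>PiE (insert i {i+1..n+1}) (IdxAt r). ((\<Prod>k=i..n+1. crd \<Theta> \<Phi> \<Xi> k (z k))
          * (\<Prod>k=i..n. mcoef k (g k) (rgt (z k)) (lft (z (k+1)))))
        *\<^sub>C (b j (lft (z i)) \<otimes>\<^sub>v Tens {i..n} (?w z)))"
    proof -
      have 1: "(\<Prod>k=i..n+1. crd \<Theta> \<Phi> \<Xi> k ((z(i := a)) k)) = cG i (\<Phi> i) a * (\<Prod>k=i+1..n+1. crd \<Theta> \<Phi> \<Xi> k (z k))" for z a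
      proof -
        have "(\<Prod>k=i+1..n+1. crd \<Theta> \<Phi> \<Xi> k ((z(i := a)) k)) = (\<Prod>k=i+1..n+1. crd \<Theta> \<Phi> \<Xi> k (z k))"
          by (intro prod.cong) auto
        note eqA = this
        have eqB: "crd \<Theta> \<Phi> \<Xi> i a = cG i (\<Phi> i) a" using i(1) by (simp add: crd_def)
        have ins: "{i..n+1} = insert i {i+1..n+1}" using i(4) by auto
        have "(\<Prod>k\<in>insert i {i+1..n+1}. crd \<Theta> \<Phi> \<Xi> k ((z(i := a)) k))
            = crd \<Theta> \<Phi> \<Xi> i ((z(i := a)) i) * (\<Prod>k=i+1..n+1. crd \<Theta> \<Phi> \<Xi> k ((z(i := a)) k))"
          by (rule prod.insert) auto
        thus ?thesis unfolding ins[symmetric] eqA eqB fun_upd_same .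
      qed
      have 2: "(\<Prod>k=i..n. mcoef k (g k) (rgt ((z(i := a)) k)) (lft ((z(i := a)) (k+1))))
          = mcoef i (g i) (rgt a) (lft (z (i+1))) * (\<Prod>k=i+1..n. mcoef k (g k) (rgt (z k)) (lft (z (k+1))))" for z a
      proof -
        have "(\<Prod>k=i+1..n. mcoef k (g k) (rgt ((z(i := a)) k)) (lft ((z(i := a)) (k+1))))
            = (\<Prod>k=i+1..n. mcoef k (g k) (rgt (z k)) (lft (z (k+1))))"
          by (intro prod.cong) auto
        note eqA = this
        have ins: "{i..n} = insert i {i+1..n}" using i(4) by auto
        have "(\<Prod>k\<in>insert i {i+1..n}. mcoef k (g k) (rgt ((z(i := a)) k)) (lft ((z(i := a)) (k+1))))
            = mcoef i (g i) (rgt ((z(i := a)) i)) (lft ((z(i := a)) (i+1)))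
              * (\<Prod>k=i+1..n. mcoef k (g k) (rgt ((z(i := a)) k)) (lft ((z(i := a)) (k+1))))"
          by (rule prod.insert) auto
        thus ?thesis unfolding ins[symmetric] eqA by simp
      qed
      have 3: "(\<lambda>k. s k (mid ((z(i := a)) k))) = (?w z)(i := s i (mid a))" for z a by auto
      have 4: "i \<notin> {i+1..n+1}" by simp
      show ?thesis
        unfolding sum_PiE_insert[OF 4] 1 2 3 Zri fun_upd_same
        by (intro sum.cong refl arg_cong2[of _ _ _ _ scaleC]) (simp only: ac_simps)
    qed
    also have "insert i {i+1..n+1} = {i..n+1}" using i(4) by auto
    finally show "?lhs j = ?rhs j" unfolding E0 E1 by (simp only: i_def)
  qed
qed

lemma f_fun_expand:
  assumes \<Theta>: "\<Theta> \<in> Lin (M 1) L" and \<Phi>: "\<And>i. i \<in> {2..n} \<Longrightarrow> \<Phi> i \<in> Lin (M i) (MS i)"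
    and \<Xi>: "\<Xi> \<in> Lin (dual N) (M n)"
  shows "f_fun G n M \<pi> S N \<Theta> \<Phi> \<Xi> = lincomb (\<lambda>z. \<Prod>i=1..n+1. crd \<Theta> \<Phi> \<Xi> i (z i))"
proof
  fix g
  show "f_fun G n M \<pi> S N \<Theta> \<Phi> \<Xi> g = lincomb (\<lambda>z. \<Prod>i=1..n+1. crd \<Theta> \<Phi> \<Xi> i (z i)) g"
  proof (cases "g \<in> Gpow G n")
    case g: True
    have 1: "1 \<in> {1..n}" using n by simp
    have g1: "g 1 \<in> carrier G" by (rule Gpow_carrier[OF g 1])
    have ins: "{1..n+1} = insert 1 {1+1..n+1}" by auto
    let ?tm = "tensor_map (M 1) (Tensor {2..n} S) (\<Theta> \<circ> \<pi> 1 (g 1)) (id_on (Tensor {2..n} S))"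
    let ?C = "\<lambda>z. (\<Prod>i=1+1..n+1. crd \<Theta> \<Phi> \<Xi> i (z i)) * (\<Prod>i=1+1..n. mcoef i (g i) (rgt (z i)) (lft (z (i+1))))"
    let ?w = "\<lambda>z j. s j (mid (z j))"
    let ?v = "\<lambda>z. b 1 (lft (z 2)) \<otimes>\<^sub>v Tens {2..n} (?w z)"
    let ?q = "\<lambda>z a. l (mid a) \<otimes>\<^sub>v Tens {2..n} (?w z) \<otimes>\<^sub>v m (mid (z (n+1)))"
    let ?ch = "\<lambda>r. foldr (\<circ>) (map (transport n M \<pi> S \<Phi> g) [2..<n+1]) id (\<Xi> (ndual r) \<otimes>\<^sub>v Tens {} 0)"
    let ?P = "\<lambda>r. PiE {1+1..n+1} (IdxAt r)"
    let ?c = "\<lambda>z a. ?C z * (mcoef 1 (g 1) (rgt a) (lft (z 2)) * cH \<Theta> a)"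
    note tm = tensor_map_Lin[where W = "Tensor {2..n} S", OF M_sub(1)[OF 1] csubspace_tensor(2) Lin_compose[OF M_rep(1)[OF 1 g1] \<Theta>]
        id_on_Lin[OF csubspace_tensor(2)]]
    have T: "?tm (?ch r) \<otimes>\<^sub>v m r
        = (\<Sum>z\<in>?P r. \<Sum>a\<in>Idx 1. ?c z a *\<^sub>C ?q z a)"
      if r: "r \<in> J (n+1)" for r
    proof -
      have zZ: "z k \<in> Idx k" if "z \<in> ?P r" "k \<in> {2..n+1}" for z k
        using PiE_mem[OF that(1), of k] that(2) IdxAt_subset[OF r] by auto
      have z2: "b 1 (lft (z 2)) \<in> M 1" "lft (z 2) \<in> I 1" if "z \<in> ?P r" for z
        using zZ[OF that, of 2] n M_sub(2)[OF 1] by (auto simp: Idx_def)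
      have wS: "Tens {2..n} (?w z) \<in> Tensor {2..n} S" if "z \<in> ?P r" for z
      proof (rule Tens_in_Tensor)
        fix i assume i: "i \<in> {2..n}"
        hence "z i \<in> Idx i" by (intro zZ[OF that]) auto
        thus "s i (mid (z i)) \<in> S i" using S_sub(2)[OF i] by (auto simp: Idx_def)
      qed
      have zr: "mid (z (n+1)) = r" if "z \<in> ?P r" for z
        using PiE_mem[OF that, of "n+1"] n by (auto simp: IdxAt_def)
      have ch: "?ch r
          = (\<Sum>z\<in>?P r. ?C z *\<^sub>C (?v z))"
        using chain_expand[where \<Theta> = \<Theta>, OF \<Phi> \<Xi> g r n order.refl] by (simp add: numeral_2_eq_2)
      have tmE: "?tm (\<Sum>z\<in>?P r. ?C z *\<^sub>C (?v z))
          = (\<Sum>z\<in>?P r. ?C z *\<^sub>C ?tm (?v z))"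
        using z2 wS by (intro Lin_expand[OF csubspace_tensor(1) tm(1)] tens_in_tensor)
      have "(\<Sum>z\<in>?P r. ?C z *\<^sub>C ?tm (?v z)) \<otimes>\<^sub>v m r
          = (\<Sum>z\<in>?P r. ?C z *\<^sub>C (?tm (?v z) \<otimes>\<^sub>v m r))"
        by (rule tens_sum_left)
      also have "\<dots> = (\<Sum>z\<in>?P r. \<Sum>a\<in>Idx 1. ?c z a *\<^sub>C ?q z a)"
      proof (intro sum.cong refl)
        fix z assume z: "z \<in> ?P r"
        have tmz: "?tm (?v z) = \<Theta> (\<pi> 1 (g 1) (b 1 (lft (z 2)))) \<otimes>\<^sub>v Tens {2..n} (?w z)"
          using tm(2)[OF z2(1)[OF z] wS[OF z]] wS[OF z] by (simp add: id_on_def)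
        have "\<Theta> (\<pi> 1 (g 1) (b 1 (lft (z 2)))) \<otimes>\<^sub>v Tens {2..n} (?w z) \<otimes>\<^sub>v m r = (\<Sum>a\<in>Idx 1. (mcoef 1 (g 1) (rgt a) (lft (z 2)) * cH \<Theta> a) *\<^sub>C (l (mid a) \<otimes>\<^sub>v Tens {2..n} (?w z) \<otimes>\<^sub>v m r))"
          unfolding \<Theta>_expand[OF \<Theta> g1 z2(2)[OF z]] by (simp only: tens_sum_left)
        thus "?C z *\<^sub>C (?tm (?v z) \<otimes>\<^sub>v m r)
            = (\<Sum>a\<in>Idx 1. ?c z a *\<^sub>C ?q z a)"
          unfolding zr[OF z] tmz by (simp only: complex_vector.scale_sum_right scaleC_scaleC)
      qed
      finally show ?thesis unfolding ch tmE .
    qed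
    have "f_fun G n M \<pi> S N \<Theta> \<Phi> \<Xi> g = (\<Sum>r\<in>J (n+1).
        ?tm (?ch r) \<otimes>\<^sub>v m r)"
      using g by (simp add: f_fun_def Q)
    also have "\<dots> = (\<Sum>r\<in>J (n+1). \<Sum>z\<in>?P r. \<Sum>a\<in>Idx 1.
        ?c z a *\<^sub>C ?q z a)"
      by (intro sum.cong refl T)
    also have "\<dots> = (\<Sum>z\<in>PiE {1+1..n+1} Idx. \<Sum>a\<in>Idx 1.
        ?c z a *\<^sub>C ?q z a)"
      by (rule sum_IdxAt[OF n])
    also have "\<dots> = (\<Sum>a\<in>Idx 1. \<Sum>z\<in>PiE {1+1..n+1} Idx.
        ?c z a *\<^sub>C ?q z a)"
      by (rule sum.swap)
    also have "\<dots> = lincomb (\<lambda>z. \<Prod>i=1..n+1. crd \<Theta> \<Phi> \<Xi> i (z i)) g"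
    proof -
      have 1: "(\<Prod>k=1..n+1. crd \<Theta> \<Phi> \<Xi> k ((z(1 := a)) k)) = cH \<Theta> a * (\<Prod>k=1+1..n+1. crd \<Theta> \<Phi> \<Xi> k (z k))" for z a
      proof -
        have "(\<Prod>k=1+1..n+1. crd \<Theta> \<Phi> \<Xi> k ((z(1 := a)) k)) = (\<Prod>k=1+1..n+1. crd \<Theta> \<Phi> \<Xi> k (z k))"
          by (intro prod.cong) auto
        note eqA = this
        have eqB: "crd \<Theta> \<Phi> \<Xi> 1 a = cH \<Theta> a" by (simp add: crd_def)
        have "(\<Prod>k\<in>insert 1 {1+1..n+1}. crd \<Theta> \<Phi> \<Xi> k ((z(1 := a)) k))
            = crd \<Theta> \<Phi> \<Xi> 1 ((z(1 := a)) 1) * (\<Prod>k=1+1..n+1. crd \<Theta> \<Phi> \<Xi> k ((z(1 := a)) k))"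
          by (rule prod.insert) auto
        thus ?thesis unfolding ins[symmetric] eqA eqB fun_upd_same .
      qed
      have 2: "(\<Prod>k=1..n. mcoef k (g k) (rgt ((z(1 := a)) k)) (lft ((z(1 := a)) (k+1))))
          = mcoef 1 (g 1) (rgt a) (lft (z 2)) * (\<Prod>k=1+1..n. mcoef k (g k) (rgt (z k)) (lft (z (k+1))))" for z a
      proof -
        have "(\<Prod>k=1+1..n. mcoef k (g k) (rgt ((z(1 := a)) k)) (lft ((z(1 := a)) (k+1))))
            = (\<Prod>k=1+1..n. mcoef k (g k) (rgt (z k)) (lft (z (k+1))))"
          by (intro prod.cong) auto
        note eqA = this
        have ins1: "{1..n} = insert 1 {1+1..n}" using n by auto
        have "(\<Prod>k\<in>insert 1 {1+1..n}. mcoef k (g k) (rgt ((z(1 := a)) k)) (lft ((z(1 := a)) (k+1))))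
            = mcoef 1 (g 1) (rgt ((z(1 := a)) 1)) (lft ((z(1 := a)) (1+1)))
              * (\<Prod>k=1+1..n. mcoef k (g k) (rgt ((z(1 := a)) k)) (lft ((z(1 := a)) (k+1))))"
          by (rule prod.insert) auto
        thus ?thesis unfolding ins1[symmetric] eqA by (simp add: numeral_2_eq_2)
      qed
      have 3: "ptens (\<lambda>i. mid ((z(1 := a)) i)) = l (mid a) \<otimes>\<^sub>v Tens {2..n} (?w z) \<otimes>\<^sub>v m (mid (z (n+1)))" for z a
      proof -
        have "Tens {2..n} (\<lambda>i. s i (mid ((z(1 := a)) i))) = Tens {2..n} (?w z)"
          unfolding Tens_def by (intro ext if_cong refl prod.cong) auto
        thus ?thesis using n by (simp add: ptens_def)
      qed
      have 4: "1 \<notin> {1+1..n+1}" by simp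
      show ?thesis
        unfolding lincomb_def ins sum_PiE_insert[OF 4] efun_def if_P[OF g] scaleC_scaleC
        unfolding ins[symmetric] 1 2 3
        by (intro sum.cong refl arg_cong2[of _ _ _ _ scaleC]) (simp only: ac_simps)
    qed
    finally show ?thesis .
  qed (simp add: f_fun_def lincomb_def efun_def)
qed

subsection \<open>Intertwiners as fixed coordinate vectors\<close>

abbreviation "HomH \<equiv> Hom_rep (G\<lparr>carrier := H\<rparr>) (M 1) (\<pi> 1) L \<tau>"

abbreviation "HomG \<equiv> \<lambda>i. Hom_rep G (M i) (\<pi> i)
           (M (i - 1) \<otimes>\<^sub>V S i) (tensor_rep (M (i - 1)) (\<pi> (i - 1)) (S i) (\<sigma> i))"

abbreviation "HomK \<equiv> Hom_rep (G\<lparr>carrier := K\<rparr>) (dual N) (dual_rep (G\<lparr>carrier := K\<rparr>) N \<nu>) (M n) (\<pi> n)"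

lemma inv_rep:
  assumes "i \<in> {1..n}" "g \<in> carrier G" "v \<in> M i"
  shows "\<pi> i g (\<pi> i (inv\<^bsub>G\<^esub> g) v) = v" "\<pi> i (inv\<^bsub>G\<^esub> g) (\<pi> i g v) = v"
  using M_rep(2)[OF assms(1), of g "inv\<^bsub>G\<^esub> g" v] M_rep(2)[OF assms(1), of "inv\<^bsub>G\<^esub> g" g v]
    M_rep(3)[OF assms(1,3)] assms(2) by simp_all

definition fixed :: "nat \<Rightarrow> (nat \<times> nat \<times> nat \<Rightarrow> complex) \<Rightarrow> bool" where
  "fixed i x \<longleftrightarrow> (\<forall>k\<in>vgroup i. \<forall>a'\<in>Idx i. (\<Sum>a\<in>Idx i. vmat i k a' a * x a) = x a')"

lemma HomH_iff:
  "\<Theta> \<in> HomH \<longleftrightarrow> \<Theta> \<in> Lin (M 1) L \<and> fixed 1 (cH \<Theta>)"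
proof -
  have 1: "1 \<in> {1..n}" using n by simp
  let ?sum = "\<lambda>k r' p'. \<Sum>r\<in>J 1. \<Sum>p\<in>I 1.
    l' r' (\<tau> k (l r)) * \<beta> 1 p (\<pi> 1 (inv\<^bsub>G\<^esub> k) (b 1 p')) * l' r (\<Theta> (b 1 p))"
  have "\<Theta> \<in> HomH \<longleftrightarrow> \<Theta> \<in> Lin (M 1) L \<and>
    (\<forall>k\<in>carrier (G\<lparr>carrier := H\<rparr>). \<forall>r'\<in>J 1. \<forall>p'\<in>I 1.
    ?sum k r' p'
      = l' r' (\<Theta> (b 1 p')))"
    by (rule Hom_rep_coords[OF M(2)[OF 1] L(2)])
      (use carrier_sub(1) M_rep(1)[OF 1] L_rep(1) inv_rep[OF 1] subgroup.m_inv_closed[OF H] in auto)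
  also have "(\<forall>k\<in>carrier (G\<lparr>carrier := H\<rparr>). \<forall>r'\<in>J 1. \<forall>p'\<in>I 1.
    ?sum k r' p'
      = l' r' (\<Theta> (b 1 p'))) \<longleftrightarrow> fixed 1 (cH \<Theta>)"
    using I0(1) n unfolding fixed_def sum_Idx
    by (simp add: vgroup_def vmat_def mcoef_def smat_def cH_def Idx_def)
  finally show ?thesis .
qed

lemma tensor_rep_Lin:
  assumes i: "i \<in> {2..n}" and g: "g \<in> carrier G"
  shows "MSrep i g \<in> Lin (MS i) (MS i)"
    and "q \<in> I (i - 1) \<Longrightarrow> r \<in> J i \<Longrightarrow> MSrep i g (b (i - 1) q \<otimes>\<^sub>v s i r)
      = \<pi> (i - 1) g (b (i - 1) q) \<otimes>\<^sub>v \<sigma> i g (s i r)"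
proof -
  have i1: "i - 1 \<in> {1..n}" using i by auto
  note tm = tensor_map_Lin[OF M_sub(1)[OF i1] S_sub(1)[OF i] M_rep(1)[OF i1 g] S_rep(1)[OF i g]]
  show "MSrep i g \<in> Lin (MS i) (MS i)"
    unfolding tensor_rep_def by (rule tm(1))
  show "MSrep i g (b (i - 1) q \<otimes>\<^sub>v s i r)
      = \<pi> (i - 1) g (b (i - 1) q) \<otimes>\<^sub>v \<sigma> i g (s i r)" if "q \<in> I (i - 1)" "r \<in> J i"
    unfolding tensor_rep_def by (rule tm(2)[OF M_sub(2)[OF i1 that(1)] S_sub(2)[OF i that(2)]])
qed

lemma HomG_iff:
  assumes i: "i \<in> {2..n}"
  shows "\<Phi> \<in> HomG i \<longleftrightarrow>
    \<Phi> \<in> Lin (M i) (MS i) \<and> fixed i (cG i \<Phi>)"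
proof -
  have i1: "i \<in> {1..n}" "i - 1 \<in> {1..n}" using i by auto
  let ?\<rho> = "MSrep i"
  let ?w = "\<lambda>(q, r). b (i - 1) q \<otimes>\<^sub>v s i r" and ?\<omega> = "\<lambda>(q, r) t. t (\<beta> (i - 1) q) (s' i r)"
  let ?sum = "\<lambda>k c' p'. \<Sum>c\<in>I (i - 1) \<times> J i. \<Sum>p\<in>I i.
    ?\<omega> c' (?\<rho> k (?w c)) * \<beta> i p (\<pi> i (inv\<^bsub>G\<^esub> k) (b i p')) * ?\<omega> c (\<Phi> (b i p))"
  have "\<Phi> \<in> Hom_rep G (M i) (\<pi> i) (MS i) ?\<rho> \<longleftrightarrow> \<Phi> \<in> Lin (M i) (MS i) \<and>
    (\<forall>k\<in>carrier G. \<forall>c'\<in>I (i - 1) \<times> J i. \<forall>p'\<in>I i.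
    ?sum k c' p'
      = ?\<omega> c' (\<Phi> (b i p')))"
    by (rule Hom_rep_coords[OF M(2)[OF i1(1)] MS_bases[OF i]])
      (use M_rep(1)[OF i1(1)] tensor_rep_Lin(1)[OF i] inv_rep[OF i1(1)] in auto)
  also have "(\<forall>k\<in>carrier G. \<forall>c'\<in>I (i - 1) \<times> J i. \<forall>p'\<in>I i.
    ?sum k c' p'
      = ?\<omega> c' (\<Phi> (b i p'))) \<longleftrightarrow> fixed i (cG i \<Phi>)"
  proof -
    have v: "vgroup i = carrier G" using i by (simp add: vgroup_def)
    have *: "?sum k (q', r') p'
      = (\<Sum>a\<in>Idx i. vmat i k (q', r', p') a * cG i \<Phi> a)" if k: "k \<in> carrier G" for k q' r' p'
    proof -
      have "?sum k (q', r') p'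
        = (\<Sum>q\<in>I (i - 1). \<Sum>r\<in>J i. \<Sum>p\<in>I i. ?\<omega> (q', r') (?\<rho> k (?w (q, r))) * \<beta> i p (\<pi> i (inv\<^bsub>G\<^esub> k) (b i p')) * ?\<omega> (q, r) (\<Phi> (b i p)))"
        by (rule sum_Times)
      also have "\<dots> = (\<Sum>q\<in>I (i - 1). \<Sum>r\<in>J i. \<Sum>p\<in>I i. vmat i k (q', r', p') (q, r, p) * cG i \<Phi> (q, r, p))"
      proof (intro sum.cong refl)
        fix q r p assume "q \<in> I (i - 1)" "r \<in> J i"
        note tr = tensor_rep_Lin(2)[OF i k this]
        have "?\<omega> (q', r') (?\<rho> k (?w (q, r)))
            = \<beta> (i - 1) q' (\<pi> (i - 1) k (b (i - 1) q)) * s' i r' (\<sigma> i k (s i r))"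
          using M_lin[OF i1(2)] S_lin[OF i] unfolding case_prod_conv tr by (simp add: tens_def)
        also have "\<dots> = mcoef (i - 1) k q' q * smat i k r' r"
        proof -
          have "mcoef (i - 1) k q' q = \<beta> (i - 1) q' (\<pi> (i - 1) k (b (i - 1) q))"
            by (simp only: mcoef_def i1(2) if_True)
          moreover have "smat i k r' r = s' i r' (\<sigma> i k (s i r))" using i by (simp add: smat_def)
          ultimately show ?thesis by (simp only:)
        qed
        finally have "?\<omega> (q', r') (?\<rho> k (?w (q, r))) = mcoef (i - 1) k q' q * smat i k r' r" .
        thus "?\<omega> (q', r') (?\<rho> k (?w (q, r))) * \<beta> i p (\<pi> i (inv\<^bsub>G\<^esub> k) (b i p')) * ?\<omega> (q, r) (\<Phi> (b i p))
          = vmat i k (q', r', p') (q, r, p) * cG i \<Phi> (q, r, p)"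
          using i1(1) by (simp add: vmat_def cG_def mcoef_def[of i])
      qed
      finally show ?thesis unfolding sum_Idx .
    qed
    show ?thesis
      unfolding fixed_def v
    proof (intro ball_cong refl iffI)
      fix k assume k: "k \<in> carrier G"
      show "\<forall>a'\<in>Idx i. (\<Sum>a\<in>Idx i. vmat i k a' a * cG i \<Phi> a) = cG i \<Phi> a'"
        if h: "\<forall>c'\<in>I (i - 1) \<times> J i. \<forall>p'\<in>I i.
          ?sum k c' p'
          = ?\<omega> c' (\<Phi> (b i p'))"
      proof
        fix a' assume "a' \<in> Idx i"
        then obtain q' r' p' where a': "a' = (q', r', p')" "(q', r') \<in> I (i - 1) \<times> J i" "p' \<in> I i"
          by (auto simp: Idx_def)
        show "(\<Sum>a\<in>Idx i. vmat i k a' a * cG i \<Phi> a) = cG i \<Phi> a'"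
          unfolding a'(1) *[OF k, symmetric] bspec[OF bspec[OF h a'(2)] a'(3)] by (simp add: cG_def)
      qed
      show "\<forall>c'\<in>I (i - 1) \<times> J i. \<forall>p'\<in>I i.
          ?sum k c' p'
          = ?\<omega> c' (\<Phi> (b i p'))"
        if h: "\<forall>a'\<in>Idx i. (\<Sum>a\<in>Idx i. vmat i k a' a * cG i \<Phi> a) = cG i \<Phi> a'"
      proof (intro ballI)
        fix c' p' assume c': "c' \<in> I (i - 1) \<times> J i" and p': "p' \<in> I i"
        obtain q' r' where c: "c' = (q', r')" by (cases c')
        have "(q', r', p') \<in> Idx i" using c' p' c by (simp add: Idx_def)
        from bspec[OF h this]
        show "?sum k c' p'
          = ?\<omega> c' (\<Phi> (b i p'))"
          unfolding c *[OF k] by (simp add: cG_def)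
      qed
    qed
  qed
  finally show ?thesis .
qed

lemma dual_rep_simp:
  assumes "k \<in> K" "\<phi> \<in> dual N"
  shows "Ndual k \<phi> = \<phi> \<circ> \<nu> (inv\<^bsub>G\<^esub> k)"
  using assms G.m_inv_consistent[OF K] by (simp add: dual_rep_def)

lemma dual_rep_facts:
  assumes k: "k \<in> K"
  shows "Ndual k \<in> Lin (dual N) (dual N)"
    and "\<phi> \<in> dual N \<Longrightarrow> Ndual k (Ndual (inv\<^bsub>G\<^esub> k) \<phi>) = \<phi>"
    and "\<phi> \<in> dual N \<Longrightarrow> Ndual (inv\<^bsub>G\<^esub> k) (Ndual k \<phi>) = \<phi>"
proof -
  have ik: "inv\<^bsub>G\<^esub> k \<in> K" using k K by (simp add: subgroup.m_inv_closed)
  have kc: "k \<in> carrier G" by (rule carrier_sub(2)[OF k])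
  have mem: "\<phi> \<circ> \<nu> k' \<in> dual N" if "\<phi> \<in> dual N" "k' \<in> K" for \<phi> k'
    by (rule Lin_compose[OF N_rep(1)[OF that(2)] that(1)])
  have add: "Ndual k (\<phi> + \<psi>) =
      Ndual k \<phi> + Ndual k \<psi>"
    if "\<phi> \<in> dual N" "\<psi> \<in> dual N" for \<phi> \<psi>
  proof -
    have "csubspace (dual N)" using N_dual_bases by (simp add: dual_bases_def)
    hence "\<phi> + \<psi> \<in> dual N" using that by (rule complex_vector.subspace_add)
    thus ?thesis using that k by (simp add: dual_rep_simp fun_eq_iff)
  qed
  have scale: "Ndual k (c *\<^sub>C \<phi>) = c *\<^sub>C Ndual k \<phi>"
    if "\<phi> \<in> dual N" for c \<phi>
  proof -
    have "csubspace (dual N)" using N_dual_bases by (simp add: dual_bases_def)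
    hence "c *\<^sub>C \<phi> \<in> dual N" using that by (rule complex_vector.subspace_scale)
    thus ?thesis using that k by (simp add: dual_rep_simp fun_eq_iff)
  qed
  have "Ndual k \<phi> = 0" if "\<phi> \<notin> dual N" for \<phi>
    using that by (simp add: dual_rep_def)
  thus "Ndual k \<in> Lin (dual N) (dual N)"
    using add scale mem[OF _ ik] dual_rep_simp[OF k] unfolding Lin_def[of "dual N" "dual N"] by simp
  have one: "\<phi> \<circ> \<nu> k1 \<circ> \<nu> k2 = \<phi>" if \<phi>: "\<phi> \<in> dual N" and k: "k1 \<in> K" "k2 \<in> K" "k1 \<otimes>\<^bsub>G\<^esub> k2 = \<one>\<^bsub>G\<^esub>" for \<phi> k1 k2
  proof
    fix v
    show "(\<phi> \<circ> \<nu> k1 \<circ> \<nu> k2) v = \<phi> v"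
    proof (cases "v \<in> N")
      case True
      thus ?thesis using N_rep(3)[OF k(1,2), of v] N_rep(2) k(3) by simp
    next
      case False
      have "(\<phi> \<circ> \<nu> k1 \<circ> \<nu> k2) \<in> dual N" using mem[OF mem[OF \<phi> k(1)] k(2)] .
      thus ?thesis using False \<phi> by (simp add: Lin_def)
    qed
  qed
  show "Ndual k (Ndual (inv\<^bsub>G\<^esub> k) \<phi>) = \<phi>" if "\<phi> \<in> dual N"
    using dual_rep_simp[OF ik that] dual_rep_simp[OF k mem[OF that, of k]] one[OF that, of k "inv\<^bsub>G\<^esub> k"] k ik kc
    by simp
  show "Ndual (inv\<^bsub>G\<^esub> k) (Ndual k \<phi>) = \<phi>" if "\<phi> \<in> dual N"
    using dual_rep_simp[OF k that] dual_rep_simp[OF ik mem[OF that ik]] one[OF that, of "inv\<^bsub>G\<^esub> k" k] k ik kc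
    by simp
qed

lemma HomK_iff:
  "\<Xi> \<in> HomK \<longleftrightarrow>
    \<Xi> \<in> Lin (dual N) (M n) \<and> fixed (n+1) (cK \<Xi>)"
proof -
  have nn: "n \<in> {1..n}" using n by simp
  let ?\<rho> = "Ndual"
  let ?sum = "\<lambda>k q' r'. \<Sum>q\<in>I n. \<Sum>r\<in>J (n+1).
    \<beta> n q' (\<pi> n k (b n q)) * ?\<rho> (inv\<^bsub>G\<^esub> k) (ndual r') (m r) * \<beta> n q (\<Xi> (ndual r))"
  have "\<Xi> \<in> Hom_rep (G\<lparr>carrier := K\<rparr>) (dual N) ?\<rho> (M n) (\<pi> n) \<longleftrightarrow> \<Xi> \<in> Lin (dual N) (M n) \<and>
    (\<forall>k\<in>carrier (G\<lparr>carrier := K\<rparr>). \<forall>q'\<in>I n. \<forall>r'\<in>J (n+1).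
    ?sum k q' r'
      = \<beta> n q' (\<Xi> (ndual r')))"
    by (rule Hom_rep_coords[OF N_dual_bases M(2)[OF nn]])
      (use carrier_sub(2) dual_rep_facts M_rep(1)[OF nn] subgroup.m_inv_closed[OF K] in auto)
  also have "(\<forall>k\<in>carrier (G\<lparr>carrier := K\<rparr>). \<forall>q'\<in>I n. \<forall>r'\<in>J (n+1).
    ?sum k q' r'
      = \<beta> n q' (\<Xi> (ndual r'))) \<longleftrightarrow> fixed (n+1) (cK \<Xi>)"
  proof -
    have *: "?sum k q' r'
        = (\<Sum>a\<in>Idx (n+1). vmat (n+1) k (q', r', 0) a * cK \<Xi> a)" if k: "k \<in> K" and r': "r' \<in> J (n+1)" for k q' r'
    proof -
      have ik: "inv\<^bsub>G\<^esub> k \<in> K" using k K by (simp add: subgroup.m_inv_closed)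
      have ndual: "ndual r' \<in> dual N" using N_dual_bases r' by (simp add: dual_bases_def)
      have "?\<rho> (inv\<^bsub>G\<^esub> k) (ndual r') (m r) = smat (n+1) k r' r" if r: "r \<in> J (n+1)" for r
        using dual_rep_simp[OF ik ndual] carrier_sub(2)[OF k] n Lin_mem[OF N_rep(1)[OF k] N_sub(2)[OF r]]
        by (simp add: smat_def)
      thus ?thesis
        unfolding sum_Idx using nn I0(2) by (simp add: vmat_def mcoef_def cK_triple)
    qed
    have v: "vgroup (n+1) = K" using n by (simp add: vgroup_def)
    have Zn: "Idx (n+1) = (\<lambda>(q, r). (q, r, 0)) ` (I n \<times> J (n+1))" using I0(2) by (auto simp: Idx_def)
    have "fixed (n+1) (cK \<Xi>) \<longleftrightarrow> (\<forall>k\<in>K. \<forall>q'\<in>I n. \<forall>r'\<in>J (n+1).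
        (\<Sum>a\<in>Idx (n+1). vmat (n+1) k (q', r', 0) a * cK \<Xi> a) = cK \<Xi> (q', r', 0))"
      unfolding fixed_def v by (subst (1) Zn) auto
    also have "\<dots> \<longleftrightarrow> (\<forall>k\<in>K. \<forall>q'\<in>I n. \<forall>r'\<in>J (n+1).
        ?sum k q' r'
      = \<beta> n q' (\<Xi> (ndual r')))"
      by (intro ball_cong refl) (simp only: * cK_triple)
    finally show ?thesis by simp
  qed
  finally show ?thesis .
qed

lemma coords_HomH: "\<exists>\<Theta>\<in>Lin (M 1) L. \<forall>a\<in>Idx 1. cH \<Theta> a = x a"
proof -
  have 1: "1 \<in> {1..n}" using n by simp
  note f = Lin_of_coords[OF M(2)[OF 1] L(2), where x = "\<lambda>r p. x (0, r, p)"]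
  have "cH (\<lambda>v. if v \<in> M 1 then \<Sum>k\<in>J 1. (\<Sum>j\<in>I 1. x (0, k, j) * \<beta> 1 j v) *\<^sub>C l k else 0) a = x a"
    if a: "a \<in> Idx 1" for a
  proof -
    obtain r p where a: "a = (0, r, p)" "r \<in> J 1" "p \<in> I 1" using a I0(1) by (auto simp: Idx_def)
    show ?thesis unfolding a(1) cH_def fst_conv snd_conv by (rule f(2)[OF a(3,2)])
  qed
  thus ?thesis using f(1) by blast
qed

lemma coords_HomG:
  assumes i: "i \<in> {2..n}"
  shows "\<exists>\<Phi>\<in>Lin (M i) (MS i). \<forall>a\<in>Idx i. cG i \<Phi> a = x a"
proof -
  have i1: "i \<in> {1..n}" using i by simp
  note f = Lin_of_coords[OF M(2)[OF i1] MS_bases[OF i], where x = "\<lambda>c p. x (fst c, snd c, p)"]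
  have "cG i (\<lambda>v. if v \<in> M i then \<Sum>k\<in>I (i - 1) \<times> J i. (\<Sum>j\<in>I i. x (fst k, snd k, j) * \<beta> i j v) *\<^sub>C
      (case k of (q, r) \<Rightarrow> b (i - 1) q \<otimes>\<^sub>v s i r) else 0) a = x a" if "a \<in> Idx i" for a
  proof -
    obtain q r p where a: "a = (q, r, p)" "(q, r) \<in> I (i - 1) \<times> J i" "p \<in> I i"
      using \<open>a \<in> Idx i\<close> by (auto simp: Idx_def)
    show ?thesis using f(2)[OF a(3,2)] unfolding a(1) cG_def fst_conv snd_conv case_prod_conv .
  qed
  thus ?thesis using f(1) by blast
qed

lemma coords_HomK: "\<exists>\<Xi>\<in>Lin (dual N) (M n). \<forall>a\<in>Idx (n+1). cK \<Xi> a = x a"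
proof -
  have nn: "n \<in> {1..n}" using n by simp
  note f = Lin_of_coords[OF N_dual_bases M(2)[OF nn], where x = "\<lambda>q r. x (q, r, 0)"]
  have "cK (\<lambda>v. if v \<in> dual N then \<Sum>k\<in>I n. (\<Sum>j\<in>J (n+1). x (k, j, 0) * v (m j)) *\<^sub>C b n k else 0) a = x a"
    if a: "a \<in> Idx (n+1)" for a
  proof -
    obtain q r where a: "a = (q, r, 0)" "q \<in> I n" "r \<in> J (n+1)" using a I0(2) by (auto simp: Idx_def)
    show ?thesis unfolding a(1) cK_triple by (rule f(2)[OF a(3,2)])
  qed
  thus ?thesis using f(1) by blast
qed

subsection \<open>The isomorphism\<close>

abbreviation "Inv \<equiv> gauge_invariants G H K n gauge Fns"

text \<open>
The coordinate functionals are linear on the whole types of functions, hence so are the coordinates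
of tensors.
\<close>

definition tcrd :: "(nat \<Rightarrow> nat \<times> nat \<times> nat) \<Rightarrow>
    (('m \<Rightarrow> 'l, (nat, 'm \<Rightarrow> ('m, 's) tensor2) tensors) tensor2, ('n \<Rightarrow> complex) \<Rightarrow> 'm) tensor2 \<Rightarrow> complex" where
  "tcrd z = ev3 (\<lambda>\<Theta>. cH \<Theta> (z 1)) (\<lambda>i \<Phi>. cG i \<Phi> (z i)) (\<lambda>\<Xi>. cK \<Xi> (z (n+1)))"

lemma clinear_coords: "clinear (\<lambda>\<Theta>. cH \<Theta> a)" "clinear (\<lambda>\<Phi>. cG i \<Phi> a)" "clinear (\<lambda>\<Xi>. cK \<Xi> a)"
  using L_lin M_lin[of n] n by (simp_all add: clinear_iff cH_def cG_def cK_def)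

lemma tcrd_pure: "tcrd z (\<Theta> \<otimes>\<^sub>v Tens {2..n} \<Phi> \<otimes>\<^sub>v \<Xi>) = (\<Prod>i=1..n+1. crd \<Theta> \<Phi> \<Xi> i (z i))"
  unfolding prod_vertices[OF n] tcrd_def using clinear_coords n
  by (subst ev3_pure) (auto simp: crd_def intro!: prod.cong)

lemma tcrd_injective:
  assumes t: "t \<in> Lin (M 1) L \<otimes>\<^sub>V Tensor {2..n} (\<lambda>i. Lin (M i) (MS i)) \<otimes>\<^sub>V Lin (dual N) (M n)"
    and 0: "\<And>z. z \<in> Lab \<Longrightarrow> tcrd z t = 0"
  shows "t = 0"
proof -
  have 1: "1 \<in> {1..n}" "n \<in> {1..n}" using n by auto
  let ?u = "\<lambda>a v. if v \<in> M 1 then \<beta> 1 (rgt a) v *\<^sub>C l (mid a) else 0"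
  let ?x = "\<lambda>i a v. if v \<in> M i then \<beta> i (rgt a) v *\<^sub>C (b (i - 1) (lft a) \<otimes>\<^sub>v s i (mid a)) else 0"
  let ?y = "\<lambda>a \<phi>. if \<phi> \<in> dual N then \<phi> (m (mid a)) *\<^sub>C b n (lft a) else 0"
  have u: "(\<Sum>a\<in>Idx 1. cH \<Theta> a *\<^sub>C ?u a) = \<Theta>" if "\<Theta> \<in> Lin (M 1) L" for \<Theta>
    using Lin_basis_expand[OF M(2)[OF 1(1)] L(2) that]
    unfolding sum_Idx cH_def fst_conv snd_conv by (simp add: I0(1))
  have x: "(\<Sum>a\<in>Idx i. cG i \<Phi> a *\<^sub>C ?x i a) = \<Phi>" if i: "i \<in> {2..n}" and \<Phi>: "\<Phi> \<in> Lin (M i) (MS i)" for i \<Phi>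
  proof -
    have "i \<in> {1..n}" using i by simp
    from Lin_basis_expand[OF M(2)[OF this] MS_bases[OF i] \<Phi>]
    show ?thesis unfolding sum_Idx cG_def fst_conv snd_conv sum_Times case_prod_conv .
  qed
  have y: "(\<Sum>a\<in>Idx (n+1). cK \<Xi> a *\<^sub>C ?y a) = \<Xi>" if "\<Xi> \<in> Lin (dual N) (M n)" for \<Xi>
    using Lin_basis_expand[OF N_dual_bases M(2)[OF 1(2)] that] I0(2)
    unfolding sum_Idx cK_def fst_conv snd_conv by simp
  have "(\<Sum>z\<in>Lab. tcrd z t *\<^sub>C (?u (z 1) \<otimes>\<^sub>v Tens {2..n} (\<lambda>i. ?x i (z i)) \<otimes>\<^sub>v ?y (z (n+1)))) = t"
    unfolding tcrd_def
    by (rule tensor3_expand[OF n finite_Idx clinear_coords u x y t])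
  moreover have "(\<Sum>z\<in>Lab. tcrd z t *\<^sub>C (?u (z 1) \<otimes>\<^sub>v Tens {2..n} (\<lambda>i. ?x i (z i)) \<otimes>\<^sub>v ?y (z (n+1)))) = 0"
    using 0 by (intro sum.neutral) simp
  ultimately show "t = 0" by simp
qed

text \<open>
Invariance of a function is the invariance of its coefficient array, by independence.
\<close>

lemma invariant_iff:
  assumes f: "f = lincomb c"
  shows "f \<in> Inv \<longleftrightarrow> (\<forall>k\<in>PiE {1..n+1} vgroup. \<forall>z'\<in>Lab. (\<Sum>z\<in>Lab. gmat k z' z * c z) = c z')"
proof -
  let ?\<rho> = "gauge"
  let ?k = "\<lambda>k g. gauge_act G n (gauge_inv G n k) g"
  let ?c = "\<lambda>k z'. \<Sum>z\<in>Lab. gmat k z' z * c z"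
  have act: "?\<rho> k (f (?k k g)) = lincomb (?c k) g" if k: "k \<in> PiE {1..n+1} vgroup" and g: "g \<in> Gpow G n" for k g
  proof -
    have mem: "efun z g' \<in> LSN" if z: "z \<in> Lab" for z g'
    proof -
      have "ptens (\<lambda>i. mid (z i)) \<in> LSN"
      proof (rule ptens_in)
        fix i assume "i \<in> {1..n+1}"
        from PiE_mem[OF z this] show "mid (z i) \<in> J i" by (auto simp: Idx_def)
      qed
      thus ?thesis
        by (simp add: efun_def complex_vector.subspace_scale[OF csubspace_tensor(1)]
            complex_vector.subspace_0[OF csubspace_tensor(1)])
    qed
    have "?\<rho> k (f (?k k g)) = (\<Sum>z\<in>Lab. c z *\<^sub>C ?\<rho> k (efun z (?k k g)))"
      unfolding f lincomb_def by (rule Lin_expand[OF csubspace_tensor(1) gauge_rep_Lin(1)[OF k] mem])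
    also have "\<dots> = (\<Sum>z\<in>Lab. c z *\<^sub>C (\<Sum>z'\<in>Lab. gmat k z' z *\<^sub>C efun z' g))"
      by (intro sum.cong refl arg_cong2[of _ _ _ _ scaleC] gauge_rep_efun[OF k g])
    also have "\<dots> = (\<Sum>z\<in>Lab. \<Sum>z'\<in>Lab. (gmat k z' z * c z) *\<^sub>C efun z' g)"
      by (simp only: complex_vector.scale_sum_right scaleC_scaleC mult.commute)
    also have "\<dots> = (\<Sum>z'\<in>Lab. \<Sum>z\<in>Lab. (gmat k z' z * c z) *\<^sub>C efun z' g)"
      by (rule sum.swap)
    also have "\<dots> = lincomb (?c k) g"
      unfolding lincomb_def complex_vector.scale_sum_left ..
    finally show ?thesis .
  qed
  have eq: "(\<forall>g\<in>Gpow G n. lincomb (?c k) g = f g) \<longleftrightarrow> (\<forall>z'\<in>Lab. ?c k z' = c z')" for k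
  proof
    assume h: "\<forall>g\<in>Gpow G n. lincomb (?c k) g = f g"
    show "\<forall>z'\<in>Lab. ?c k z' = c z'"
    proof
      fix z' assume z': "z' \<in> Lab"
      have "?c k z' - c z' = 0"
      proof (rule efun_independent[OF _ z'])
        fix g assume "g \<in> Gpow G n"
        hence "lincomb (?c k) g - lincomb c g = 0" using h f by simp
        thus "(\<Sum>z\<in>Lab. (?c k z - c z) *\<^sub>C efun z g) = 0"
          unfolding lincomb_def by (simp only: complex_vector.scale_left_diff_distrib sum_subtractf)
      qed
      thus "?c k z' = c z'" by simp
    qed
  qed (simp add: f lincomb_def)
  have "f \<in> Fns"
    unfolding vector_valued_eq f by (rule rangeI)
  hence "f \<in> Inv \<longleftrightarrow> (\<forall>k\<in>PiE {1..n+1} vgroup. \<forall>g\<in>Gpow G n. lincomb (?c k) g = f g)"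
    unfolding gauge_invariants_def gauge_group_eq using act by simp
  thus ?thesis unfolding eq .
qed

text \<open>
A gauge transformation which is trivial at all vertices but \<open>j\<close> acts only in the slot \<open>j\<close>.
\<close>

lemma fixed_in_each_slot:
  assumes c: "\<And>k z'. k \<in> PiE {1..n+1} vgroup \<Longrightarrow> z' \<in> Lab \<Longrightarrow>
      (\<Sum>z\<in>Lab. gmat k z' z * c z) = c z'"
    and j: "j \<in> {1..n+1}" and z: "z \<in> Lab"
  shows "fixed j (\<lambda>a. c (z(j := a)))"
  unfolding fixed_def
proof (intro ballI)
  fix k a' assume k: "k \<in> vgroup j" and a': "a' \<in> Idx j"
  have one: "\<one>\<^bsub>G\<^esub> \<in> vgroup i" for i
    using H K by (simp add: vgroup_def subgroup.one_closed)
  let ?k = "(\<lambda>i\<in>{1..n+1}. \<one>\<^bsub>G\<^esub>)(j := k)"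
  let ?z = "z(j := a')"
  let ?O = "{1..n+1} - {j}"
  have kP: "?k \<in> PiE {1..n+1} vgroup" using one k j by (auto simp: PiE_iff extensional_def)
  have zP: "?z \<in> Lab" using z a' j by (auto simp: PiE_iff extensional_def)
  have ins: "{1..n+1} = insert j ?O" using j by auto
  have jn: "j \<notin> ?O" by simp
  have prod: "(\<Prod>i=1..n+1. vmat i (?k i) (?z i) ((w(j := a)) i)) = vmat j k a' a * of_bool (\<forall>i\<in>?O. z i = w i)"
    if w: "w \<in> PiE ?O Idx" for w a
  proof -
    have "(\<Prod>i=1..n+1. vmat i (?k i) (?z i) ((w(j := a)) i))
        = vmat j (?k j) (?z j) ((w(j := a)) j) * (\<Prod>i\<in>?O. vmat i (?k i) (?z i) ((w(j := a)) i))"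
      using j by (rule prod.remove[rotated]) simp
    also have "(\<Prod>i\<in>?O. vmat i (?k i) (?z i) ((w(j := a)) i)) = (\<Prod>i\<in>?O. of_bool (z i = w i))"
    proof (rule prod.cong)
      fix i assume i: "i \<in> ?O"
      have "z i \<in> Idx i" "w i \<in> Idx i" using i PiE_mem[OF z, of i] PiE_mem[OF w i] by auto
      thus "vmat i (?k i) (?z i) ((w(j := a)) i) = of_bool (z i = w i)"
        using i vmat_one[of i "z i" "w i"] by simp
    qed simp
    also have "(\<Prod>i\<in>?O. of_bool (z i = w i) :: complex) = of_bool (\<forall>i\<in>?O. z i = w i)"
      by (auto simp: prod_zero_iff)
    finally show ?thesis unfolding fun_upd_same .
  qed
  let ?w = "restrict z ?O"
  have w: "?w \<in> PiE ?O Idx" using z by (auto simp: PiE_iff)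
  have fin: "finite (PiE ?O Idx)" by (intro finite_PiE) (auto intro: finite_Idx)
  have eqw: "of_bool (\<forall>i\<in>?O. z i = w i) = (of_bool (w = ?w) :: complex)" if "w \<in> PiE ?O Idx" for w
  proof -
    have "w = ?w" if "\<forall>i\<in>?O. z i = w i"
      by (rule PiE_ext[OF \<open>w \<in> _\<close> w]) (use that in auto)
    moreover have "z i = w i" if "w = ?w" "i \<in> ?O" for i
      using fun_cong[OF that(1), of i] that(2) by simp
    ultimately have "(\<forall>i\<in>?O. z i = w i) \<longleftrightarrow> w = ?w" by blast
    thus ?thesis by (rule arg_cong)
  qed
  have upd: "?w(j := a) = z(j := a)" for a
    using z by (auto simp: PiE_iff extensional_def restrict_def fun_eq_iff)
  have "c ?z = (\<Sum>y\<in>Lab. (\<Prod>i=1..n+1. vmat i (?k i) (?z i) (y i)) * c y)" using c[OF kP zP] by simp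
  also have "\<dots> = (\<Sum>a\<in>Idx j. \<Sum>w\<in>PiE ?O Idx. (\<Prod>i=1..n+1. vmat i (?k i) (?z i) ((w(j := a)) i)) * c (w(j := a)))"
    using sum_PiE_insert[OF jn, where Z = Idx and h = "\<lambda>y. (\<Prod>i=1..n+1. vmat i (?k i) (?z i) (y i)) * c y"]
    unfolding ins[symmetric] .
  also have "\<dots> = (\<Sum>a\<in>Idx j. \<Sum>w\<in>PiE ?O Idx. if w = ?w then vmat j k a' a * c (w(j := a)) else 0)"
    using prod eqw by (intro sum.cong refl) (auto simp: of_bool_def)
  also have "\<dots> = (\<Sum>a\<in>Idx j. vmat j k a' a * c (z(j := a)))"
    using fin w upd by simp
  finally show "(\<Sum>a\<in>Idx j. vmat j k a' a * c (z(j := a))) = c (z(j := a'))" by simp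
qed

lemma fixed_cong: "(\<And>a. a \<in> Idx i \<Longrightarrow> x a = y a) \<Longrightarrow> fixed i x \<longleftrightarrow> fixed i y"
  unfolding fixed_def by simp

lemma csubspace_fixed: "csubspace {x. fixed i x}"
  unfolding complex_vector.subspace_def fixed_def
  by (auto simp: distrib_left sum.distrib sum_distrib_left mult.left_commute simp flip: sum_distrib_left)

text \<open>
The linear map \<open>F\<close> takes a tensor to the function whose coefficients are the coordinates of the
tensor.
\<close>

theorem isomorphism:
  "\<exists>F. F \<in> Lin (HomH \<otimes>\<^sub>V Tensor {2..n} HomG \<otimes>\<^sub>V HomK) Inv \<and>
       bij_betw F (HomH \<otimes>\<^sub>V Tensor {2..n} HomG \<otimes>\<^sub>V HomK) Inv \<and>
       (\<forall>\<Theta>\<in>HomH. \<forall>\<Phi>. (\<forall>i\<in>{2..n}. \<Phi> i \<in> HomG i) \<longrightarrow> (\<forall>\<Xi>\<in>HomK.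
          F (\<Theta> \<otimes>\<^sub>v Tens {2..n} \<Phi> \<otimes>\<^sub>v \<Xi>) = f_fun G n M \<pi> S N \<Theta> \<Phi> \<Xi>))"
proof -
  let ?D = "HomH \<otimes>\<^sub>V Tensor {2..n} HomG \<otimes>\<^sub>V HomK"
  let ?E = "Lin (M 1) L \<otimes>\<^sub>V Tensor {2..n} (\<lambda>i. Lin (M i) (MS i)) \<otimes>\<^sub>V Lin (dual N) (M n)"
  let ?pure = "\<lambda>\<Theta> \<Phi> \<Xi>. \<Theta> \<otimes>\<^sub>v Tens {2..n} \<Phi> \<otimes>\<^sub>v \<Xi>"
  have subD: "csubspace ?D" and subE: "csubspace ?E" by (rule csubspace_tensor)+
  have pureE: "?pure \<Theta> \<Phi> \<Xi> \<in> ?E"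
    if "\<Theta> \<in> HomH" "\<And>i. i \<in> {2..n} \<Longrightarrow> \<Phi> i \<in> HomG i" "\<Xi> \<in> HomK" for \<Theta> \<Phi> \<Xi>
  proof (intro tens_in_tensor)
    show "\<Theta> \<in> Lin (M 1) L" "\<Xi> \<in> Lin (dual N) (M n)" using that(1,3) unfolding HomH_iff HomK_iff by blast+
    show "Tens {2..n} \<Phi> \<in> Tensor {2..n} (\<lambda>i. Lin (M i) (MS i))"
      by (rule Tens_in_Tensor) (use that(2) HomG_iff in blast)
  qed
  have DE: "?D \<subseteq> ?E" by (rule tensor3_subset[OF subE pureE])
  have pureD: "?pure \<Theta> \<Phi> \<Xi> \<in> ?D"
    if "\<Theta> \<in> HomH" "\<And>i. i \<in> {2..n} \<Longrightarrow> \<Phi> i \<in> HomG i" "\<Xi> \<in> HomK" for \<Theta> \<Phi> \<Xi>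
    by (intro tens_in_tensor that(1,3)) (rule Tens_in_Tensor, rule that(2))
  define F where "F t = (if t \<in> ?D then lincomb (\<lambda>z. tcrd z t) else 0)" for t
  have tcrd_lin: "clinear (tcrd z)" for z unfolding tcrd_def by (rule clinear_ev3)
  have tcrd_add: "tcrd z (t + t') = tcrd z t + tcrd z t'" and tcrd_scale: "tcrd z (c *\<^sub>C t) = c * tcrd z t" for z t t' c
    using tcrd_lin[of z] by (simp_all add: clinear_iff)
  have "clinear (\<lambda>t. lincomb (\<lambda>z. tcrd z t))"
    unfolding clinear_iff lincomb_def tcrd_add tcrd_scale
    by (auto simp: fun_eq_iff scaleC_add_left sum.distrib complex_vector.scale_sum_right scaleC_scaleC
        sum_fun_apply distrib_right sum_distrib_left mult.assoc)
  hence F_lin: "F \<in> Lin ?D UNIV" unfolding F_def by (rule Lin_restrictI[OF subD])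
  have crd_fixed: "fixed i (crd \<Theta> \<Phi> \<Xi> i)"
    if "\<Theta> \<in> HomH" "\<And>i. i \<in> {2..n} \<Longrightarrow> \<Phi> i \<in> HomG i" "\<Xi> \<in> HomK" and i: "i \<in> {1..n+1}" for \<Theta> \<Phi> \<Xi> i
  proof -
    consider "i = 1" | "i = n + 1" "i \<noteq> 1" | "i \<in> {2..n}" using i by fastforce
    thus ?thesis
    proof cases
      case 1
      have "crd \<Theta> \<Phi> \<Xi> 1 = cH \<Theta>" by (simp add: crd_def fun_eq_iff)
      thus ?thesis using that(1) unfolding HomH_iff 1 by simp
    next
      case 2
      have "crd \<Theta> \<Phi> \<Xi> (n+1) = cK \<Xi>" using 2 by (simp add: crd_def fun_eq_iff)
      thus ?thesis using that(3) unfolding HomK_iff 2(1) by simp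
    next
      case 3
      have "crd \<Theta> \<Phi> \<Xi> i = cG i (\<Phi> i)" using 3 by (simp add: crd_def fun_eq_iff)
      thus ?thesis using that(2)[OF 3] HomG_iff[OF 3] by simp
    qed
  qed
  have tcrd_fixed: "(\<Sum>z\<in>Lab. gmat k z' z * tcrd z t) = tcrd z' t"
    if k: "k \<in> PiE {1..n+1} vgroup" and z': "z' \<in> Lab" and t: "t \<in> ?D" for k z' t
  proof -
    let ?l = "\<lambda>t. \<Sum>z\<in>Lab. gmat k z' z * tcrd z t"
    have "?D \<subseteq> {t. ?l t = tcrd z' t}"
    proof (rule tensor3_subset)
      have add: "?l (t + t') = ?l t + ?l t'" and scale: "?l (c *\<^sub>C t) = c * ?l t" for t t' c
        by (simp_all only: tcrd_add tcrd_scale distrib_left sum.distrib sum_distrib_left mult.left_commute)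
      show "csubspace {t. ?l t = tcrd z' t}"
        unfolding complex_vector.subspace_def using add scale tcrd_add tcrd_scale tcrd_scale[of _ 0 0] by auto
      fix \<Theta> \<Phi> \<Xi> assume h: "\<Theta> \<in> HomH" "\<And>i. i \<in> {2..n} \<Longrightarrow> \<Phi> i \<in> HomG i" "\<Xi> \<in> HomK"
      have "?l (?pure \<Theta> \<Phi> \<Xi>) = (\<Sum>z\<in>Lab. \<Prod>i=1..n+1. vmat i (k i) (z' i) (z i) * crd \<Theta> \<Phi> \<Xi> i (z i))"
        unfolding tcrd_pure prod.distrib ..
      also have "\<dots> = (\<Prod>i=1..n+1. \<Sum>a\<in>Idx i. vmat i (k i) (z' i) a * crd \<Theta> \<Phi> \<Xi> i a)"
        by (rule prod_sum_PiE[symmetric]) (auto intro: finite_Idx)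
      also have "\<dots> = (\<Prod>i=1..n+1. crd \<Theta> \<Phi> \<Xi> i (z' i))"
        using crd_fixed[OF h] PiE_mem[OF k] PiE_mem[OF z'] unfolding fixed_def by (intro prod.cong refl) blast
      finally show "?pure \<Theta> \<Phi> \<Xi> \<in> {t. ?l t = tcrd z' t}" by (simp only: tcrd_pure mem_Collect_eq)
    qed
    thus ?thesis using t by blast
  qed
  have F_Inv: "F t \<in> Inv" if t: "t \<in> ?D" for t
  proof -
    have "F t = lincomb (\<lambda>z. tcrd z t)" using t by (simp add: F_def)
    from invariant_iff[OF this] show ?thesis using tcrd_fixed[OF _ _ t] by blast
  qed
  have F_pure: "F (?pure \<Theta> \<Phi> \<Xi>) = f_fun G n M \<pi> S N \<Theta> \<Phi> \<Xi>"
    if h: "\<Theta> \<in> HomH" "\<And>i. i \<in> {2..n} \<Longrightarrow> \<Phi> i \<in> HomG i" "\<Xi> \<in> HomK" for \<Theta> \<Phi> \<Xi>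
  proof -
    have "f_fun G n M \<pi> S N \<Theta> \<Phi> \<Xi> = lincomb (\<lambda>z. \<Prod>i=1..n+1. crd \<Theta> \<Phi> \<Xi> i (z i))"
      by (rule f_fun_expand) (use h HomH_iff HomG_iff HomK_iff in blast)+
    thus ?thesis using pureD[OF h] unfolding F_def tcrd_pure by simp
  qed
  have inj: "inj_on F ?D"
  proof (rule inj_onI)
    fix t t' assume t: "t \<in> ?D" "t' \<in> ?D" and eq: "F t = F t'"
    have "t - t' = 0"
    proof (rule tcrd_injective)
      show "t - t' \<in> ?E" using t DE by (intro complex_vector.subspace_diff[OF subE]) auto
      fix z assume z: "z \<in> Lab"
      have "tcrd z t - tcrd z t' = 0"
      proof (rule efun_independent[OF _ z])
        fix g assume "g \<in> Gpow G n"
        have "lincomb (\<lambda>z. tcrd z t) g - lincomb (\<lambda>z. tcrd z t') g = 0" using eq t by (simp add: F_def)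
        thus "(\<Sum>z\<in>Lab. (tcrd z t - tcrd z t') *\<^sub>C efun z g) = 0"
          unfolding lincomb_def by (simp only: complex_vector.scale_left_diff_distrib sum_subtractf)
      qed
      moreover have "tcrd z (t - t' + t') = tcrd z (t - t') + tcrd z t'" by (rule tcrd_add)
      ultimately show "tcrd z (t - t') = 0" by simp
    qed
    thus "t = t'" by simp
  qed
  have surj: "f \<in> F ` ?D" if f: "f \<in> Inv" for f
  proof -
    have "f \<in> range lincomb" using f unfolding gauge_invariants_def vector_valued_eq by blast
    then obtain c where c: "f = lincomb c" by blast
    have slot: "fixed i (\<lambda>a. c (z(i := a)))" if "i \<in> {1..n+1}" "z \<in> Lab" for i z
      by (rule fixed_in_each_slot[OF _ that]) (use invariant_iff[OF c] f in blast)
    (* The matrix of a projection in the slot i has the vectors P i a as its columns. They satisfy the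
       equations of an intertwiner, so they are the coordinates of one. *)
    obtain P where P: "\<And>i a. i \<in> {1..n+1} \<Longrightarrow> P i a \<in> {x. fixed i x}"
      "\<And>z. z \<in> Lab \<Longrightarrow> c z = (\<Sum>w\<in>Lab. c w * (\<Prod>i=1..n+1. P i (w i) (z i)))"
    proof (rule array_of_slices[where I = "{1..n+1}" and Z = Idx and V = "\<lambda>i. {x. fixed i x}" and c = c])
      show "(\<lambda>a. if a \<in> Idx i then c (z(i := a)) else 0) \<in> {x. fixed i x}" if "i \<in> {1..n+1}" "z \<in> Lab" for i z
        using slot[OF that] fixed_cong[of i "\<lambda>a. if a \<in> Idx i then c (z(i := a)) else 0" "\<lambda>a. c (z(i := a))"]
        by simp
      show "finite {1..n+1}" by simp
      show "finite (Idx i)" if "i \<in> {1..n+1}" for i by (rule finite_Idx[OF that])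
      show "csubspace {x. fixed i x}" for i by (rule csubspace_fixed)
    qed (rule that)
    have "\<forall>a. \<exists>\<theta>. \<theta> \<in> Lin (M 1) L \<and> (\<forall>a'\<in>Idx 1. cH \<theta> a' = P 1 a a')"
      using coords_HomH by blast
    from choice[OF this] obtain \<Theta> where
      \<Theta>: "\<And>a. \<Theta> a \<in> Lin (M 1) L" "\<And>a a'. a' \<in> Idx 1 \<Longrightarrow> cH (\<Theta> a) a' = P 1 a a'" by blast
    have "\<exists>\<phi>. \<forall>a. \<phi> a \<in> Lin (M i) (MS i) \<and> (\<forall>a'\<in>Idx i. cG i (\<phi> a) a' = P i a a')"
      if i: "i \<in> {2..n}" for i
    proof (rule choice, rule allI)
      fix a
      show "\<exists>\<phi>. \<phi> \<in> Lin (M i) (MS i) \<and> (\<forall>a'\<in>Idx i. cG i \<phi> a' = P i a a')"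
        using coords_HomG[OF i, of "P i a"] by blast
    qed
    hence "\<forall>i\<in>{2..n}. \<exists>\<phi>. \<forall>a. \<phi> a \<in> Lin (M i) (MS i) \<and> (\<forall>a'\<in>Idx i. cG i (\<phi> a) a' = P i a a')"
      by (rule ballI)
    from bchoice[OF this] obtain \<Phi> where \<Phi>: "\<And>i a. i \<in> {2..n} \<Longrightarrow> \<Phi> i a \<in> Lin (M i) (MS i)"
      "\<And>i a a'. i \<in> {2..n} \<Longrightarrow> a' \<in> Idx i \<Longrightarrow> cG i (\<Phi> i a) a' = P i a a'" by blast
    have "\<forall>a. \<exists>\<xi>. \<xi> \<in> Lin (dual N) (M n) \<and> (\<forall>a'\<in>Idx (n+1). cK \<xi> a' = P (n+1) a a')"
      using coords_HomK by blast
    from choice[OF this] obtain \<Xi> where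
      \<Xi>: "\<And>a. \<Xi> a \<in> Lin (dual N) (M n)" "\<And>a a'. a' \<in> Idx (n+1) \<Longrightarrow> cK (\<Xi> a) a' = P (n+1) a a'" by blast
    have \<Theta>H: "\<Theta> a \<in> HomH" for a
      using \<Theta>(1)[of a] fixed_cong[OF \<Theta>(2)[of _ a]] P(1)[of 1 a] unfolding HomH_iff by simp
    have \<Phi>H: "\<Phi> i a \<in> HomG i" if "i \<in> {2..n}" for i a
      using \<Phi>(1)[OF that, of a] fixed_cong[OF \<Phi>(2)[OF that, of _ a]] P(1)[of i a] that HomG_iff[OF that] by simp
    have \<Xi>H: "\<Xi> a \<in> HomK" for a
      using \<Xi>(1)[of a] fixed_cong[OF \<Xi>(2)[of _ a]] P(1)[of "n+1" a] unfolding HomK_iff by simp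
    let ?p = "\<lambda>w. \<Theta> (w 1) \<otimes>\<^sub>v Tens {2..n} (\<lambda>i. \<Phi> i (w i)) \<otimes>\<^sub>v \<Xi> (w (n+1))"
    define t where "t = (\<Sum>w\<in>Lab. c w *\<^sub>C ?p w)"
    have p: "?p w \<in> ?D" for w by (rule pureD[OF \<Theta>H \<Phi>H \<Xi>H])
    have tD: "t \<in> ?D" unfolding t_def by (rule csubspace_sum[OF subD p])
    have "tcrd z t = c z" if z: "z \<in> Lab" for z
    proof -
      have "tcrd z t = (\<Sum>w\<in>Lab. c w * tcrd z (?p w))"
        unfolding t_def by (simp add: clinear_expand[OF tcrd_lin])
      also have "\<dots> = (\<Sum>w\<in>Lab. c w * (\<Prod>i=1..n+1. P i (w i) (z i)))"
      proof (intro sum.cong refl arg_cong2[of _ _ _ _ times])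
        fix w
        have "crd (\<Theta> (w 1)) (\<lambda>i. \<Phi> i (w i)) (\<Xi> (w (n+1))) i (z i) = P i (w i) (z i)" if i: "i \<in> {1..n+1}" for i
        proof -
          have zi: "z i \<in> Idx i" by (rule PiE_mem[OF z i])
          consider "i = 1" | "i = n + 1" "i \<noteq> 1" | "i \<in> {2..n}" using i by fastforce
          thus ?thesis
            using zi \<Theta>(2) \<Phi>(2) \<Xi>(2) by cases (auto simp: crd_def)
        qed
        thus "tcrd z (?p w) = (\<Prod>i=1..n+1. P i (w i) (z i))" unfolding tcrd_pure by (intro prod.cong refl) simp
      qed
      also have "\<dots> = c z" using P(2)[OF z] by simp
      finally show ?thesis .
    qed
    hence "F t = f" using tD unfolding F_def c lincomb_def by simp
    thus ?thesis using tD by blast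
  qed
  have "F \<in> Lin ?D Inv" by (rule Lin_codomain[OF F_lin F_Inv])
  moreover have "bij_betw F ?D Inv" using inj F_Inv surj unfolding bij_betw_def by blast
  ultimately show ?thesis using F_pure by blast
qed

end

theorem proposition4p18:
  fixes G :: "'g monoid" and T :: "'g topology"
    and \<A> :: "('g set \<times> ('g \<Rightarrow> 'e::real_normed_vector)) set"
    and H K :: "'g set" and n :: nat
    and M :: "nat \<Rightarrow> 'm::complex_vector set" and \<pi> :: "nat \<Rightarrow> 'g \<Rightarrow> 'm \<Rightarrow> 'm"
    and S :: "nat \<Rightarrow> 's::complex_vector set" and \<sigma> :: "nat \<Rightarrow> 'g \<Rightarrow> 's \<Rightarrow> 's"
    and L :: "'l::complex_vector set" and \<tau> :: "'g \<Rightarrow> 'l \<Rightarrow> 'l"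
    and N :: "'n::complex_vector set" and \<nu> :: "'g \<Rightarrow> 'n \<Rightarrow> 'n"
  assumes "n \<ge> 1"
    and "lie_group G T \<A>" and "compact_space T" and "connected_space T"
    and "subgroup H G" and "subgroup K G"
    and "\<And>i. i \<in> {2..n} \<Longrightarrow> fd_rep G (S i) (\<sigma> i) \<and> continuous_rep T (S i) (\<sigma> i)"
    and "fd_rep (G\<lparr>carrier := H\<rparr>) L \<tau>"
    and "fd_rep (G\<lparr>carrier := K\<rparr>) N \<nu>"
    and "\<And>i. i \<in> {1..n} \<Longrightarrow>
           fd_rep G (M i) (\<pi> i) \<and> continuous_rep T (M i) (\<pi> i) \<and> irreducible_rep G (M i) (\<pi> i)"
  defines "HomH \<equiv> Hom_rep (G\<lparr>carrier := H\<rparr>) (M 1) (\<pi> 1) L \<tau>"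
    and "HomG \<equiv> \<lambda>i. Hom_rep G (M i) (\<pi> i)
           (M (i - 1) \<otimes>\<^sub>V S i) (tensor_rep (M (i - 1)) (\<pi> (i - 1)) (S i) (\<sigma> i))"
    and "HomK \<equiv> Hom_rep (G\<lparr>carrier := K\<rparr>) (dual N) (dual_rep (G\<lparr>carrier := K\<rparr>) N \<nu>) (M n) (\<pi> n)"
    and "Inv \<equiv> gauge_invariants G H K n (gauge_rep n L \<tau> S \<sigma> N \<nu>)
           (vector_valued (matrix_coeffs G n M \<pi>) (L \<otimes>\<^sub>V Tensor {2..n} S \<otimes>\<^sub>V N))"
  shows "\<exists>F. F \<in> Lin (HomH \<otimes>\<^sub>V Tensor {2..n} HomG \<otimes>\<^sub>V HomK) Inv \<and>
           bij_betw F (HomH \<otimes>\<^sub>V Tensor {2..n} HomG \<otimes>\<^sub>V HomK) Inv \<and>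
           (\<forall>\<Theta>\<in>HomH. \<forall>\<Phi>. (\<forall>i\<in>{2..n}. \<Phi> i \<in> HomG i) \<longrightarrow> (\<forall>\<Xi>\<in>HomK.
              F (\<Theta> \<otimes>\<^sub>v Tens {2..n} \<Phi> \<otimes>\<^sub>v \<Xi>) = f_fun G n M \<pi> S N \<Theta> \<Phi> \<Xi>))"
proof -
  interpret lie_group G T \<A> by (rule assms(2))
  have G: "group G" by (rule is_group)
  have "\<exists>d b \<beta>. dual_bases (M i) {..<d::nat} b \<beta>" if "i \<in> {1..n}" for i
    using assms(10)[OF that] fin_dim_basis dual_bases_of_basis unfolding fd_rep_def by metis
  then obtain dM bM \<beta>M where M: "\<And>i. i \<in> {1..n} \<Longrightarrow> dual_bases (M i) {..<dM i :: nat} (bM i) (\<beta>M i)"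
    by metis
  have "\<exists>d b \<beta>. dual_bases (S i) {..<d::nat} b \<beta>" if "i \<in> {2..n}" for i
    using assms(7)[OF that] fin_dim_basis dual_bases_of_basis unfolding fd_rep_def by metis
  then obtain dS bS \<beta>S where S: "\<And>i. i \<in> {2..n} \<Longrightarrow> dual_bases (S i) {..<dS i :: nat} (bS i) (\<beta>S i)"
    by metis
  obtain dL bL \<beta>L where L: "dual_bases L {..<dL::nat} bL \<beta>L"
    using assms(8) fin_dim_basis dual_bases_of_basis unfolding fd_rep_def by metis
  define B where "B = (SOME B. finite B \<and> complex_vector.independent B \<and> cspan B = N)"
  have "\<exists>B. finite B \<and> complex_vector.independent B \<and> cspan B = N"
    using assms(9) fin_dim_basis unfolding fd_rep_def by metis
  hence B: "finite B" "complex_vector.independent B" "cspan B = N"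
    unfolding B_def by (metis (mono_tags, lifting) someI_ex)+
  obtain dN bN \<beta>N where N: "dual_bases N {..<dN::nat} bN \<beta>N" "bij_betw bN {..<dN} B"
    "\<And>v j. v \<in> N \<Longrightarrow> j < dN \<Longrightarrow> \<beta>N j v = complex_vector.representation B v (bN j)"
    using dual_bases_of_basis[OF B] by blast
  define I where "I i = (if i \<in> {1..n} then {..<dM i} else {0})" for i
  define J where "J i = (if i = 1 then {..<dL} else if i = n + 1 then {..<dN} else {..<dS i})" for i
  interpret linear_graph G H K n M \<pi> S \<sigma> L \<tau> N \<nu> I J bM \<beta>M bS \<beta>S bL \<beta>L bN \<beta>N
  proof (rule linear_graph.intro)
    show "1 \<le> n" "group G" "subgroup H G" "subgroup K G" by (fact assms G)+
    show "\<pi> i \<in> hom G (GL (M i))" "dual_bases (M i) (I i) (bM i) (\<beta>M i)" if "i \<in> {1..n}" for i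
      using assms(10)[OF that] M[OF that] that by (simp_all add: fd_rep_def I_def)
    show "I 0 = {0}" "I (n+1) = {0}" by (simp_all add: I_def)
    show "fd_rep G (S i) (\<sigma> i)" "dual_bases (S i) (J i) (bS i) (\<beta>S i)" if "i \<in> {2..n}" for i
      using assms(7)[OF that] S[OF that] that by (simp_all add: J_def)
    show "\<tau> \<in> hom (G\<lparr>carrier := H\<rparr>) (GL L)" "dual_bases L (J 1) bL \<beta>L"
      using assms(8) L by (simp_all add: fd_rep_def J_def)
    show "\<nu> \<in> hom (G\<lparr>carrier := K\<rparr>) (GL N)" "dual_bases N (J (n+1)) bN \<beta>N"
      using assms(1,9) N(1) by (simp_all add: fd_rep_def J_def)
    show "a p q = 0" if i: "i \<in> {1..n}" and 0: "\<And>g. g \<in> carrier G \<Longrightarrow>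
        (\<Sum>(p, q)\<in>I i \<times> I i. a p q * \<beta>M i p (\<pi> i g (bM i q))) = 0" and pq: "p \<in> I i" "q \<in> I i" for i a p q
    proof (rule irreducible_matrix_coeffs_independent[OF G M[OF i], where \<rho> = "\<pi> i"])
      show "\<pi> i \<in> hom G (GL (M i))" "irreducible_rep G (M i) (\<pi> i)"
        using assms(10)[OF i] by (simp_all add: fd_rep_def)
      show "(\<Sum>(p, q)\<in>{..<dM i} \<times> {..<dM i}. a p q * \<beta>M i p (\<pi> i g (bM i q))) = 0" if "g \<in> carrier G" for g
        using 0[OF that] i by (simp add: I_def)
      show "p < dM i" "q < dM i" using pq i by (simp_all add: I_def)
    qed
    show "Qmap N t = (\<Sum>r\<in>J (n+1). t (\<lambda>v. if v \<in> N then \<beta>N r v else 0) \<otimes>\<^sub>v bN r)"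
      for t :: "('n \<Rightarrow> complex) \<Rightarrow> ('l, (nat, 's) tensors) tensor2"
    proof -
      have "Qmap N t = (\<Sum>b\<in>B. t (\<lambda>v. complex_vector.representation B v b) \<otimes>\<^sub>v b)"
        unfolding Qmap_def B_def[symmetric] Let_def ..
      also have "\<dots> = (\<Sum>r<dN. t (\<lambda>v. complex_vector.representation B v (bN r)) \<otimes>\<^sub>v bN r)"
        by (rule sum.reindex_bij_betw[OF N(2), symmetric])
      also have "\<dots> = (\<Sum>r<dN. t (\<lambda>v. if v \<in> N then \<beta>N r v else 0) \<otimes>\<^sub>v bN r)"
      proof (intro sum.cong refl arg_cong2[of _ _ _ _ tens] arg_cong[of _ _ t] ext)
        (* Outside N, both sides are 0, on the left as the default value of a representation. *)
        fix r v assume "r \<in> {..<dN}"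
        thus "complex_vector.representation B v (bN r) = (if v \<in> N then \<beta>N r v else 0)"
          using N(3)[of v r] B(3) by (simp add: complex_vector.representation_def)
      qed
      finally show ?thesis using assms(1) by (simp add: J_def)
    qed
  qed
  show ?thesis unfolding HomH_def HomG_def HomK_def Inv_def by (rule isomorphism)
qed

end
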